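(* Let $f = \exp\varphi$ be a log-concave probability density on $\mathbb{R}$, and for each $n>1$ let $\mathbb{F}_n$ be the empirical distribution function of a random sample of size $n$ from $f$, and $\hat F_n$ the distribution function of the log-concave maximum likelihood density estimator $\hat f_n=\exp\hat\varphi_n$ based on that sample. Assume that $\varphi \in \mathcal{H}^{\beta,L}(T)$ for some $\beta \in [1,2]$, some $L>0$ and a compact subinterval $T=[A,B]$ (with $A<B$) of the interior of $\{f>0\}$. Assume further that there is a constant $C>0$ such that $\varphi'(x)-\varphi'(y)\ge C(y-x)$ for arbitrary $A\le x<y\le B$, where $\varphi'$ stands for $\varphi'(\cdot\,-)$ or $\varphi'(\cdot\,+)$. Then, with $\rho_n := \log(n)/n$ and $T(n,\beta) := [A + \rho_n^{1/(2\beta+1)},\, B - \rho_n^{1/(2\beta+1)}]$, as $n\to\infty$, $$\sup_{t \in T(n,\beta)} |\hat F_n(t)-\mathbb{F}_n(t)| = O_{\mathrm{p}}\bigl(\rho_n^{3\beta/(4\beta+2)}\bigr).$$ In particular, if $\beta>1$, then $$\sup_{t \in T(n,\beta)} |\hat F_n(t)-\mathbb{F}_n(t)| = o_{\mathrm{p}}(n^{-1/2}).$$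
   Context: A probability density $f$ on $\mathbb{R}$ is log-concave if $f=\exp\varphi$ for some concave $\varphi:\mathbb{R}\to[-\infty,\infty)$ (with $\exp(-\infty)=0$). For each $n>1$, let $X_1<X_2<\dots<X_n$ be the order statistics of an i.i.d. sample of size $n$ from $f$ (almost surely distinct), with empirical distribution function $\mathbb{F}_n$. For concave $\varphi:\mathbb{R}\to[-\infty,\infty)$ put $\Psi_n(\varphi):=\int\varphi\,d\mathbb{F}_n-\int_{\mathbb{R}}\exp\varphi(x)\,dx$. The estimator $\hat\varphi_n$ is the maximizer of $\Psi_n$ over all concave functions $\mathbb{R}\to[-\infty,\infty)$. It is known that it exists, is unique, is linear on each $[X_j,X_{j+1}]$, $1\le j<n$, and equals $-\infty$ on $\mathbb{R}\setminus[X_1,X_n]$. Put $\hat f_n:=\exp\hat\varphi_n$ and $\hat F_n(x):=\int_{-\infty}^x\hat f_n(r)\,dr$. Hölder classes: for an interval $I$, $\beta\in[1,2]$, $L>0$, a function $g:I\to\mathbb{R}$ belongs to $\mathcal{H}^{\beta,L}(I)$ if for all $x,y\in I$: $|g(x)-g(y)|\le L|x-y|$ in case $\beta=1$; $g$ is differentiable and $|g'(x)-g'(y)|\le L|x-y|^{\beta-1}$ in case $\beta>1$. $\varphi'(x-)$ and $\varphi'(x+)$ denote the left and right derivatives of $\varphi$ at $x$. $Z_n=O_{\mathrm p}(a_n)$ means $\lim_{C\to\infty}\limsup_{n\to\infty}\mathbb{P}(|Z_n|>C a_n)=0$; $Z_n=o_{\mathrm p}(a_n)$ means $Z_n/a_n\to0$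 in probability. The set $T(n,\beta)$ is a non-empty interval for all sufficiently large $n$. *)

theory Defs
  imports "HOL-Probability.Probability"
begin

definition exp_ext :: "ereal \<Rightarrow> real" where
  "exp_ext u = (if u = -\<infinity> then 0 else exp (real_of_ereal u))"

text \<open>
  Concave functions from the real line to \<open>[-\<infinity>, \<infinity>)\<close>.  The weights are restricted to the
  open unit interval because \<open>0 * (-\<infinity>) = 0\<close> in \<^typ>\<open>ereal\<close>.
\<close>

definition concave_ext :: "(real \<Rightarrow> ereal) \<Rightarrow> bool" where
  "concave_ext \<phi> \<longleftrightarrow> (\<forall>x. \<phi> x \<noteq> \<infinity>) \<and>
     (\<forall>x y t. 0 < t \<and> t < 1 \<longrightarrow>
        ereal (1 - t) * \<phi> x + ereal t * \<phi> y \<le> \<phi> ((1 - t) * x + t * y))"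

definition log_concave_density :: "(real \<Rightarrow> real) \<Rightarrow> (real \<Rightarrow> ereal) \<Rightarrow> bool" where
  "log_concave_density f \<phi> \<longleftrightarrow> concave_ext \<phi> \<and> (\<forall>x. f x = exp_ext (\<phi> x)) \<and>
     (\<integral>\<^sup>+ x. ennreal (f x) \<partial>lborel) = 1"

text \<open>A sample of size \<open>n\<close> is a sequence of which only the entries with index below \<open>n\<close> are used.\<close>

definition random_sample ::
  "'w measure \<Rightarrow> (real \<Rightarrow> real) \<Rightarrow> nat \<Rightarrow> (nat \<Rightarrow> 'w \<Rightarrow> real) \<Rightarrow> bool" where
  "random_sample M f n X \<longleftrightarrow> prob_space M \<and>
     prob_space.indep_vars M (\<lambda>_. borel) X {..<n} \<and>
     (\<forall>i<n. distributed M lborel (X i) (\<lambda>x. ennreal (f x)))"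

definition empirical_cdf :: "nat \<Rightarrow> (nat \<Rightarrow> real) \<Rightarrow> real \<Rightarrow> real" where
  "empirical_cdf n x t = real (card {i. i < n \<and> x i \<le> t}) / real n"

text \<open>
  The integral of \<open>\<phi>\<close> with respect to the empirical distribution is the average of \<open>\<phi>\<close> over the
  sample.  No indeterminate difference occurs, since \<open>\<phi> < \<infinity>\<close> for concave \<open>\<phi>\<close>.
\<close>

definition log_lik :: "nat \<Rightarrow> (nat \<Rightarrow> real) \<Rightarrow> (real \<Rightarrow> ereal) \<Rightarrow> ereal" where
  "log_lik n x \<phi> = (\<Sum>i<n. \<phi> (x i)) / ereal (real n)
     - enn2ereal (\<integral>\<^sup>+ r. ennreal (exp_ext (\<phi> r)) \<partial>lborel)"

definition is_log_concave_mle :: "nat \<Rightarrow> (nat \<Rightarrow> real) \<Rightarrow> (real \<Rightarrow> ereal) \<Rightarrow> bool" where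
  "is_log_concave_mle n x \<phi> \<longleftrightarrow> concave_ext \<phi> \<and>
     (\<forall>\<psi>. concave_ext \<psi> \<longrightarrow> log_lik n x \<psi> \<le> log_lik n x \<phi>)"

definition estimated_cdf :: "(real \<Rightarrow> ereal) \<Rightarrow> real \<Rightarrow> real" where
  "estimated_cdf \<phi> t = (LINT r:{..t}|lborel. exp_ext (\<phi> r))"

text \<open>Differentiability at an endpoint contained in \<open>I\<close> is one-sided.\<close>

definition holder_class :: "real \<Rightarrow> real \<Rightarrow> real set \<Rightarrow> (real \<Rightarrow> real) \<Rightarrow> bool" where
  "holder_class \<beta> L I g \<longleftrightarrow>
     (\<beta> = 1 \<longrightarrow> (\<forall>x\<in>I. \<forall>y\<in>I. \<bar>g x - g y\<bar> \<le> L * \<bar>x - y\<bar>)) \<and>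
     (\<beta> > 1 \<longrightarrow> (\<exists>g'. (\<forall>x\<in>I. (g has_real_derivative g' x) (at x within I)) \<and>
        (\<forall>x\<in>I. \<forall>y\<in>I. \<bar>g' x - g' y\<bar> \<le> L * \<bar>x - y\<bar> powr (\<beta> - 1))))"

definition left_deriv :: "(real \<Rightarrow> real) \<Rightarrow> real \<Rightarrow> real" where
  "left_deriv g x = (THE D. (g has_real_derivative D) (at_left x))"

definition right_deriv :: "(real \<Rightarrow> real) \<Rightarrow> real \<Rightarrow> real" where
  "right_deriv g x = (THE D. (g has_real_derivative D) (at_right x))"

text \<open>
  Stochastic order symbols.  Outer probability coincides with probability on measurable events; for
  a non-measurable event \<^const>\<open>emeasure\<close> would be 0 and the bound would say nothing.
\<close>

definition bigO_prob :: "'w measure \<Rightarrow> (nat \<Rightarrow> 'w \<Rightarrow> real) \<Rightarrow> (nat \<Rightarrow> real) \<Rightarrow> bool" where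
  "bigO_prob M Z a \<longleftrightarrow>
     ((\<lambda>C::real. limsup (\<lambda>n. outer_measure_of M {\<omega> \<in> space M. \<bar>Z n \<omega>\<bar> > C * a n})) \<longlongrightarrow> 0) at_top"

definition smallo_prob :: "'w measure \<Rightarrow> (nat \<Rightarrow> 'w \<Rightarrow> real) \<Rightarrow> (nat \<Rightarrow> real) \<Rightarrow> bool" where
  "smallo_prob M Z a \<longleftrightarrow>
     (\<forall>\<epsilon>>0. (\<lambda>n. outer_measure_of M {\<omega> \<in> space M. \<bar>Z n \<omega> / a n\<bar> > \<epsilon>}) \<longlonglongrightarrow> 0)"

definition rho :: "nat \<Rightarrow> real" where
  "rho n = ln (real n) / real n"

definition shrunk_interval :: "real \<Rightarrow> real \<Rightarrow> nat \<Rightarrow> real \<Rightarrow> real set" where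
  "shrunk_interval A B n \<beta> =
     {A + rho n powr (1 / (2 * \<beta> + 1)) .. B - rho n powr (1 / (2 * \<beta> + 1))}"

end

theory Submission
  imports Defs "HOL-Real_Asymp.Real_Asymp"
begin

text \<open>
  Let \<open>D\<close> be the primitive of the difference of the estimated and the empirical distribution function.
  Perturbing the estimator by concave functions gives \<open>D \<le> 0\<close>, with \<open>D = 0\<close> at its kinks.  Between adjacent
  zeros \<open>s < u\<close> of \<open>D\<close> the estimated log-density \<open>G\<close> is affine, so the error of the estimated density is
  \<open>f * g\<close> with \<open>g = exp (G - \<phi>) - 1\<close> convex.  Convexity of \<open>g\<close>, the sign of \<open>D\<close> and its zeros \<open>s, u\<close>
  bound the integral of \<open>\<bar>f * g\<bar>\<close> over \<open>[s, u]\<close> by the modulus of continuity of the empirical process, which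
  is of order \<open>sqrt ((u - s) * rho n) + rho n\<close>; the same then holds for the difference of the distribution
  functions on \<open>[s, u]\<close>.  On the other hand strong concavity of \<open>\<phi>\<close> makes \<open>g\<close> strongly convex, and that
  integral is at least of order \<open>(u - s)\<^sup>3\<close>.  Hence \<open>u - s\<close> is of order \<open>rho n powr (1 / 5)\<close> and the
  distribution functions differ by at most the order \<open>rho n powr (3 / 5)\<close> on all of \<open>[A, B]\<close>.  Since
  \<open>3 * \<beta> / (4 * \<beta> + 2) \<le> 3 / 5\<close> for \<open>\<beta> \<le> 2\<close>, both claims follow.
\<close>

section \<open>Convex functions of one variable\<close>

text \<open>The difficulty is localisation: a gap \<open>[s, u]\<close> between zeros of
  \<open>D\<close> may reach far outside \<open>[A, B]\<close>, where \<open>f\<close> has no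
  positive lower bound and no curvature is available. Estimates are therefore made on the overlap
  \<open>[a0, b0]\<close> of the gap with \<open>[A, B]\<close>, using a margin \<open>c\<close>
  around \<open>[A, B]\<close> on which \<open>m0 \<le> f \<le> M0\<close>. What comes from farther
  out is charged to \<open>Lam\<close>, a bound for the length of the sample range times the modulus
  there. Exponential tails of \<open>f\<close> keep this range of order \<open>ln n\<close>, so
  \<open>Lam = rho n powr (2 / 5)\<close> eventually suffices.

  Since \<open>D\<close> contains the empirical distribution function, it is compared with
  \<open>Q\<close>, the solution of \<open>Q'' = f * g\<close> with zero data at \<open>s\<close>;
  the empirical process enters only through \<open>D - Q\<close>. The sign of \<open>D\<close>
  bounds \<open>Q\<close> from one side, convexity of \<open>g\<close> supplies the other.

  The exponent is a balance. With \<open>r = rho n\<close> and an overlap of length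
  \<open>d\<close>, strong convexity makes \<open>g\<close> vary by the order \<open>d ^ 2\<close>
  in the middle third, while the modulus limits it there to the order
  \<open>sqrt (r * d) / d\<close>; hence \<open>d ^ 5\<close> is of order \<open>r\<close>, and the
  modulus at this length is of order \<open>r powr (3 / 5)\<close>.\<close>

lemma convex_on_three_points:
  fixes g :: "real \<Rightarrow> real"
  assumes "convex_on I g" "p \<in> I" "q \<in> I" "p \<le> x" "x \<le> q"
  shows "(q - p) * g x \<le> (q - x) * g p + (x - p) * g q"
proof (cases "p = q")
  case False
  with assms have pq: "q - p > 0" by simp
  define t where "t = (x - p) / (q - p)"
  have t: "0 \<le> t" "t \<le> 1" using pq assms(4,5) by (auto simp: t_def)
  have "t * (q - p) = x - p" using pq by (simp add: t_def)
  note tq = this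
  then have x: "x = (1 - t) * p + t * q" by (simp add: algebra_simps)
  have "g x \<le> (1 - t) * g p + t * g q"
    using convex_onD[OF assms(1) t assms(2,3)] x by simp
  then have "(q - p) * g x \<le> (q - p) * ((1 - t) * g p + t * g q)"
    using pq by simp
  also have "\<dots> = (q - p) * g p - t * (q - p) * g p + t * (q - p) * g q"
    by (simp add: algebra_simps)
  also have "\<dots> = (q - x) * g p + (x - p) * g q"
    unfolding tq by (simp add: algebra_simps)
  finally show ?thesis .
qed (use assms in simp)

lemma convex_on_le_max:
  fixes g :: "real \<Rightarrow> real"
  assumes "convex_on I g" "p \<in> I" "q \<in> I" "p \<le> x" "x \<le> q"
  shows "g x \<le> max (g p) (g q)"
proof (cases "p = q")
  case False
  with assms have pq: "q - p > 0" by simp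
  have "(q - p) * g x \<le> (q - x) * g p + (x - p) * g q"
    by (rule convex_on_three_points[OF assms])
  also have "\<dots> \<le> (q - x) * max (g p) (g q) + (x - p) * max (g p) (g q)"
    using assms by (intro add_mono mult_left_mono) auto
  also have "\<dots> = (q - p) * max (g p) (g q)" by (simp add: algebra_simps)
  finally show ?thesis using pq by simp
qed (use assms in simp)

text \<open>Smaller values on both sides of \<open>x\<close> would pull \<open>g x\<close> below
  itself. This carries a sign or a bound at one point to a whole side of it.\<close>

lemma convex_on_one_sided_ge:
  fixes g :: "real \<Rightarrow> real"
  assumes "convex_on {s..u} g" "x \<in> {s..u}"
  shows "(\<forall>y\<in>{s..x}. g x \<le> g y) \<or> (\<forall>y\<in>{x..u}. g x \<le> g y)"
proof (rule ccontr)
  assume "\<not> ?thesis"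
  then obtain p q where "p \<in> {s..x}" "q \<in> {x..u}" "g p < g x" "g q < g x"
    by (auto simp: not_le)
  with convex_on_le_max[OF assms(1), of p q x] assms(2) show False by auto
qed

lemma convex_on_antimono_before_min:
  fixes g :: "real \<Rightarrow> real"
  assumes "convex_on {s..u} g" "z \<in> {s..u}" "\<And>y. y \<in> {s..u} \<Longrightarrow> g z \<le> g y"
    and "s \<le> x" "x \<le> y" "y \<le> z"
  shows "g y \<le> g x"
  using convex_on_le_max[OF assms(1), of x z y] assms by force

lemma concave_on_slope_le:
  fixes p :: "real \<Rightarrow> real"
  assumes "concave_on S p" "a \<in> S" "b \<in> S" "a < x" "x < b"
  shows "(p b - p x) / (b - x) \<le> (p x - p a) / (x - a)"
    and "(p b - p x) / (b - x) \<le> (p b - p a) / (b - a)"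
    and "(p b - p a) / (b - a) \<le> (p x - p a) / (x - a)"
proof -
  have "convex_on S (\<lambda>x. - p x)" using assms(1) by (simp add: concave_on_def)
  from convex_on_three_points[OF this assms(2,3), of x] assms(4,5)
  have *: "(b - x) * p a + (x - a) * p b \<le> (b - a) * p x" by simp
  show "(p b - p x) / (b - x) \<le> (p x - p a) / (x - a)"
    "(p b - p x) / (b - x) \<le> (p b - p a) / (b - a)"
    "(p b - p a) / (b - a) \<le> (p x - p a) / (x - a)"
    using * assms(4,5) by (simp_all add: divide_le_eq le_divide_eq pos_divide_le_eq)
      (simp_all add: field_simps)
qed

lemma increment_ge_of_deriv:
  fixes F F' :: "real \<Rightarrow> real"
  assumes "\<And>x. x \<in> {a..b} \<Longrightarrow> (F has_real_derivative F' x) (at x within {a..b})"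
    and "\<And>x. x \<in> {a..b} \<Longrightarrow> c \<le> F' x" and "a \<le> b"
  shows "c * (b - a) \<le> F b - F a"
proof (cases "a = b")
  case False
  with assms have "a < b" by simp
  from mvt_simple[OF this, of F "\<lambda>x. (*) (F' x)"] assms(1)
  obtain x where "x \<in> {a<..<b}" "F b - F a = F' x * (b - a)"
    by (auto simp: has_field_derivative_def)
  with assms(2)[of x] \<open>a < b\<close> show ?thesis by (auto intro: mult_right_mono)
qed simp

lemma increment_le_of_deriv:
  fixes F F' :: "real \<Rightarrow> real"
  assumes "\<And>x. x \<in> {a..b} \<Longrightarrow> (F has_real_derivative F' x) (at x within {a..b})"
    and "\<And>x. x \<in> {a..b} \<Longrightarrow> F' x \<le> c" and "a \<le> b"
  shows "F b - F a \<le> c * (b - a)"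
proof -
  have "- c * (b - a) \<le> - F b - - F a"
    by (rule increment_ge_of_deriv[where F' = "\<lambda>x. - F' x"])
       (use assms in \<open>auto intro!: DERIV_minus\<close>)
  then show ?thesis by simp
qed

lemma taylor_two_lower:
  fixes Q Q1 h :: "real \<Rightarrow> real"
  assumes Q: "\<And>x. x \<in> {a..b} \<Longrightarrow> (Q has_real_derivative Q1 x) (at x within {a..b})"
    and Q1: "\<And>x. x \<in> {a..b} \<Longrightarrow> (Q1 has_real_derivative h x) (at x within {a..b})"
    and h: "\<And>x. x \<in> {a..b} \<Longrightarrow> \<kappa> \<le> h x" and ab: "a \<le> b"
  shows "Q a + Q1 a * (b - a) + \<kappa> * (b - a)\<^sup>2 / 2 \<le> Q b"
    and "Q b - Q1 b * (b - a) + \<kappa> * (b - a)\<^sup>2 / 2 \<le> Q a"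
proof -
  have inc: "\<kappa> * (y - x) \<le> Q1 y - Q1 x" if "a \<le> x" "x \<le> y" "y \<le> b" for x y
    using that h
    by (intro increment_ge_of_deriv[where F' = h])
       (auto intro: has_field_derivative_subset[OF Q1])
  have "0 * (b - a) \<le> (Q b - Q1 a * (b - a) - \<kappa> * (b - a)\<^sup>2 / 2) -
      (Q a - Q1 a * (a - a) - \<kappa> * (a - a)\<^sup>2 / 2)"
  proof (rule increment_ge_of_deriv[where F' = "\<lambda>x. Q1 x - Q1 a - \<kappa> * (x - a)"])
    fix x assume x: "x \<in> {a..b}"
    show "((\<lambda>x. Q x - Q1 a * (x - a) - \<kappa> * (x - a)\<^sup>2 / 2) has_real_derivative
        Q1 x - Q1 a - \<kappa> * (x - a)) (at x within {a..b})"
      using Q[OF x] by (auto intro!: derivative_eq_intros simp: field_simps)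
    show "0 \<le> Q1 x - Q1 a - \<kappa> * (x - a)" using inc[of a x] x by simp
  qed fact
  then show "Q a + Q1 a * (b - a) + \<kappa> * (b - a)\<^sup>2 / 2 \<le> Q b" by simp
  have "(Q b - Q1 b * (b - b) - \<kappa> * (b - b)\<^sup>2 / 2) -
      (Q a - Q1 b * (a - b) - \<kappa> * (a - b)\<^sup>2 / 2) \<le> 0 * (b - a)"
  proof (rule increment_le_of_deriv[where F' = "\<lambda>x. Q1 x - Q1 b - \<kappa> * (x - b)"])
    fix x assume x: "x \<in> {a..b}"
    show "((\<lambda>x. Q x - Q1 b * (x - b) - \<kappa> * (x - b)\<^sup>2 / 2) has_real_derivative
        Q1 x - Q1 b - \<kappa> * (x - b)) (at x within {a..b})"
      using Q[OF x] by (auto intro!: derivative_eq_intros simp: field_simps)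
    show "Q1 x - Q1 b - \<kappa> * (x - b) \<le> 0" using inc[of x b] x by (simp add: algebra_simps)
  qed fact
  then show "Q b - Q1 b * (b - a) + \<kappa> * (b - a)\<^sup>2 / 2 \<le> Q a"
    by (simp add: algebra_simps power2_commute)
qed

lemma second_difference_lower:
  fixes Q Q1 h :: "real \<Rightarrow> real"
  assumes Q: "\<And>x. x \<in> {p - d..p + d} \<Longrightarrow> (Q has_real_derivative Q1 x) (at x within {p - d..p + d})"
    and Q1: "\<And>x. x \<in> {p - d..p + d} \<Longrightarrow> (Q1 has_real_derivative h x) (at x within {p - d..p + d})"
    and h: "\<And>x. x \<in> {p - d..p + d} \<Longrightarrow> \<kappa> \<le> h x" and d: "0 \<le> d"
  shows "\<kappa> * d\<^sup>2 \<le> Q (p + d) - 2 * Q p + Q (p - d)"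
proof -
  have "Q p + Q1 p * (p + d - p) + \<kappa> * (p + d - p)\<^sup>2 / 2 \<le> Q (p + d)"
    by (rule taylor_two_lower(1)[where h = h])
       (use d h in \<open>auto intro: has_field_derivative_subset[OF Q] has_field_derivative_subset[OF Q1]\<close>)
  moreover have "Q p - Q1 p * (p - (p - d)) + \<kappa> * (p - (p - d))\<^sup>2 / 2 \<le> Q (p - d)"
    by (rule taylor_two_lower(2)[where h = h])
       (use d h in \<open>auto intro: has_field_derivative_subset[OF Q] has_field_derivative_subset[OF Q1]\<close>)
  ultimately show ?thesis by simp
qed

lemma second_difference_upper:
  fixes Q Q1 h :: "real \<Rightarrow> real"
  assumes Q: "\<And>x. x \<in> {p - d..p + d} \<Longrightarrow> (Q has_real_derivative Q1 x) (at x within {p - d..p + d})"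
    and Q1: "\<And>x. x \<in> {p - d..p + d} \<Longrightarrow> (Q1 has_real_derivative h x) (at x within {p - d..p + d})"
    and h: "\<And>x. x \<in> {p - d..p + d} \<Longrightarrow> h x \<le> \<kappa>" and d: "0 \<le> d"
  shows "Q (p + d) - 2 * Q p + Q (p - d) \<le> \<kappa> * d\<^sup>2"
proof -
  have "- \<kappa> * d\<^sup>2 \<le> - Q (p + d) - 2 * (- Q p) + - Q (p - d)"
    by (rule second_difference_lower[where ?Q1.0 = "\<lambda>x. - Q1 x" and h = "\<lambda>x. - h x"])
       (use assms in \<open>auto intro!: DERIV_minus\<close>)
  then show ?thesis by simp
qed

text \<open>Modulus of continuity of the empirical process at noise level \<open>r\<close>:
  \<open>sqrt (r * d)\<close> is the Gaussian size of an increment over length \<open>d\<close>, and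
  \<open>r\<close> takes over when \<open>d < r\<close>. It increases in \<open>d\<close> while its
  quotient by \<open>d\<close> decreases; comparisons between different lengths rest on these two
  facts.\<close>

definition emp_modulus :: "real \<Rightarrow> real \<Rightarrow> real \<Rightarrow> real" where
  "emp_modulus k r d = k * (sqrt (r * d) + r)"

lemma emp_modulus_nonneg: "0 \<le> k \<Longrightarrow> 0 \<le> r \<Longrightarrow> 0 \<le> d \<Longrightarrow> 0 \<le> emp_modulus k r d"
  by (simp add: emp_modulus_def)

lemma emp_modulus_mono:
  "0 \<le> k \<Longrightarrow> 0 \<le> r \<Longrightarrow> d \<le> d' \<Longrightarrow> emp_modulus k r d \<le> emp_modulus k r d'"
  by (simp add: emp_modulus_def mult_left_mono)

lemma emp_modulus_div_antimono:
  assumes "0 \<le> k" "0 \<le> r" "0 < d" "d \<le> d'"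
  shows "d * emp_modulus k r d' \<le> d' * emp_modulus k r d"
proof -
  have "d * sqrt d' = sqrt d * (sqrt d * sqrt d')" using assms by simp
  also have "\<dots> \<le> sqrt d' * (sqrt d * sqrt d')"
    using assms by (intro mult_right_mono) auto
  also have "\<dots> = d' * sqrt d" using assms by simp
  finally have "k * sqrt r * (d * sqrt d') \<le> k * sqrt r * (d' * sqrt d)"
    using assms by (intro mult_left_mono) auto
  moreover have "k * r * d \<le> k * r * d'" using assms by (intro mult_left_mono) auto
  ultimately show ?thesis by (simp add: emp_modulus_def real_sqrt_mult algebra_simps)
qed

lemma emp_modulus_double:
  assumes "0 \<le> k" "0 \<le> r" "0 \<le> d"
  shows "emp_modulus k r (2 * d) \<le> 2 * emp_modulus k r d"
proof (cases "d = 0")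
  case False
  with assms emp_modulus_div_antimono[of k r d "2 * d"] show ?thesis by simp
qed (use assms in \<open>simp add: emp_modulus_def\<close>)

section \<open>Affine pieces of the estimator\<close>

text \<open>The first summand serves pieces with \<open>A - c \<le> s\<close>, the second those that
  start farther left.\<close>

definition pos_const :: "real \<Rightarrow> real \<Rightarrow> real \<Rightarrow> real" where
  "pos_const c m0 M0 = 4 * (1 + M0 / m0) + 2 * M0 / (m0 * c\<^sup>2)"

text \<open>\<open>pos_const\<close> counts once for each side of the minimum of \<open>g\<close>;
  the last summand is \<open>M0\<close> times the constant of \<open>g_lower\<close>.\<close>

definition inc_const :: "real \<Rightarrow> real \<Rightarrow> real \<Rightarrow> real" where
  "inc_const c m0 M0 = 2 * pos_const c m0 M0 + 2048 * M0 / (m0 * c\<^sup>2)"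

text \<open>The first two summands come from the upper bound \<open>g_upper_middle\<close>, the last
  one from \<open>g_lower\<close>.\<close>

definition mid_const :: "real \<Rightarrow> real \<Rightarrow> real" where
  "mid_const c m0 = 6 / m0 + 2 / (m0 * c\<^sup>2) + 2048 / (m0 * c\<^sup>2)"

text \<open>The analytic content of one affine piece between contact points \<open>s\<close> and
  \<open>u\<close>. \<open>Q\<close> is the double primitive of \<open>f * g\<close> started at
  \<open>s\<close>, and \<open>Q x - Q u - (x - u) * Q1 u\<close> is the one started at
  \<open>u\<close>. The upper bounds \<open>Q_up\<close> and \<open>R_up\<close> reflect
  \<open>D \<le> 0\<close>, the lower bounds \<open>Q_u\<close> and \<open>R_s\<close> reflect
  \<open>D = 0\<close> at the opposite end.\<close>

locale affine_piece =
  fixes s u A B c m0 M0 k r Lam :: real and f g Q Q1 :: "real \<Rightarrow> real"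
  assumes su: "s < u" and c: "0 < c" "c \<le> 1" and m0: "0 < m0" and k: "0 < k" and r: "0 \<le> r"
    and AB: "max s A \<le> min u B"
    and f_pos: "\<And>x. x \<in> {s..u} \<Longrightarrow> 0 < f x"
    and f_low: "\<And>x. x \<in> {s..u} \<Longrightarrow> A - c \<le> x \<Longrightarrow> x \<le> B + c \<Longrightarrow> m0 \<le> f x"
    and f_up: "\<And>x. x \<in> {s..u} \<Longrightarrow> A - c \<le> x \<Longrightarrow> x \<le> B + c \<Longrightarrow> f x \<le> M0"
    and g_convex: "convex_on {s..u} g" and g_cont: "continuous_on {s..u} g"
    and dQ: "\<And>x. x \<in> {s..u} \<Longrightarrow> (Q has_real_derivative Q1 x) (at x within {s..u})"
    and dQ1: "\<And>x. x \<in> {s..u} \<Longrightarrow> (Q1 has_real_derivative f x * g x) (at x within {s..u})"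
    and Q_s: "Q s = 0" and Q1_s: "Q1 s = 0"
    and Q_up: "\<And>x. x \<in> {s..u} \<Longrightarrow> Q x \<le> (x - s) * emp_modulus k r (x - s)"
    and R_up: "\<And>x. x \<in> {s..u} \<Longrightarrow> Q x - Q u - (x - u) * Q1 u \<le> (u - x) * emp_modulus k r (u - x)"
    and Q_u: "- ((u - s) * emp_modulus k r (u - s)) \<le> Q u"
    and R_s: "- ((u - s) * emp_modulus k r (u - s)) \<le> (u - s) * Q1 u - Q u"
    and Lam: "(u - s) * emp_modulus k r (u - s) \<le> Lam"
begin

text \<open>The hypotheses are invariant under \<open>x \<mapsto> - x\<close>, which exchanges the
  double primitives started at \<open>s\<close> and at \<open>u\<close>. Every estimate made from
  one end thus holds from the other.\<close>

lemma reflected: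
  "affine_piece (- u) (- s) (- B) (- A) c m0 M0 k r Lam (\<lambda>x. f (- x)) (\<lambda>x. g (- x))
     (\<lambda>x. Q (- x) - Q u - (- x - u) * Q1 u) (\<lambda>x. Q1 u - Q1 (- x))"
proof
  have im: "uminus ` {- u..- s} = {s..u}" by simp
  show "convex_on {- u..- s} (\<lambda>x. g (- x))"
  proof (rule convex_onI)
    fix t x y :: real assume "0 < t" "t < 1" "x \<in> {- u..- s}" "y \<in> {- u..- s}"
    then show "g (- ((1 - t) *\<^sub>R x + t *\<^sub>R y)) \<le> (1 - t) * g (- x) + t * g (- y)"
      using convex_onD[OF g_convex, of t "- x" "- y"] by (simp add: algebra_simps)
  qed simp
  show "continuous_on {- u..- s} (\<lambda>x. g (- x))"
    by (rule continuous_on_compose2[OF g_cont]) (auto intro!: continuous_intros)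
  show "((\<lambda>x. Q (- x) - Q u - (- x - u) * Q1 u) has_real_derivative Q1 u - Q1 (- x))
      (at x within {- u..- s})" if "x \<in> {- u..- s}" for x
  proof -
    have "((\<lambda>x. Q (- x)) has_real_derivative Q1 (- x) * (- 1)) (at x within {- u..- s})"
      using that dQ[of "- x"]
      by (intro DERIV_image_chain[of Q _ uminus, unfolded o_def im]) (auto intro!: derivative_eq_intros)
    then show ?thesis by (auto intro!: derivative_eq_intros)
  qed
  show "((\<lambda>x. Q1 u - Q1 (- x)) has_real_derivative f (- x) * g (- x)) (at x within {- u..- s})"
    if "x \<in> {- u..- s}" for x
  proof -
    have "((\<lambda>x. Q1 (- x)) has_real_derivative (f (- x) * g (- x)) * (- 1)) (at x within {- u..- s})"
      using that dQ1[of "- x"]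
      by (intro DERIV_image_chain[of Q1 _ uminus, unfolded o_def im]) (auto intro!: derivative_eq_intros)
    then show ?thesis by (auto intro!: derivative_eq_intros)
  qed
  show "Q (- x) - Q u - (- x - u) * Q1 u \<le> (x - - u) * emp_modulus k r (x - - u)"
    if "x \<in> {- u..- s}" for x
    using R_up[of "- x"] that by (simp add: algebra_simps)
  show "Q (- x) - Q u - (- x - u) * Q1 u - (Q (- (- s)) - Q u - (- (- s) - u) * Q1 u) -
      (x - - s) * (Q1 u - Q1 (- (- s))) \<le> (- s - x) * emp_modulus k r (- s - x)"
    if "x \<in> {- u..- s}" for x
  proof -
    have "Q (- x) - Q u - (- x - u) * Q1 u - (Q (- (- s)) - Q u - (- (- s) - u) * Q1 u) -
      (x - - s) * (Q1 u - Q1 (- (- s))) = Q (- x)"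
      by (simp add: algebra_simps Q_s Q1_s)
    moreover have "- s - x = - x - s" by simp
    moreover have "Q (- x) \<le> (- x - s) * emp_modulus k r (- x - s)" using Q_up[of "- x"] that by simp
    ultimately show ?thesis by metis
  qed
qed (use su c m0 k r AB Q_u R_s Lam f_pos f_low f_up Q_s Q1_s in \<open>auto simp: algebra_simps\<close>)

abbreviation "w \<equiv> emp_modulus k r"
abbreviation "N \<equiv> (u - s) * w (u - s)"
abbreviation "a0 \<equiv> max s A"
abbreviation "b0 \<equiv> min u B"

lemma w_nonneg: "0 \<le> d \<Longrightarrow> 0 \<le> w d" using k r by (simp add: emp_modulus_nonneg)

lemma w_mono: "d \<le> d' \<Longrightarrow> w d \<le> w d'" using k r by (simp add: emp_modulus_mono)

lemma N_nonneg: "0 \<le> N" using su w_nonneg[of "u - s"] by simp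

lemma Lam_nonneg: "0 \<le> Lam" using N_nonneg Lam by linarith

lemma dw_le_N: "0 \<le> d \<Longrightarrow> d \<le> u - s \<Longrightarrow> d * w d \<le> N"
  by (intro mult_mono w_mono w_nonneg) auto

lemma dQ_sub: "{p..q} \<subseteq> {s..u} \<Longrightarrow> x \<in> {p..q} \<Longrightarrow> (Q has_real_derivative Q1 x) (at x within {p..q})"
  by (rule has_field_derivative_subset[OF dQ]) auto

lemma dQ1_sub: "{p..q} \<subseteq> {s..u} \<Longrightarrow> x \<in> {p..q} \<Longrightarrow> (Q1 has_real_derivative f x * g x) (at x within {p..q})"
  by (rule has_field_derivative_subset[OF dQ1]) auto

section \<open>Two-sided bounds for \<open>Q\<close> and pointwise bounds for
  \<open>g\<close>\<close>

lemma nonneg_start: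
  assumes "x \<in> {s..u}" "\<And>y. y \<in> {s..x} \<Longrightarrow> 0 \<le> g y"
  shows "0 \<le> Q x" "0 \<le> Q1 x"
proof -
  have sub: "{s..x} \<subseteq> {s..u}" using assms by auto
  have h: "0 \<le> f y * g y" if "y \<in> {s..x}" for y
    using assms f_pos[of y] that by (auto intro!: mult_nonneg_nonneg less_imp_le)
  have "Q s + Q1 s * (x - s) + 0 * (x - s)\<^sup>2 / 2 \<le> Q x"
    by (rule taylor_two_lower(1)[OF dQ_sub[OF sub] dQ1_sub[OF sub] h]) (use assms in auto)
  then show "0 \<le> Q x" by (simp add: Q_s Q1_s)
  have "0 * (x - s) \<le> Q1 x - Q1 s"
    by (rule increment_ge_of_deriv[OF dQ1_sub[OF sub] h]) (use assms in auto)
  then show "0 \<le> Q1 x" by (simp add: Q1_s)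
qed

lemma nonneg_end:
  assumes "x \<in> {s..u}" "\<And>y. y \<in> {x..u} \<Longrightarrow> 0 \<le> g y"
  shows "0 \<le> Q x - Q u - (x - u) * Q1 u"
  using affine_piece.nonneg_start(1)[OF reflected, of "- x"] assms by auto

lemma Q_le_N: "x \<in> {s..u} \<Longrightarrow> Q x \<le> N"
  using Q_up[of x] dw_le_N[of "x - s"] by auto

text \<open>A lower bound for \<open>Q\<close> is given only at the ends. At an interior minimum
  \<open>z\<close> the first and second derivative tests give \<open>Q1 z = 0\<close> and
  \<open>0 \<le> g z\<close>; convexity keeps \<open>g\<close> nonnegative on one whole side of
  \<open>z\<close>, where the double primitive started at that end is nonnegative.\<close>

lemma Q_ge_N:
  assumes x: "x \<in> {s..u}"
  shows "- N \<le> Q x"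
proof -
  have "continuous_on {s..u} Q" using dQ DERIV_continuous_on by blast
  with su obtain z where z: "z \<in> {s..u}" and min: "\<And>y. y \<in> {s..u} \<Longrightarrow> Q z \<le> Q y"
    using continuous_attains_inf[of "{s..u}" Q] by auto
  have "- N \<le> Q z"
  proof (cases "z = s \<or> z = u")
    case True
    then show ?thesis using Q_s N_nonneg Q_u by auto
  next
    case False
    then have zi: "s < z" "z < u" using z by auto
    have at: "(at z within {s..u}) = at z"
      using zi by (intro at_within_interior) (simp add: interior_atLeastAtMost_real)
    have Dz: "(Q has_real_derivative Q1 z) (at z)" "(Q1 has_real_derivative f z * g z) (at z)"
      using dQ[OF z] dQ1[OF z] by (simp_all add: at)
    have "Q1 z = 0"
    proof (rule DERIV_local_min[OF Dz(1)])
      show "0 < min (z - s) (u - z)" using zi by simp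
      show "\<forall>y. \<bar>z - y\<bar> < min (z - s) (u - z) \<longrightarrow> Q z \<le> Q y" using min by (auto simp: abs_if split: if_splits)
    qed
    \<comment> \<open>If \<open>g z < 0\<close>, then \<open>Q1\<close> is negative just to the
      right of \<open>z\<close>, and \<open>Q\<close> falls below its minimum.\<close>
    have "0 \<le> g z"
    proof (rule ccontr)
      assume "\<not> 0 \<le> g z"
      then have "f z * g z < 0" using f_pos[OF z] by (simp add: mult_pos_neg)
      from DERIV_neg_dec_right[OF Dz(2) this] obtain e
        where e: "e > 0" "\<And>h. 0 < h \<Longrightarrow> h < e \<Longrightarrow> Q1 (z + h) < Q1 z" by blast
      define q where "q = z + min (e / 2) (u - z)"
      have q: "z < q" "q \<le> u" "q < z + e" using e zi by (auto simp: q_def)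
      have "\<exists>x\<in>{z<..<q}. Q q - Q z = Q1 x * (q - z)"
        using mvt_simple[OF q(1), of Q "\<lambda>x. (*) (Q1 x)"] dQ_sub[of z q] q z
        by (auto simp: has_field_derivative_def)
      then obtain y where y: "z < y" "y < q" "Q q - Q z = Q1 y * (q - z)" by auto
      have "Q1 y < 0" using e(2)[of "y - z"] y q \<open>Q1 z = 0\<close> by auto
      then have "Q q < Q z" using y q by (smt (verit) mult_neg_pos)
      with min[of q] q zi show False by auto
    qed
    with convex_on_one_sided_ge[OF g_convex z]
    consider "\<forall>y\<in>{s..z}. 0 \<le> g y" | "\<forall>y\<in>{z..u}. 0 \<le> g y" by force
    then show ?thesis
    proof cases
      case 1
      then show ?thesis using nonneg_start(1)[OF z] N_nonneg by auto
    next
      case 2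
      then have R: "0 \<le> Q z - Q u - (z - u) * Q1 u" using nonneg_end[OF z] by auto
      \<comment> \<open>By \<open>R\<close>, \<open>Q z\<close> lies above the tangent of
        \<open>Q\<close> at \<open>u\<close>. This tangent is at least \<open>- N\<close> at
        \<open>s\<close> by \<open>R_up\<close> and at \<open>u\<close> by \<open>Q_u\<close>, hence
        also at \<open>z\<close> between them.\<close>
      have "- Q u - (s - u) * Q1 u \<le> N" using R_up[of s] su by (simp add: Q_s)
      then have "(u - z) * (- N) \<le> (u - z) * (Q u + (s - u) * Q1 u)"
        using zi by (intro mult_left_mono) auto
      moreover have "(z - s) * (- N) \<le> (z - s) * Q u"
        using zi Q_u by (intro mult_left_mono) auto
      ultimately have "(u - s) * (- N) \<le> (u - s) * (Q u + (z - u) * Q1 u)"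
        by (simp add: algebra_simps)
      then have "- N \<le> Q u + (z - u) * Q1 u" using su by (meson diff_gt_0_iff_gt mult_le_cancel_left_pos)
      with R show ?thesis by linarith
    qed
  qed
  then show ?thesis using min[OF x] by linarith
qed

text \<open>The second difference of \<open>Q\<close> with step \<open>d\<close> is a weighted
  integral of \<open>f * g\<close> over the window, yet \<open>\<bar>Q\<bar> \<le> N\<close> limits
  it to \<open>4 * N\<close>.\<close>

lemma not_above_on:
  assumes "s \<le> p - d" "p + d \<le> u" "A - c \<le> p - d" "p + d \<le> B + c" "0 < d" "0 \<le> m"
    and "\<And>x. x \<in> {p - d..p + d} \<Longrightarrow> m \<le> g x"
  shows "m0 * m * d\<^sup>2 \<le> 4 * N"
proof -
  have sub: "{p - d..p + d} \<subseteq> {s..u}" using assms by auto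
  have "m0 * m * d\<^sup>2 \<le> Q (p + d) - 2 * Q p + Q (p - d)"
  proof (rule second_difference_lower[OF dQ_sub[OF sub] dQ1_sub[OF sub]])
    fix x assume "x \<in> {p - d..p + d}"
    then show "m0 * m \<le> f x * g x" using assms f_low[of x] m0 by (intro mult_mono) auto
  qed (use assms in auto)
  also have "\<dots> \<le> N + 2 * N + N"
    using Q_le_N[of "p + d"] Q_ge_N[of p] Q_le_N[of "p - d"] assms by force
  finally show ?thesis by simp
qed

lemma not_below_on:
  assumes "s \<le> p - d" "p + d \<le> u" "A - c \<le> p - d" "p + d \<le> B + c" "0 < d" "0 \<le> m"
    and "\<And>x. x \<in> {p - d..p + d} \<Longrightarrow> g x \<le> - m"
  shows "m0 * m * d\<^sup>2 \<le> 4 * N"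
proof -
  have sub: "{p - d..p + d} \<subseteq> {s..u}" using assms by auto
  have "Q (p + d) - 2 * Q p + Q (p - d) \<le> - (m0 * m) * d\<^sup>2"
  proof (rule second_difference_upper[OF dQ_sub[OF sub] dQ1_sub[OF sub]])
    fix x assume x: "x \<in> {p - d..p + d}"
    then have "m0 * m \<le> f x * (- g x)"
      using assms(1-6) assms(7)[OF x] x f_low[of x] m0 by (intro mult_mono) auto
    then show "f x * g x \<le> - (m0 * m)" by simp
  qed (use assms in auto)
  moreover have "- N - 2 * N - N \<le> Q (p + d) - 2 * Q p + Q (p - d)"
    using Q_ge_N[of "p + d"] Q_le_N[of p] Q_ge_N[of "p - d"] assms by force
  ultimately show ?thesis by simp
qed

text \<open>Let \<open>g x = - m\<close> with \<open>0 < m\<close>. Either \<open>g\<close> stays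
  below \<open>- (m / 2)\<close> on \<open>[x, x + 2 * d]\<close>, or its slope from
  \<open>x\<close> to \<open>x + 2 * d\<close> exceeds \<open>m / (4 * d)\<close> and convexity
  lifts it above \<open>m / 2\<close> on \<open>[x + 6 * d, x + 8 * d]\<close>. In both cases a
  window of half-width \<open>d\<close> bounds \<open>m\<close>; this is why room
  \<open>8 * d\<close> is required.\<close>

lemma g_lower_right:
  assumes "s \<le> x" "A - c \<le> x" "x + 8 * d \<le> u" "x + 8 * d \<le> B + c" "0 < d"
  shows "- (8 * N / (m0 * d\<^sup>2)) \<le> g x"
proof (cases "g x < 0")
  case True
  define m where "m = - g x"
  have m: "m > 0" using True by (simp add: m_def)
  have gx: "g x = - m" by (simp add: m_def)
  have "m0 * (m / 2) * d\<^sup>2 \<le> 4 * N"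
  proof (cases "g (x + 2 * d) \<le> - (m / 2)")
    case True
    have "g y \<le> - (m / 2)" if "y \<in> {x + d - d..x + d + d}" for y
      using convex_on_le_max[OF g_convex, of x "x + 2 * d" y] that assms True m by (auto simp: m_def)
    with not_below_on[of "x + d" d "m / 2"] assms m show ?thesis by auto
  next
    case False
    have "m / 2 \<le> g y" if y: "y \<in> {x + 7 * d - d..x + 7 * d + d}" for y
    proof -
      have "(y - x) * g (x + 2 * d) \<le> (y - (x + 2 * d)) * g x + (x + 2 * d - x) * g y"
        by (rule convex_on_three_points[OF g_convex]) (use y assms in auto)
      moreover have "(y - x) * (- (m / 2)) \<le> (y - x) * g (x + 2 * d)"
        using y assms False by (intro mult_left_mono) auto
      ultimately have "(y - x) * (m / 2) - 2 * d * m \<le> 2 * d * g y"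
        unfolding gx by argo
      moreover have "6 * d * (m / 2) \<le> (y - x) * (m / 2)"
        using y m by (intro mult_right_mono) auto
      ultimately have "2 * d * (m / 2) \<le> 2 * d * g y" by (simp add: algebra_simps)
      then show ?thesis using assms by simp
    qed
    with not_above_on[of "x + 7 * d" d "m / 2"] assms m show ?thesis by auto
  qed
  then have "m \<le> 8 * N / (m0 * d\<^sup>2)" using m0 assms by (simp add: field_simps)
  then show ?thesis by (simp add: m_def)
next
  case False
  have "0 \<le> 8 * N / (m0 * d\<^sup>2)" using m0 N_nonneg by simp
  with False show ?thesis by linarith
qed

lemma g_lower_left:
  assumes "x \<le> u" "x \<le> B + c" "s \<le> x - 8 * d" "A - c \<le> x - 8 * d" "0 < d"
  shows "- (8 * N / (m0 * d\<^sup>2)) \<le> g x"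
  using affine_piece.g_lower_right[OF reflected, of "- x" d] assms by (simp add: algebra_simps)

text \<open>In the part of the piece within \<open>[A - c, B + c]\<close>, of length
  \<open>l\<close>, some side of \<open>x\<close> offers room \<open>l / 2 = 8 * d\<close>, so one
  of the two preceding bounds applies; \<open>8 * 16 ^ 2\<close> gives 2048.\<close>

lemma g_lower:
  assumes x: "x \<in> {a0..b0}" and a: "a0 < b0"
  shows "- (2048 / (m0 * c\<^sup>2) * (w (b0 - a0) / (b0 - a0) + Lam)) \<le> g x"
proof -
  define l where "l = min u (B + c) - max s (A - c)"
  define d where "d = l / 16"
  have l: "l > 0" using a c by (auto simp: l_def)
  have d: "d > 0" using l by (simp add: d_def)
  have "x + 8 * d \<le> min u (B + c) \<or> max s (A - c) \<le> x - 8 * d"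
    unfolding d_def l_def by (cases "x \<le> (min u (B + c) + max s (A - c)) / 2") argo+
  then have "- (8 * N / (m0 * d\<^sup>2)) \<le> g x"
    using g_lower_right[of x d] g_lower_left[of x d] x c d by auto
  moreover have "8 * N / (m0 * d\<^sup>2) = 2048 / m0 * (N / l\<^sup>2)"
    by (simp add: d_def power2_eq_square)
  \<comment> \<open>Either the whole piece lies within the margin, \<open>l = u - s\<close>, and the
    decreasing quotient \<open>w d / d\<close> passes to the shorter length \<open>b0 - a0\<close>;
    or the piece crosses the margin, so that \<open>c \<le> l\<close> and \<open>N \<le> Lam\<close>
    is enough.\<close>
  moreover have "N / l\<^sup>2 \<le> 1 / c\<^sup>2 * (w (b0 - a0) / (b0 - a0) + Lam)"
  proof (cases "A - c \<le> s \<and> u \<le> B + c")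
    case True
    then have ls: "l = u - s" by (simp add: l_def)
    have "(b0 - a0) * w (u - s) \<le> (u - s) * w (b0 - a0)"
      using k r a by (intro emp_modulus_div_antimono) auto
    then have le: "w (u - s) / (u - s) \<le> w (b0 - a0) / (b0 - a0)"
      using a su by (simp add: field_simps)
    have "N / l\<^sup>2 = w (u - s) / (u - s)" using su by (simp add: ls power2_eq_square)
    also note le
    also have "w (b0 - a0) / (b0 - a0) \<le> 1 * (w (b0 - a0) / (b0 - a0) + Lam)"
      using Lam_nonneg by simp
    also have "\<dots> \<le> 1 / c\<^sup>2 * (w (b0 - a0) / (b0 - a0) + Lam)"
      using c a w_nonneg[of "b0 - a0"] Lam_nonneg
      by (intro mult_right_mono add_nonneg_nonneg divide_nonneg_nonneg) (auto simp: power_le_one)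
    finally show ?thesis .
  next
    case False
    then have lc: "c \<le> l" using AB c by (auto simp: l_def)
    have "N / l\<^sup>2 \<le> Lam / c\<^sup>2"
      using Lam Lam_nonneg lc c N_nonneg by (intro frac_le) (auto intro: power_mono)
    also have "\<dots> = 1 / c\<^sup>2 * Lam" by simp
    also have "\<dots> \<le> 1 / c\<^sup>2 * (w (b0 - a0) / (b0 - a0) + Lam)"
      using a w_nonneg[of "b0 - a0"] by (intro mult_left_mono) auto
    finally show ?thesis .
  qed
  ultimately have "8 * N / (m0 * d\<^sup>2) \<le> 2048 / m0 * (1 / c\<^sup>2 * (w (b0 - a0) / (b0 - a0) + Lam))"
    using m0 by (metis divide_nonneg_pos mult_left_mono zero_le_numeral)
  with \<open>- (8 * N / (m0 * d\<^sup>2)) \<le> g x\<close> show ?thesis by (simp add: field_simps)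
qed

text \<open>A function \<open>g\<close> that stays above \<open>g x \<ge> 0\<close> left of
  \<open>x\<close> forces \<open>Q x\<close> to be at least
  \<open>m0 * g x * (x - p)\<^sup>2 / 2\<close>. This is compared with \<open>Q_up\<close> for
  \<open>p = s\<close>, and with \<open>Q x \<le> Lam\<close> for \<open>p = A - c\<close>, where
  \<open>c \<le> x - p\<close>.\<close>

lemma g_upper_right:
  assumes x: "s < x" "x \<in> {a0..b0}" and ge: "\<And>y. y \<in> {s..x} \<Longrightarrow> g x \<le> g y" and g: "0 \<le> g x"
  shows "A - c \<le> s \<Longrightarrow> g x \<le> 2 * w (x - s) / (m0 * (x - s))"
    and "s < A - c \<Longrightarrow> g x \<le> 2 * Lam / (m0 * c\<^sup>2)"
proof -
  have xu: "x \<in> {s..u}" using x by auto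
  have lower: "m0 * g x * (x - p)\<^sup>2 / 2 \<le> Q x" if p: "s \<le> p" "A - c \<le> p" "p \<le> x" for p
  proof -
    have pu: "p \<in> {s..u}" using p xu by auto
    have gp: "0 \<le> g y" if "y \<in> {s..p}" for y
      using that p g ge[of y] by auto
    have p0: "0 \<le> Q p" "0 \<le> Q1 p" using nonneg_start[OF pu gp] by auto
    have sub: "{p..x} \<subseteq> {s..u}" using p xu by auto
    have "Q p + Q1 p * (x - p) + m0 * g x * (x - p)\<^sup>2 / 2 \<le> Q x"
    proof (rule taylor_two_lower(1)[OF dQ_sub[OF sub] dQ1_sub[OF sub]])
      fix y assume "y \<in> {p..x}"
      then show "m0 * g x \<le> f y * g y"
        using p x xu c g m0 f_low[of y] ge[of y] by (intro mult_mono) auto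
    qed (use p in auto)
    then show ?thesis using p0 p by (smt (verit) mult_nonneg_nonneg)
  qed
  show "g x \<le> 2 * w (x - s) / (m0 * (x - s))" if "A - c \<le> s"
  proof -
    have "m0 * g x * (x - s)\<^sup>2 / 2 \<le> (x - s) * w (x - s)"
      using lower[of s] that x Q_up[OF xu] by auto
    moreover have "m0 * g x * (x - s)\<^sup>2 = (x - s) * (m0 * g x * (x - s))"
      by (simp add: power2_eq_square)
    ultimately have "(x - s) * (m0 * g x * (x - s)) \<le> (x - s) * (2 * w (x - s))" by linarith
    then have "m0 * g x * (x - s) \<le> 2 * w (x - s)" using x by simp
    then show ?thesis using x m0 by (simp add: field_simps)
  qed
  show "g x \<le> 2 * Lam / (m0 * c\<^sup>2)" if "s < A - c"
  proof -
    have "m0 * g x * c\<^sup>2 / 2 \<le> m0 * g x * (x - (A - c))\<^sup>2 / 2"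
      using x m0 g c by (intro divide_right_mono mult_left_mono power_mono) auto
    also have "\<dots> \<le> Q x" using lower[of "A - c"] that x c by auto
    also have "\<dots> \<le> Lam" using Q_le_N[OF xu] Lam by simp
    finally show ?thesis using m0 c by (simp add: field_simps)
  qed
qed

section \<open>The mass of \<open>f * g\<close> on the overlap with \<open>[A, B]\<close>\<close>

abbreviation "C_pos \<equiv> pos_const c m0 M0"

lemma m0_le_M0: "m0 \<le> M0"
  using f_low[of "max s A"] f_up[of "max s A"] AB c su by force

text \<open>\<open>Q z\<close> is a double integral, whereas a single integral has to be bounded.
  The mass left of the midpoint \<open>m\<close> of \<open>[s, z]\<close> enters \<open>Q z\<close>
  with weight at least \<open>(z - s) / 2\<close>, so it is at most \<open>2 * w (z - s)\<close>; as
  \<open>g\<close> decreases, this mass also controls \<open>g m\<close>, hence \<open>g\<close> on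
  the right half.\<close>

lemma positive_mass_left:
  assumes z: "z \<in> {a0..b0}" and gz: "0 \<le> g z"
    and anti: "\<And>x y. s \<le> x \<Longrightarrow> x \<le> y \<Longrightarrow> y \<le> z \<Longrightarrow> g y \<le> g x"
  shows "Q1 z - Q1 a0 \<le> C_pos * (w (z - a0) + (z - a0) * Lam)"
proof (cases "z = a0")
  case True
  have "0 \<le> C_pos * w 0"
    using m0 m0_le_M0 w_nonneg[of 0] by (auto simp: pos_const_def)
  with True show ?thesis by simp
next
  case False
  then have za: "a0 < z" "s < z" using z by auto
  have zu: "z \<in> {s..u}" and a0u: "a0 \<in> {s..u}" using z by auto
  have gp: "0 \<le> g y" if "y \<in> {s..z}" for y using anti[of y z] gz that by force
  have M0: "M0 > 0" using m0 m0_le_M0 by simp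
  have wn: "0 \<le> w (z - a0)" "0 \<le> (z - a0) * Lam" using za w_nonneg Lam_nonneg by auto
  have inc: "Q1 y - Q1 x \<le> M0 * g x * (y - x)"
    if "s \<le> x" "A - c \<le> x" "x \<le> y" "y \<le> z" for x y
  proof (rule increment_le_of_deriv[OF dQ1_sub])
    show "{x..y} \<subseteq> {s..u}" using that zu by auto
    fix v assume v: "v \<in> {x..y}"
    then show "f v * g v \<le> M0 * g x"
      using that z f_up[of v] anti[of x v] gp[of v] M0 c by (intro mult_mono) auto
  qed (use that in auto)
  show ?thesis
  proof (cases "A - c \<le> s")
    case True
    define m where "m = (s + z) / 2"
    define W where "W = w (z - s)"
    have W: "0 \<le> W" using za w_nonneg by (simp add: W_def)
    have m: "s < m" "m < z" "z - m = (z - s) / 2" "m - s = (z - s) / 2"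
      using za by (auto simp: m_def field_simps)
    have mu: "m \<in> {s..u}" using m zu by auto
    have m_ge: "0 \<le> Q m" "0 \<le> Q1 m" using nonneg_start[OF mu] gp m by auto
    have "Q1 m * (z - m) \<le> Q z"
    proof -
      have sub: "{m..z} \<subseteq> {s..u}" using m zu by auto
      have h: "0 \<le> f v * g v" if "v \<in> {m..z}" for v
        using that m zu gp[of v] f_pos[of v] by (intro mult_nonneg_nonneg) auto
      have "Q m + Q1 m * (z - m) + 0 * (z - m)\<^sup>2 / 2 \<le> Q z"
        by (rule taylor_two_lower(1)[OF dQ_sub[OF sub] dQ1_sub[OF sub] h]) (use m in auto)
      with m_ge show ?thesis by simp
    qed
    also have "\<dots> \<le> (z - s) * W" using Q_up[OF zu] by (simp add: W_def)
    finally have "Q1 m * ((z - s) / 2) \<le> (z - s) * W" unfolding m(3) .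
    then have "(z - s) * Q1 m / 2 \<le> (z - s) * W" by (simp add: mult.commute)
    then have "(z - s) * Q1 m \<le> (z - s) * (2 * W)" by linarith
    then have Q1m: "Q1 m \<le> 2 * W" using za by simp
    have "m0 * g m * (m - s) \<le> Q1 m - Q1 s"
    proof (rule increment_ge_of_deriv[OF dQ1_sub])
      show "{s..m} \<subseteq> {s..u}" using mu by auto
      fix v assume v: "v \<in> {s..m}"
      then show "m0 * g m \<le> f v * g v"
        using True m z zu f_low[of v] anti[of v m] gp[of m] m0 c by (intro mult_mono) auto
    qed (use m in auto)
    then have gm: "g m * (z - s) \<le> 4 * W / m0"
      using Q1m m m0 by (simp add: Q1_s field_simps)
    \<comment> \<open>If \<open>a0 \<le> m\<close>, then \<open>z - s \<le> 2 * (z - a0)\<close> and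
      doubling the modulus is harmless. Otherwise \<open>[a0, z]\<close> lies in the right half,
      where \<open>g \<le> g m\<close>, and the decreasing quotient \<open>w d / d\<close> passes
      from \<open>z - s\<close> to \<open>z - a0\<close>.\<close>
    have "Q1 z - Q1 a0 \<le> 4 * (1 + M0 / m0) * w (z - a0)"
    proof (cases "a0 \<le> m")
      case True
      have "0 \<le> Q1 a0" by (rule nonneg_start(2)[OF a0u gp]) (use za in auto)
      then have "Q1 z - Q1 a0 \<le> Q1 m + (Q1 z - Q1 m)" by simp
      also have "\<dots> \<le> 2 * W + M0 * g m * (z - m)"
        using Q1m inc[of m z] m(1,2) \<open>A - c \<le> s\<close> by auto
      also have "\<dots> = 2 * W + M0 * (g m * (z - s)) / 2" using m by simp
      also have "\<dots> \<le> 2 * W + M0 * (4 * W / m0) / 2"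
        using gm M0 by (intro add_left_mono divide_right_mono mult_left_mono) auto
      also have "\<dots> = 2 * (1 + M0 / m0) * W" by (simp add: field_simps)
      also have "\<dots> \<le> 2 * (1 + M0 / m0) * (2 * w (z - a0))"
      proof (rule mult_left_mono)
        have "W \<le> w (2 * (z - a0))" unfolding W_def using True m by (intro w_mono) auto
        also have "\<dots> \<le> 2 * w (z - a0)" using k r za by (intro emp_modulus_double) auto
        finally show "W \<le> 2 * w (z - a0)" .
      qed (use M0 m0 in auto)
      finally show ?thesis by (simp add: algebra_simps)
    next
      case False
      then have "Q1 z - Q1 a0 \<le> M0 * g a0 * (z - a0)"
        using inc[of a0 z] za \<open>A - c \<le> s\<close> c by auto
      also have "\<dots> \<le> M0 * g m * (z - a0)"
        using False anti[of m a0] m za M0 by (intro mult_right_mono mult_left_mono) auto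
      also have "\<dots> \<le> M0 * (4 / m0 * w (z - a0))"
      proof -
        have "(z - s) * (g m * (z - a0)) = (g m * (z - s)) * (z - a0)" by simp
        also have "\<dots> \<le> 4 * W / m0 * (z - a0)" using gm za by (intro mult_right_mono) auto
        also have "\<dots> = 4 / m0 * ((z - a0) * w (z - s))" by (simp add: W_def)
        also have "\<dots> \<le> 4 / m0 * ((z - s) * w (z - a0))"
          using k r za m0 by (intro mult_left_mono emp_modulus_div_antimono) auto
        also have "\<dots> = (z - s) * (4 / m0 * w (z - a0))" by (simp add: mult.left_commute)
        finally have "(z - s) * (g m * (z - a0)) \<le> (z - s) * (4 / m0 * w (z - a0))" .
        then have "g m * (z - a0) \<le> 4 / m0 * w (z - a0)"
          by (rule mult_left_le_imp_le) (use za in simp)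
        then have "M0 * (g m * (z - a0)) \<le> M0 * (4 / m0 * w (z - a0))"
          using M0 by (intro mult_left_mono) auto
        then show ?thesis by (simp only: mult.assoc)
      qed
      also have "\<dots> \<le> 4 * (1 + M0 / m0) * w (z - a0)" using wn by (simp add: algebra_simps)
      finally show ?thesis .
    qed
    also have "\<dots> \<le> C_pos * (w (z - a0) + (z - a0) * Lam)"
      unfolding pos_const_def using wn M0 m0 by (intro mult_mono) auto
    finally show ?thesis .
  next
    case False
    then have sA: "s < A - c" "a0 = A" using c by auto
    have gA: "g A \<le> 2 * Lam / (m0 * c\<^sup>2)"
      using sA c z za gp anti[of _ A] by (intro g_upper_right(2)) auto
    have "Q1 z - Q1 a0 \<le> M0 * g A * (z - A)" using inc[of A z] sA c za by auto
    also have "\<dots> \<le> M0 * (2 * Lam / (m0 * c\<^sup>2)) * (z - A)"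
      using gA M0 za by (intro mult_right_mono mult_left_mono) auto
    also have "\<dots> = 2 * M0 / (m0 * c\<^sup>2) * ((z - a0) * Lam)" using sA by simp
    also have "\<dots> \<le> C_pos * (w (z - a0) + (z - a0) * Lam)"
      unfolding pos_const_def using wn M0 m0 by (intro mult_mono) auto
    finally show ?thesis .
  qed
qed

text \<open>A decreasing \<open>g\<close> changes sign at most once. Up to the sign change
  \<open>z\<close> the mass on \<open>[t1, z]\<close> is at most that on \<open>[a0, z]\<close>;
  after \<open>z\<close> the primitive \<open>Q1\<close> only falls.\<close>

lemma increment_upper_left:
  assumes t: "a0 \<le> t1" "t1 \<le> t2" "t2 \<le> b0"
    and anti: "\<And>x y. s \<le> x \<Longrightarrow> x \<le> y \<Longrightarrow> y \<le> t2 \<Longrightarrow> g y \<le> g x"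
  shows "Q1 t2 - Q1 t1 \<le> C_pos * (w (b0 - a0) + (b0 - a0) * Lam)"
proof -
  have C: "0 \<le> C_pos" using m0 m0_le_M0 by (simp add: pos_const_def)
  have bound: "C_pos * (w (z - a0) + (z - a0) * Lam) \<le> C_pos * (w (b0 - a0) + (b0 - a0) * Lam)"
    if "z \<le> b0" for z
    using that C Lam_nonneg by (intro mult_left_mono add_mono w_mono mult_right_mono) auto
  have down: "Q1 y - Q1 x \<le> 0" if "s \<le> x" "x \<le> y" "y \<le> u" "\<And>v. v \<in> {x..y} \<Longrightarrow> g v \<le> 0" for x y
  proof -
    have "Q1 y - Q1 x \<le> 0 * (y - x)"
    proof (rule increment_le_of_deriv[OF dQ1_sub])
      fix v assume "v \<in> {x..y}"
      then show "f v * g v \<le> 0" using that f_pos[of v] by (intro mult_nonneg_nonpos) auto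
    qed (use that in auto)
    then show ?thesis by simp
  qed
  have up: "Q1 x \<le> Q1 y" if "s \<le> x" "x \<le> y" "y \<le> u" "\<And>v. v \<in> {x..y} \<Longrightarrow> 0 \<le> g v" for x y
  proof -
    have "0 * (y - x) \<le> Q1 y - Q1 x"
    proof (rule increment_ge_of_deriv[OF dQ1_sub])
      fix v assume "v \<in> {x..y}"
      then show "0 \<le> f v * g v" using that f_pos[of v] by (intro mult_nonneg_nonneg) auto
    qed (use that in auto)
    then show ?thesis by simp
  qed
  have "\<exists>z\<in>{t1..t2}. 0 \<le> g z \<and> (\<forall>v\<in>{z..t2}. g v \<le> 0 \<or> z = t2)" if g1: "0 \<le> g t1"
  proof (cases "0 \<le> g t2")
    case False
    have "continuous_on {t1..t2} g" using t by (intro continuous_on_subset[OF g_cont]) auto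
    then obtain z where z: "t1 \<le> z" "z \<le> t2" "g z = 0"
      using IVT2'[of g t2 0 t1] False g1 t by auto
    then have "g v \<le> 0" if "v \<in> {z..t2}" for v using anti[of z v] t that by auto
    with z show ?thesis by (intro bexI[of _ z]) auto
  qed (use t in auto)
  then consider "g t1 < 0" | z where "z \<in> {t1..t2}" "0 \<le> g z" "\<forall>v\<in>{z..t2}. g v \<le> 0 \<or> z = t2"
    by force
  then show ?thesis
  proof cases
    case 1
    then have "Q1 t2 - Q1 t1 \<le> 0" using t anti[of t1] by (intro down) force+
    also have "0 \<le> C_pos * (w (b0 - a0) + (b0 - a0) * Lam)"
      using t C Lam_nonneg w_nonneg[of "b0 - a0"] by simp
    finally show ?thesis .
  next
    case 2
    have "Q1 t2 - Q1 z \<le> 0"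
    proof (cases "z = t2")
      case False
      then show ?thesis using 2 t by (intro down) auto
    qed simp
    moreover have "Q1 a0 \<le> Q1 t1" using 2 t anti[of _ z] by (intro up) force+
    moreover have "Q1 z - Q1 a0 \<le> C_pos * (w (z - a0) + (z - a0) * Lam)"
      using 2 t anti by (intro positive_mass_left) auto
    moreover have "C_pos * (w (z - a0) + (z - a0) * Lam) \<le> C_pos * (w (b0 - a0) + (b0 - a0) * Lam)"
      using 2 t by (intro bound) auto
    ultimately show ?thesis by linarith
  qed
qed

lemma increment_upper_right:
  assumes t: "a0 \<le> t1" "t1 \<le> t2" "t2 \<le> b0"
    and mono: "\<And>x y. t1 \<le> x \<Longrightarrow> x \<le> y \<Longrightarrow> y \<le> u \<Longrightarrow> g x \<le> g y"
  shows "Q1 t2 - Q1 t1 \<le> C_pos * (w (b0 - a0) + (b0 - a0) * Lam)"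
proof -
  interpret rf: affine_piece "- u" "- s" "- B" "- A" c m0 M0 k r Lam "\<lambda>x. f (- x)" "\<lambda>x. g (- x)"
     "\<lambda>x. Q (- x) - Q u - (- x - u) * Q1 u" "\<lambda>x. Q1 u - Q1 (- x)"
    by (rule reflected)
  have e: "rf.b0 - rf.a0 = b0 - a0" by linarith
  have "(Q1 u - Q1 (- (- t1))) - (Q1 u - Q1 (- (- t2))) \<le> rf.C_pos * (w (rf.b0 - rf.a0) + (rf.b0 - rf.a0) * Lam)"
    by (rule rf.increment_upper_left) (use t mono in auto)
  then show ?thesis unfolding e by simp
qed

abbreviation "C_inc \<equiv> inc_const c m0 M0"

text \<open>From above, the minimum of \<open>g\<close> separates a decreasing from an increasing
  branch, each covered by a one-sided lemma. From below, the pointwise bound \<open>g_lower\<close>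
  is integrated, and its denominator \<open>b0 - a0\<close> cancels against the length.\<close>

lemma increment_bound:
  assumes t: "a0 \<le> t1" "t1 \<le> t2" "t2 \<le> b0"
  shows "\<bar>Q1 t2 - Q1 t1\<bar> \<le> C_inc * (w (b0 - a0) + (b0 - a0) * Lam)"
proof -
  define e where "e = w (b0 - a0) + (b0 - a0) * Lam"
  have e: "0 \<le> e" using t Lam_nonneg w_nonneg[of "b0 - a0"] by (simp add: e_def)
  have M0: "0 < M0" using m0 m0_le_M0 by simp
  have C: "0 \<le> C_pos" using m0 M0 by (simp add: pos_const_def)
  obtain z where z: "z \<in> {s..u}" and min: "\<And>y. y \<in> {s..u} \<Longrightarrow> g z \<le> g y"
    using continuous_attains_inf[of "{s..u}" g] g_cont su by auto
  have anti: "g y \<le> g x" if "s \<le> x" "x \<le> y" "y \<le> z" for x y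
    by (rule convex_on_antimono_before_min[OF g_convex z min]) (use that in auto)
  have mono: "g x \<le> g y" if "z \<le> x" "x \<le> y" "y \<le> u" for x y
    using convex_on_le_max[OF g_convex, of z y x] min[of y] that z by auto
  have left: "Q1 y - Q1 x \<le> C_pos * e" if "a0 \<le> x" "x \<le> y" "y \<le> b0" "y \<le> z" for x y
    unfolding e_def by (rule increment_upper_left) (use that anti in auto)
  have right: "Q1 y - Q1 x \<le> C_pos * e" if "a0 \<le> x" "x \<le> y" "y \<le> b0" "z \<le> x" for x y
    unfolding e_def by (rule increment_upper_right) (use that mono in auto)
  have Ce: "0 \<le> C_pos * e" using C e by simp
  have "Q1 t2 - Q1 t1 \<le> 2 * C_pos * e"
  proof -
    consider "t2 \<le> z" | "z \<le> t1" | "t1 \<le> z" "z \<le> t2" by linarith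
    then show ?thesis
    proof cases
      case 1
      from left[OF t this] Ce show ?thesis by linarith
    next
      case 2
      from right[OF t this] Ce show ?thesis by linarith
    next
      case 3
      then show ?thesis using left[of t1 z] right[of z t2] t by auto
    qed
  qed
  also have "\<dots> \<le> C_inc * e"
    unfolding inc_const_def using e M0 m0 by (intro mult_right_mono) auto
  finally have upper: "Q1 t2 - Q1 t1 \<le> C_inc * e" .
  have "- (C_inc * e) \<le> Q1 t2 - Q1 t1"
  proof (cases "a0 = b0")
    case True
    then have "t1 = t2" using t by linarith
    moreover have "0 \<le> C_inc * e" unfolding inc_const_def using e C M0 m0 by simp
    ultimately show ?thesis by simp
  next
    case False
    then have ab: "a0 < b0" using t by auto
    define \<nu> where "\<nu> = 2048 / (m0 * c\<^sup>2) * (w (b0 - a0) / (b0 - a0) + Lam)"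
    have \<nu>: "0 \<le> \<nu>" unfolding \<nu>_def using ab m0 w_nonneg[of "b0 - a0"] Lam_nonneg
      by (intro mult_nonneg_nonneg add_nonneg_nonneg divide_nonneg_nonneg) auto
    have "- (M0 * \<nu>) * (t2 - t1) \<le> Q1 t2 - Q1 t1"
    proof (rule increment_ge_of_deriv[OF dQ1_sub])
      show "{t1..t2} \<subseteq> {s..u}" using t by auto
      fix x assume x: "x \<in> {t1..t2}"
      then have "- \<nu> \<le> g x" unfolding \<nu>_def using t by (intro g_lower ab) auto
      then have "f x * (- \<nu>) \<le> f x * g x" using x t f_pos[of x] by (intro mult_left_mono) auto
      moreover have "f x * \<nu> \<le> M0 * \<nu>" using x t c \<nu> f_up[of x] by (intro mult_right_mono) auto
      ultimately show "- (M0 * \<nu>) \<le> f x * g x" by simp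
    qed (use t in auto)
    moreover have "M0 * \<nu> * (t2 - t1) \<le> M0 * \<nu> * (b0 - a0)"
      using t M0 \<nu> by (intro mult_left_mono) auto
    moreover have "M0 * \<nu> * (b0 - a0) = 2048 * M0 / (m0 * c\<^sup>2) * e"
    proof -
      have "(w (b0 - a0) / (b0 - a0) + Lam) * (b0 - a0) = e"
        using ab by (simp add: e_def distrib_right del: max_less_iff_conj min_less_iff_conj)
      moreover have "M0 * \<nu> * (b0 - a0) = 2048 * M0 / (m0 * c\<^sup>2) *
          ((w (b0 - a0) / (b0 - a0) + Lam) * (b0 - a0))"
        unfolding \<nu>_def by (simp only: times_divide_eq_left times_divide_eq_right ac_simps)
      ultimately show ?thesis by simp
    qed
    moreover have "2048 * M0 / (m0 * c\<^sup>2) * e \<le> C_inc * e"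
      unfolding inc_const_def using e C by (intro mult_right_mono) auto
    ultimately show ?thesis by simp
  qed
  with upper have "\<bar>Q1 t2 - Q1 t1\<bar> \<le> C_inc * e" unfolding abs_le_iff by linarith
  then show ?thesis unfolding e_def .
qed

text \<open>With \<open>a = b0 - a0\<close>, staying a third of the overlap away from
  \<open>a0\<close> gives \<open>a / 3 \<le> x - s\<close>, so
  \<open>w (x - s) / (x - s) \<le> 3 * (w a / a)\<close>; hence the constant \<open>6 / m0\<close>
  in place of \<open>2 / m0\<close>.\<close>

lemma g_upper_middle_right:
  assumes x: "a0 + (b0 - a0) / 3 \<le> x" "x \<le> b0" and ab: "a0 < b0"
    and ge: "\<And>y. y \<in> {s..x} \<Longrightarrow> g x \<le> g y"
  shows "g x \<le> (6 / m0 + 2 / (m0 * c\<^sup>2)) * (w (b0 - a0) / (b0 - a0) + Lam)"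
proof -
  define a where "a = b0 - a0"
  have a: "a > 0" using ab by (simp add: a_def)
  have wa: "0 \<le> w a / a" using a w_nonneg[of a] by simp
  have pos: "0 \<le> (6 / m0 + 2 / (m0 * c\<^sup>2)) * (w a / a + Lam)"
    using wa m0 Lam_nonneg by (intro mult_nonneg_nonneg add_nonneg_nonneg) auto
  have "a0 + a / 3 \<le> x" using x(1) by (simp add: a_def)
  moreover have "s \<le> a0" by simp
  ultimately have xa: "x \<in> {a0..b0}" and sx: "s < x" "a / 3 \<le> x - s" using x(2) a by auto
  show ?thesis
  proof (cases "0 \<le> g x")
    case True
    show ?thesis
    proof (cases "A - c \<le> s")
      case sA: True
      have "(a / 3) * w (x - s) \<le> (x - s) * w (a / 3)"
        using k r sx a by (intro emp_modulus_div_antimono) auto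
      also have "\<dots> \<le> (x - s) * w a" using sx a by (intro mult_left_mono w_mono) auto
      finally have "w (x - s) / (x - s) \<le> 3 * (w a / a)" using sx a by (simp add: field_simps)
      then have "2 / m0 * (w (x - s) / (x - s)) \<le> 2 / m0 * (3 * (w a / a))"
        using m0 by (intro mult_left_mono) auto
      then have "g x \<le> 6 / m0 * (w a / a)"
        using g_upper_right(1)[OF sx(1) xa ge True sA] by simp
      also have "\<dots> \<le> (6 / m0 + 2 / (m0 * c\<^sup>2)) * (w a / a + Lam)"
        using wa m0 Lam_nonneg by (intro mult_mono) auto
      finally show ?thesis by (simp add: a_def)
    next
      case False
      then have "g x \<le> 2 * Lam / (m0 * c\<^sup>2)"
        using g_upper_right(2)[OF sx(1) xa ge True] by simp
      also have "\<dots> = 2 / (m0 * c\<^sup>2) * Lam" by simp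
      also have "\<dots> \<le> (6 / m0 + 2 / (m0 * c\<^sup>2)) * (w a / a + Lam)"
        using wa m0 Lam_nonneg by (intro mult_mono) auto
      finally show ?thesis by (simp add: a_def)
    qed
  qed (use pos in \<open>simp add: a_def\<close>)
qed

lemma g_upper_middle:
  assumes x: "a0 + (b0 - a0) / 3 \<le> x" "x \<le> b0 - (b0 - a0) / 3" and ab: "a0 < b0"
  shows "g x \<le> (6 / m0 + 2 / (m0 * c\<^sup>2)) * (w (b0 - a0) / (b0 - a0) + Lam)"
proof -
  interpret rf: affine_piece "- u" "- s" "- B" "- A" c m0 M0 k r Lam "\<lambda>x. f (- x)" "\<lambda>x. g (- x)"
     "\<lambda>x. Q (- x) - Q u - (- x - u) * Q1 u" "\<lambda>x. Q1 u - Q1 (- x)"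
    by (rule reflected)
  have e: "rf.b0 = - a0" "rf.a0 = - b0" by linarith+
  have xb: "a0 \<le> x" "x \<le> b0" using x ab by argo+
  moreover have "s \<le> a0" "b0 \<le> u" by auto
  ultimately have "x \<in> {s..u}" by (meson atLeastAtMost_iff order.trans)
  from convex_on_one_sided_ge[OF g_convex this] show ?thesis
  proof
    assume "\<forall>y\<in>{s..x}. g x \<le> g y"
    then show ?thesis by (intro g_upper_middle_right x(1) xb(2) ab) blast
  next
    assume right: "\<forall>y\<in>{x..u}. g x \<le> g y"
    have "g (- (- x)) \<le> (6 / m0 + 2 / (m0 * c\<^sup>2)) * (w (rf.b0 - rf.a0) / (rf.b0 - rf.a0) + Lam)"
    proof (rule rf.g_upper_middle_right)
      show "rf.a0 + (rf.b0 - rf.a0) / 3 \<le> - x" "- x \<le> rf.b0" "rf.a0 < rf.b0"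
        unfolding e using x(2) xb ab by argo+
    qed (use right in auto)
    moreover have "rf.b0 - rf.a0 = b0 - a0" unfolding e by simp
    ultimately show ?thesis by simp
  qed
qed

end

section \<open>The length of the overlap and the resulting rate\<close>

lemma inc_const_nonneg: "0 < m0 \<Longrightarrow> 0 \<le> M0 \<Longrightarrow> 0 \<le> inc_const c m0 M0"
  by (simp add: inc_const_def pos_const_def)

lemma mid_const_pos: "0 < m0 \<Longrightarrow> 0 < c \<Longrightarrow> 0 < mid_const c m0"
  by (auto simp: mid_const_def intro!: add_pos_pos divide_pos_pos)

context affine_piece begin

abbreviation "K_mid \<equiv> mid_const c m0"

lemma K_mid_pos: "0 < K_mid"
  using m0 c by (intro mid_const_pos) auto

lemma C_inc_nonneg: "0 \<le> C_inc"
  using m0 m0_le_M0 by (intro inc_const_nonneg) auto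

lemma g_middle_abs:
  assumes x: "a0 + (b0 - a0) / 3 \<le> x" "x \<le> b0 - (b0 - a0) / 3" and ab: "a0 < b0"
  shows "\<bar>g x\<bar> \<le> K_mid * (w (b0 - a0) / (b0 - a0) + Lam)"
proof -
  define e where "e = w (b0 - a0) / (b0 - a0) + Lam"
  have e: "0 \<le> e" unfolding e_def using ab w_nonneg[of "b0 - a0"] Lam_nonneg
    by (intro add_nonneg_nonneg divide_nonneg_nonneg) auto
  have K: "0 \<le> 6 / m0" "0 \<le> 2 / (m0 * c\<^sup>2)" "0 \<le> 2048 / (m0 * c\<^sup>2)"
    using m0 by auto
  have "a0 \<le> x \<and> x \<le> b0" using x ab by argo
  then have "- (2048 / (m0 * c\<^sup>2) * e) \<le> g x"
    unfolding e_def by (intro g_lower ab) simp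
  moreover have "2048 / (m0 * c\<^sup>2) * e \<le> K_mid * e"
    unfolding mid_const_def by (intro mult_right_mono e) (use K in linarith)
  moreover have "g x \<le> (6 / m0 + 2 / (m0 * c\<^sup>2)) * e"
    unfolding e_def by (rule g_upper_middle[OF x ab])
  moreover have "(6 / m0 + 2 / (m0 * c\<^sup>2)) * e \<le> K_mid * e"
    unfolding mid_const_def by (intro mult_right_mono e) (use K in linarith)
  ultimately show ?thesis unfolding e_def by linarith
qed

text \<open>
  Strong convexity of \<open>ln (1 + g)\<close> makes the second difference of \<open>g\<close> over the middle third of
  order \<open>(b0 - a0)\<^sup>2\<close>, whereas \<open>g\<close> itself is small there.
\<close>

lemma length_bound:
  assumes ab: "a0 < b0" and \<kappa>: "0 < \<kappa>"
    and g1: "\<And>x. x \<in> {s..u} \<Longrightarrow> 0 < 1 + g x"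
    and strong: "\<And>x d. a0 \<le> x \<Longrightarrow> 0 \<le> d \<Longrightarrow> x + 2 * d \<le> b0 \<Longrightarrow>
      \<kappa> * d\<^sup>2 \<le> ln (1 + g x) + ln (1 + g (x + 2 * d)) - 2 * ln (1 + g (x + d))"
    and small: "K_mid * (w (b0 - a0) / (b0 - a0) + Lam) \<le> 1 / 2"
  shows "\<kappa> * (b0 - a0)\<^sup>2 \<le> 288 * (K_mid * (w (b0 - a0) / (b0 - a0) + Lam))"
proof -
  define \<mu> where "\<mu> = K_mid * (w (b0 - a0) / (b0 - a0) + Lam)"
  define a where "a = b0 - a0"
  have a: "a > 0" using ab by (simp add: a_def)
  \<comment> \<open>The points \<open>x\<close>, \<open>x + d\<close>, \<open>x + 2 * d\<close> are
    the ends and the midpoint of the middle third of the overlap.\<close>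
  define d x where "d = a / 6" and "x = a0 + a / 3"
  have d: "0 < d" using a by (simp add: d_def)
  have b0: "b0 = a0 + a" by (simp add: a_def)
  have bd: "\<bar>g y\<bar> \<le> \<mu>" if "y \<in> {x, x + d, x + 2 * d}" for y
  proof -
    have "x \<le> y" "y \<le> x + 2 * d" using that d by auto
    then have "a0 + (b0 - a0) / 3 \<le> y" "y \<le> b0 - (b0 - a0) / 3"
      unfolding x_def d_def a_def by argo+
    then show ?thesis unfolding \<mu>_def by (rule g_middle_abs[OF _ _ ab])
  qed
  have ax: "a0 \<le> x" "x + 2 * d \<le> b0" using a by (auto simp: x_def d_def b0)
  have "y \<in> {s..u}" if "y \<in> {x, x + d, x + 2 * d}" for y
  proof -
    have "a0 \<le> y" "y \<le> b0" "s \<le> a0" "b0 \<le> u" using that ax d by auto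
    then show ?thesis by (meson atLeastAtMost_iff order.trans)
  qed
  then have pos: "0 < 1 + g x" "0 < 1 + g (x + d)" "0 < 1 + g (x + 2 * d)" by (auto intro: g1)
  define v1 v2 v3 where "v1 = ln (1 + g x)" and "v2 = ln (1 + g (x + d))" and "v3 = ln (1 + g (x + 2 * d))"
  have e: "exp v1 = 1 + g x" "exp v2 = 1 + g (x + d)" "exp v3 = 1 + g (x + 2 * d)"
    using pos by (simp_all add: v1_def v2_def v3_def)
  have st: "\<kappa> * d\<^sup>2 \<le> v1 + v3 - 2 * v2"
    using strong[of x d] ax d by (simp add: v1_def v2_def v3_def)
  \<comment> \<open>The tangent of \<open>exp\<close> at \<open>v2\<close> turns the second
    difference of \<open>ln (1 + g)\<close> into one of \<open>g\<close>, at the price of the factor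
    \<open>exp v2\<close>, which is at least \<open>1 / 2\<close>.\<close>
  have lin: "exp v2 * (1 + (t - v2)) \<le> exp t" for t
  proof -
    have "exp v2 * (1 + (t - v2)) \<le> exp v2 * exp (t - v2)"
      by (intro mult_left_mono exp_ge_add_one_self) auto
    then show ?thesis by (simp flip: exp_add)
  qed
  have "\<bar>g (x + d)\<bar> \<le> 1 / 2" using bd[of "x + d"] small unfolding \<mu>_def by (meson insertCI order.trans)
  then have "1 / 2 \<le> exp v2" unfolding e by linarith
  then have "1 / 2 * (\<kappa> * d\<^sup>2) \<le> exp v2 * (\<kappa> * d\<^sup>2)"
    using \<kappa> by (intro mult_right_mono) auto
  also have "\<dots> \<le> exp v2 * (v1 + v3 - 2 * v2)" using st by (intro mult_left_mono) auto
  also have "\<dots> \<le> exp v1 + exp v3 - 2 * exp v2"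
    using lin[of v1] lin[of v3] by (simp add: algebra_simps)
  also have "\<dots> = g x + g (x + 2 * d) - 2 * g (x + d)" by (simp add: e)
  also have "\<dots> \<le> 4 * \<mu>" using bd[of x] bd[of "x + d"] bd[of "x + 2 * d"] by auto
  \<comment> \<open>With \<open>d = a / 6\<close> the inequality reads
    \<open>\<kappa> * a\<^sup>2 / 72 \<le> 4 * \<mu>\<close>, which explains 288.\<close>
  finally show ?thesis by (simp add: d_def a_def \<mu>_def power_divide)
qed

text \<open>\<open>q\<close> is the critical length: \<open>r * q = q ^ 6\<close>, so
  \<open>w\<close> is of order \<open>q ^ 3\<close> at lengths of order \<open>q\<close>, and
  \<open>w q / q\<close> is of order \<open>q\<^sup>2\<close>, the order of a squared length in
  \<open>length_bound\<close>.\<close>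

lemma increment_bound_rate:
  assumes \<kappa>: "0 < \<kappa>"
    and g1: "\<And>x. x \<in> {s..u} \<Longrightarrow> 0 < 1 + g x"
    and strong: "\<And>x d. a0 \<le> x \<Longrightarrow> 0 \<le> d \<Longrightarrow> x + 2 * d \<le> b0 \<Longrightarrow>
      \<kappa> * d\<^sup>2 \<le> ln (1 + g x) + ln (1 + g (x + 2 * d)) - 2 * ln (1 + g (x + d))"
    and q: "0 < q" "q \<le> 1" "r = q ^ 5" "Lam \<le> q\<^sup>2" "K_mid * (2 * k + 1) * q\<^sup>2 \<le> 1 / 2"
    and C7: "1 \<le> C7" "288 * K_mid * (2 * k + 1) \<le> \<kappa> * C7\<^sup>2"
    and t: "a0 \<le> t1" "t1 \<le> t2" "t2 \<le> b0"
  shows "b0 - a0 \<le> C7 * q"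
    and "\<bar>Q1 t2 - Q1 t1\<bar> \<le> C_inc * (2 * k * C7 + C7) * q ^ 3"
proof -
  have w_lin: "w (C * q) \<le> 2 * k * C * q ^ 3" if "1 \<le> C" for C
  proof -
    have "r * (C * q) = C * (q ^ 3)\<^sup>2" by (simp add: q(3) power2_eq_square) (simp add: eval_nat_numeral)
    then have "sqrt (r * (C * q)) = sqrt C * sqrt ((q ^ 3)\<^sup>2)" by (simp only: real_sqrt_mult)
    also have "\<dots> = sqrt C * q ^ 3" using q by (simp only: real_sqrt_abs) simp
    also have "\<dots> \<le> C * q ^ 3"
      using that q by (intro mult_right_mono) (auto simp: real_le_lsqrt power2_eq_square)
    finally have 1: "sqrt (r * (C * q)) \<le> C * q ^ 3" .
    have "q ^ 5 \<le> 1 * q ^ 3" using q by (simp add: power_decreasing)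
    also have "\<dots> \<le> C * q ^ 3" using that q by (intro mult_right_mono) auto
    finally have "r \<le> C * q ^ 3" using q by simp
    with 1 have "w (C * q) \<le> k * (C * q ^ 3 + C * q ^ 3)"
      unfolding emp_modulus_def using k by (intro mult_left_mono add_mono) auto
    then show ?thesis by simp
  qed
  show len: "b0 - a0 \<le> C7 * q"
  proof (cases "b0 - a0 \<le> q")
    case True
    also have "q \<le> C7 * q" using q C7 by simp
    finally show ?thesis .
  next
    case False
    then have qa: "q < b0 - a0" by simp
    then have ab: "a0 < b0" using q(1) by linarith
    \<comment> \<open>An overlap longer than \<open>q\<close> has a smaller quotient
      \<open>w d / d\<close> than the length \<open>q\<close> itself.\<close>
    have "q * w (b0 - a0) \<le> (b0 - a0) * w q"
      using k r q qa by (intro emp_modulus_div_antimono) auto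
    then have "w (b0 - a0) / (b0 - a0) \<le> w q / q" using q ab by (simp add: field_simps)
    also have "\<dots> \<le> 2 * k * q\<^sup>2"
      using w_lin[of 1] q by (simp add: field_simps eval_nat_numeral)
    finally have "w (b0 - a0) / (b0 - a0) + Lam \<le> (2 * k + 1) * q\<^sup>2"
      using q by (simp add: algebra_simps)
    then have le: "K_mid * (w (b0 - a0) / (b0 - a0) + Lam) \<le> K_mid * ((2 * k + 1) * q\<^sup>2)"
      using K_mid_pos by (intro mult_left_mono) auto
    have "\<kappa> * (b0 - a0)\<^sup>2 \<le> 288 * (K_mid * (w (b0 - a0) / (b0 - a0) + Lam))"
    proof (rule length_bound[OF ab \<kappa> g1 strong])
      show "K_mid * (w (b0 - a0) / (b0 - a0) + Lam) \<le> 1 / 2"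
        using le q(5) by (simp only: mult.assoc)
    qed
    also have "\<dots> \<le> 288 * K_mid * (2 * k + 1) * q\<^sup>2" using le by simp
    also have "\<dots> \<le> \<kappa> * C7\<^sup>2 * q\<^sup>2" using C7 by (intro mult_right_mono) auto
    finally have "(b0 - a0)\<^sup>2 \<le> (C7 * q)\<^sup>2" using \<kappa> by (simp add: power_mult_distrib mult.assoc)
    then show ?thesis by (rule power2_le_imp_le) (use q C7 in auto)
  qed
  have "w (b0 - a0) + (b0 - a0) * Lam \<le> w (C7 * q) + (C7 * q) * q\<^sup>2"
    using len t q C7 Lam_nonneg by (intro add_mono w_mono mult_mono) auto
  also have "\<dots> \<le> (2 * k * C7 + C7) * q ^ 3"
    using w_lin[OF C7(1)] by (simp add: algebra_simps eval_nat_numeral)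
  finally have "C_inc * (w (b0 - a0) + (b0 - a0) * Lam) \<le> C_inc * ((2 * k * C7 + C7) * q ^ 3)"
    using C_inc_nonneg by (intro mult_left_mono) auto
  with increment_bound[OF t] show "\<bar>Q1 t2 - Q1 t1\<bar> \<le> C_inc * (2 * k * C7 + C7) * q ^ 3"
    by (simp add: mult.assoc)
qed

end

text \<open>The difference quotients \<open>qt\<close> at \<open>x\<close> decrease. Their infimum
  over the left side is therefore their limit there, which \<open>THE\<close> picks as the left
  derivative, and it still dominates every quotient on the right side.\<close>

lemma left_deriv_supergradient:
  fixes p :: "real \<Rightarrow> real"
  assumes p: "concave_on {l<..<h} p" and x: "x \<in> {l<..<h}" and y: "y \<in> {l<..<h}"
  shows "(p has_real_derivative left_deriv p x) (at_left x)"
    and "p y \<le> p x + left_deriv p x * (y - x)"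
proof -
  define qt where "qt z = (p z - p x) / (z - x)" for z
  have qt_left: "qt z \<le> qt v" if "l < v" "v \<le> z" "z < x" for v z
  proof (cases "v = z")
    case False
    have "(p x - p z) / (x - z) \<le> (p x - p v) / (x - v)"
      by (rule concave_on_slope_le(2)[OF p]) (use that x False in auto)
    then show ?thesis by (simp add: qt_def minus_divide_divide[symmetric, of "p _ - p x"])
  qed simp
  have qt_right: "qt z \<le> qt v" if "l < v" "v < x" "x < z" "z < h" for v z
  proof -
    have "(p z - p x) / (z - x) \<le> (p x - p v) / (x - v)"
      by (rule concave_on_slope_le(1)[OF p]) (use that x in auto)
    then show ?thesis by (simp add: qt_def minus_divide_divide[symmetric, of "p v - p x"])
  qed
  define D where "D = Inf (qt ` {l<..<x})"
  have ne: "qt ` {l<..<x} \<noteq> {}" using x by auto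
  obtain b where b: "x < b" "b < h" using x dense by (metis greaterThanLessThan_iff)
  have bdd: "bdd_below (qt ` {l<..<x})"
    using qt_right[of _ b] b by (intro bdd_belowI[of _ "qt b"]) auto
  have D_le: "D \<le> qt z" if "l < z" "z < x" for z
    unfolding D_def using that bdd by (intro cInf_lower) auto
  have le_D: "qt z \<le> D" if "x < z" "z < h" for z
    unfolding D_def using that qt_right ne by (intro cInf_greatest) auto
  have "(qt \<longlongrightarrow> D) (at_left x)"
  proof (rule order_tendstoI)
    fix e assume "e < D"
    then show "\<forall>\<^sub>F z in at_left x. e < qt z"
      using D_le x by (intro eventually_at_leftI[of l]) (auto intro: less_le_trans)
  next
    fix e assume "D < e"
    then obtain v where v: "l < v" "v < x" "qt v < e"
      using cInf_lessD[OF ne, of e] by (auto simp: D_def)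
    show "\<forall>\<^sub>F z in at_left x. qt z < e"
    proof (rule eventually_at_leftI[OF _ v(2)])
      fix z assume "z \<in> {v<..<x}"
      then show "qt z < e" using qt_left[of v z] v by simp
    qed
  qed
  then have D: "(p has_real_derivative D) (at_left x)"
    by (simp add: has_field_derivative_iff qt_def[abs_def])
  have eq: "left_deriv p x = D"
    unfolding left_deriv_def
  proof (rule the_equality, rule D)
    fix D' assume "(p has_real_derivative D') (at_left x)"
    then show "D' = D" using D
      by (auto simp: has_field_derivative_iff intro: tendsto_unique[of "at_left x"])
  qed
  then show "(p has_real_derivative left_deriv p x) (at_left x)" using D by simp
  consider "y = x" | "y < x" | "x < y" by linarith
  then have "p y \<le> p x + D * (y - x)"
  proof cases
    case 2
    then show ?thesis using D_le[of y] y by (simp add: qt_def neg_le_divide_eq)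
  next
    case 3
    then show ?thesis using le_D[of y] y by (simp add: qt_def divide_le_eq)
  qed simp
  then show "p y \<le> p x + left_deriv p x * (y - x)" by (simp add: eq)
qed

text \<open>Reflection turns the right derivative into the negative of a left derivative.\<close>

lemma right_deriv_supergradient:
  fixes p :: "real \<Rightarrow> real"
  assumes p: "concave_on {l<..<h} p" and x: "x \<in> {l<..<h}" and y: "y \<in> {l<..<h}"
  shows "p y \<le> p x + right_deriv p x * (y - x)"
proof -
  define p' where "p' z = p (- z)" for z
  have p': "concave_on {- h<..<- l} p'"
    unfolding concave_on_def
  proof (rule convex_onI)
    fix t a b :: real assume "0 < t" "t < 1" "a \<in> {- h<..<- l}" "b \<in> {- h<..<- l}"
    then show "- p' ((1 - t) *\<^sub>R a + t *\<^sub>R b) \<le> (1 - t) * - p' a + t * - p' b"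
      using convex_onD[OF p[unfolded concave_on_def], of t "- a" "- b"]
      by (simp add: p'_def algebra_simps)
  qed simp
  have x': "- x \<in> {- h<..<- l}" and y': "- y \<in> {- h<..<- l}" using x y by auto
  define D where "D = - left_deriv p' (- x)"
  have "(p' has_real_derivative - D) (at_left (- x))"
    using left_deriv_supergradient(1)[OF p' x' y'] by (simp add: D_def)
  then have "((\<lambda>y. (p (- y) - p x) / (y + x)) \<longlongrightarrow> - D) (at_left (- x))"
    by (simp add: has_field_derivative_iff p'_def)
  then have "((\<lambda>y. (p y - p x) / (- y + x)) \<longlongrightarrow> - D) (at_right x)"
    by (simp add: at_left_minus filterlim_filtermap)
  moreover have "(p y - p x) / (- y + x) = - ((p y - p x) / (y - x))" for y
    by (metis minus_diff_eq minus_divide_right uminus_add_conv_diff)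
  ultimately have D: "(p has_real_derivative D) (at_right x)"
    by (simp add: has_field_derivative_iff tendsto_minus_cancel_left[symmetric])
  have "right_deriv p x = D"
    unfolding right_deriv_def
  proof (rule the_equality, rule D)
    fix D' assume "(p has_real_derivative D') (at_right x)"
    then show "D' = D" using D
      by (auto simp: has_field_derivative_iff intro: tendsto_unique[of "at_right x"])
  qed
  then show ?thesis
    using left_deriv_supergradient(2)[OF p' x' y'] by (simp add: p'_def D_def algebra_simps)
qed

text \<open>Left and right derivatives enter only as supergradients, so both variants of the
  curvature condition are treated alike. The slope at \<open>x + d / 2\<close> exceeds the one at
  \<open>x + d\<close> by at least \<open>C * (d / 2)\<close> and acts over the length
  \<open>d / 2\<close>; this yields \<open>C / 4\<close>.\<close>

lemma second_difference_of_strong_concavity: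
  fixes p :: "real \<Rightarrow> real"
  assumes p: "concave_on {l<..<h} p" and AB: "l < A" "B < h"
    and curvature:
      "(\<forall>x y. A \<le> x \<and> x < y \<and> y \<le> B \<longrightarrow> left_deriv p x - left_deriv p y \<ge> C * (y - x)) \<or>
       (\<forall>x y. A \<le> x \<and> x < y \<and> y \<le> B \<longrightarrow> right_deriv p x - right_deriv p y \<ge> C * (y - x))"
    and x: "A \<le> x" "0 \<le> d" "x + 2 * d \<le> B"
  shows "p x + p (x + 2 * d) - 2 * p (x + d) \<le> - (C / 4 * d\<^sup>2)"
proof (cases "d = 0")
  case False
  with x have d: "d > 0" by simp
  obtain D where D: "\<And>x y. x \<in> {l<..<h} \<Longrightarrow> y \<in> {l<..<h} \<Longrightarrow> p y \<le> p x + D x * (y - x)"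
    and C: "\<And>x y. A \<le> x \<Longrightarrow> x < y \<Longrightarrow> y \<le> B \<Longrightarrow> D x - D y \<ge> C * (y - x)"
    using curvature left_deriv_supergradient(2)[OF p] right_deriv_supergradient[OF p] by metis
  have "p (x + 2 * d) \<le> p (x + d) + D (x + d) * d"
    using D[of "x + d" "x + 2 * d"] x AB d by simp
  moreover have "p (x + d / 2) \<le> p (x + d) - D (x + d) * (d / 2)"
    using D[of "x + d" "x + d / 2"] x AB d by (simp add: algebra_simps)
  moreover have "p x \<le> p (x + d / 2) - D (x + d / 2) * (d / 2)"
    using D[of "x + d / 2" x] x AB d by simp
  moreover have "(D (x + d) + C * (d / 2)) * (d / 2) \<le> D (x + d / 2) * (d / 2)"
    using C[of "x + d / 2" "x + d"] x AB d by (intro mult_right_mono) auto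
  ultimately show ?thesis by (simp add: algebra_simps power2_eq_square)
qed simp

section \<open>Piecewise affine interpolation\<close>

text \<open>With nonnegative weights this is a general concave piecewise affine function with kinks
  in \<open>S\<close>. The explicit weights make visible how far a kink can be flattened without
  losing concavity.\<close>

definition hinge_fun :: "real \<Rightarrow> real \<Rightarrow> (real \<Rightarrow> real) \<Rightarrow> real set \<Rightarrow> real \<Rightarrow> real" where
  "hinge_fun a b c S r = a + b * r - (\<Sum>z\<in>S. c z * max 0 (r - z))"

lemma max_affine_convex:
  fixes x y t z :: real
  assumes "0 \<le> t" "t \<le> 1"
  shows "max 0 ((1 - t) * x + t * y - z) \<le> (1 - t) * max 0 (x - z) + t * max 0 (y - z)"
proof -
  have "(1 - t) * (x - z) \<le> (1 - t) * max 0 (x - z)" "t * (y - z) \<le> t * max 0 (y - z)"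
    using assms by (auto intro: mult_left_mono)
  moreover have "0 \<le> (1 - t) * max 0 (x - z)" "0 \<le> t * max 0 (y - z)" using assms by auto
  moreover have e: "(1 - t) * x + t * y - z = (1 - t) * (x - z) + t * (y - z)"
    by (simp add: algebra_simps)
  ultimately show ?thesis unfolding e by linarith
qed

lemma concave_on_hinge_fun:
  assumes "\<And>z. z \<in> S \<Longrightarrow> 0 \<le> c z"
  shows "concave_on UNIV (hinge_fun a b c S)"
  unfolding concave_on_def
proof (rule convex_onI)
  fix t x y :: real assume t: "0 < t" "t < 1"
  have "(\<Sum>z\<in>S. c z * max 0 ((1 - t) * x + t * y - z)) \<le>
      (\<Sum>z\<in>S. c z * ((1 - t) * max 0 (x - z) + t * max 0 (y - z)))"
    using t assms by (intro sum_mono mult_left_mono max_affine_convex) auto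
  also have "\<dots> = (1 - t) * (\<Sum>z\<in>S. c z * max 0 (x - z)) + t * (\<Sum>z\<in>S. c z * max 0 (y - z))"
    by (simp add: sum_distrib_left distrib_left sum.distrib mult.left_commute)
  finally show "- hinge_fun a b c S ((1 - t) *\<^sub>R x + t *\<^sub>R y)
      \<le> (1 - t) * - hinge_fun a b c S x + t * - hinge_fun a b c S y"
    by (simp add: hinge_fun_def algebra_simps)
qed simp

lemma continuous_on_hinge_fun: "continuous_on A (hinge_fun a b c S)"
  unfolding hinge_fun_def by (intro continuous_intros)

lemma concave_on_chord_le:
  fixes k :: "real \<Rightarrow> real"
  assumes "concave_on I k" "p \<in> I" "q \<in> I" "p < q" "p \<le> r" "r \<le> q"
  shows "k p + (k q - k p) / (q - p) * (r - p) \<le> k r"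
proof -
  have "(q - r) * k p + (r - p) * k q \<le> (q - p) * k r"
    using convex_on_three_points[of I "\<lambda>x. - k x" p q r] assms by (simp add: concave_on_def)
  moreover have "(q - r) * k p + (r - p) * k q = (q - p) * k p + (k q - k p) * (r - p)"
    by (simp add: algebra_simps)
  moreover have "(q - p) * (k p + (k q - k p) / (q - p) * (r - p)) = (q - p) * k p + (k q - k p) * (r - p)"
    using assms by (simp add: distrib_left)
  ultimately have "(q - p) * (k p + (k q - k p) / (q - p) * (r - p)) \<le> (q - p) * k r" by linarith
  then show ?thesis using assms by simp
qed

text \<open>Points are added in increasing order. Beyond the old maximum \<open>m\<close> the
  interpolant continues its last chord, of slope \<open>\<tau>\<close>; by concavity the chord from
  \<open>m\<close> to the new point has a slope \<open>\<sigma> \<le> \<tau>\<close>, and a hinge of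
  weight \<open>\<tau> - \<sigma>\<close> at \<open>m\<close> bends the function onto it.\<close>

lemma hinge_interpolation:
  fixes k :: "real \<Rightarrow> real"
  assumes "finite S" "S \<noteq> {}" "concave_on {Min S..Max S} k"
  shows "\<exists>a b c. (\<forall>z. 0 \<le> c z) \<and> (\<forall>x\<in>S. hinge_fun a b c S x = k x) \<and>
    (\<forall>x\<in>{Min S..Max S}. hinge_fun a b c S x \<le> k x)"
proof -
  \<comment> \<open>Beyond the claim, the invariant records that the weight at the maximum is still
    free and that the function follows its last chord from some \<open>p\<close> onwards, also past
    the maximum.\<close>
  define P where "P S a b c \<longleftrightarrow> (\<forall>z. 0 \<le> c z) \<and> (\<forall>x\<in>S. hinge_fun a b c S x = k x) \<and>
    (\<forall>x\<in>{Min S..Max S}. hinge_fun a b c S x \<le> k x) \<and> c (Max S) = 0 \<and>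
    (S = {Max S} \<or> (\<exists>p\<in>S. p < Max S \<and>
      (\<forall>r\<ge>p. hinge_fun a b c S r = k (Max S) + (k (Max S) - k p) / (Max S - p) * (r - Max S))))"
    for S a b c
  have "S \<noteq> {} \<longrightarrow> concave_on {Min S..Max S} k \<longrightarrow> (\<exists>a b c. P S a b c)"
    using assms(1)
  proof (induction S rule: finite_linorder_max_induct)
    case (insert x S)
    show ?case
    proof (intro impI)
      assume conc: "concave_on {Min (insert x S)..Max (insert x S)} k"
      show "\<exists>a b c. P (insert x S) a b c"
      proof (cases "S = {}")
        case True
        then have "P (insert x S) (k x) 0 (\<lambda>_. 0)" by (simp add: P_def hinge_fun_def)
        then show ?thesis by blast
      next
        case False
        define m where "m = Max S"
        have m: "m \<in> S" "m < x" "\<And>y. y \<in> S \<Longrightarrow> y \<le> m"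
          using False insert by (auto simp: m_def)
        have Mx: "Max (insert x S) = x"
          using insert m by (intro Max_eqI) (auto intro: less_imp_le)
        have Mn: "Min (insert x S) = Min S"
          using insert m False by (simp add: min_def) (meson Min_le m(1) m(2) not_less order.trans less_imp_le)
        have Mn_le: "Min S \<le> y" if "y \<in> S" for y using that insert by simp
        have conc': "concave_on {Min S..x} k" using conc by (simp add: Mx Mn)
        have "concave_on {Min S..Max S} k"
          using conc' m by (auto simp: m_def concave_on_def intro: convex_on_subset)
        with insert False obtain a b c where P: "P S a b c" by blast
        define \<sigma> where "\<sigma> = (k x - k m) / (x - m)"
        have chord: "k m + \<sigma> * (r - m) \<le> k r" if "m \<le> r" "r \<le> x" for r
          unfolding \<sigma>_def using that m Mn_le[of m] by (intro concave_on_chord_le[OF conc']) auto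
        have \<sigma>x: "\<sigma> * (x - m) = k x - k m" using m by (simp add: \<sigma>_def)
        have \<sigma>eq: "k m + \<sigma> * (r - m) = k x + (k x - k m) / (x - m) * (r - x)" for r
          using \<sigma>x by (simp add: \<sigma>_def[symmetric] algebra_simps)
        from P consider "S = {m}"
          | p where "p \<in> S" "p < m" "\<And>r. p \<le> r \<Longrightarrow> hinge_fun a b c S r = k m + (k m - k p) / (m - p) * (r - m)"
          by (auto simp: P_def m_def)
        then show ?thesis
        proof cases
          case 1
          have h: "hinge_fun (k m - \<sigma> * m) \<sigma> (\<lambda>_. 0) (insert x S) r = k m + \<sigma> * (r - m)" for r
            by (simp add: hinge_fun_def algebra_simps)
          have "P (insert x S) (k m - \<sigma> * m) \<sigma> (\<lambda>_. 0)"
            unfolding P_def h Mx Mn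
          proof (intro conjI allI ballI disjI2)
            fix y assume "y \<in> insert x S"
            then show "k m + \<sigma> * (y - m) = k y" using 1 \<sigma>x by auto
          next
            fix y assume "y \<in> {Min S..x}"
            then show "k m + \<sigma> * (y - m) \<le> k y" using 1 chord by auto
          next
            show "\<exists>p\<in>insert x S. p < x \<and>
                (\<forall>r\<ge>p. k m + \<sigma> * (r - m) = k x + (k x - k p) / (x - p) * (r - x))"
              using m \<sigma>eq by (intro bexI[of _ m]) auto
          qed auto
          then show ?thesis by blast
        next
          case 2
          define \<tau> where "\<tau> = (k m - k p) / (m - p)"
          have st: "\<sigma> \<le> \<tau>" unfolding \<sigma>_def \<tau>_def
            using 2 m Mn_le[of p] by (intro concave_on_slope_le(1)[OF conc']) auto
          define c' where "c' = c(m := \<tau> - \<sigma>, x := 0)"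
          have cm: "c m = 0" using P by (simp add: P_def m_def)
          have xS: "x \<notin> S" using insert by auto
          have "(\<Sum>z\<in>S. c' z * max 0 (r - z)) = (\<Sum>z\<in>S. c z * max 0 (r - z)) + (\<tau> - \<sigma>) * max 0 (r - m)" for r
          proof -
            have "(\<Sum>z\<in>S. c' z * max 0 (r - z)) =
                (\<Sum>z\<in>S. c z * max 0 (r - z) + (if z = m then (\<tau> - \<sigma>) * max 0 (r - m) else 0))"
              using cm xS by (intro sum.cong) (auto simp: c'_def)
            then show ?thesis using insert m by (simp add: sum.distrib)
          qed
          then have h: "hinge_fun a b c' (insert x S) r = hinge_fun a b c S r - (\<tau> - \<sigma>) * max 0 (r - m)" for r
            using insert xS by (simp add: hinge_fun_def c'_def)
          have hl: "hinge_fun a b c' (insert x S) r = hinge_fun a b c S r" if "r \<le> m" for r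
            using that by (simp add: h)
          have hr: "hinge_fun a b c' (insert x S) r = k m + \<sigma> * (r - m)" if "m \<le> r" for r
            using that 2(2) 2(3)[of r] by (simp add: h \<tau>_def[symmetric] algebra_simps)
          have "P (insert x S) a b c'"
            unfolding P_def Mx Mn
          proof (intro conjI allI ballI disjI2)
            fix z show "0 \<le> c' z" using P st by (simp add: c'_def P_def)
          next
            fix y assume "y \<in> insert x S"
            then show "hinge_fun a b c' (insert x S) y = k y"
              using m P \<sigma>x by (auto simp: hl hr P_def)
          next
            fix y assume y: "y \<in> {Min S..x}"
            show "hinge_fun a b c' (insert x S) y \<le> k y"
              using y P chord by (cases "y \<le> m") (auto simp: hl hr P_def m_def[symmetric])
          next
            show "\<exists>p\<in>insert x S. p < x \<and> (\<forall>r\<ge>p. hinge_fun a b c' (insert x S) r =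
                k x + (k x - k p) / (x - p) * (r - x))"
              using m hr \<sigma>eq by (intro bexI[of _ m]) auto
          qed (simp add: c'_def)
          then show ?thesis by blast
        qed
      qed
    qed
  qed simp
  with assms(2,3) show ?thesis unfolding P_def by blast
qed

section \<open>Concave functions with values in \<open>[-\<infinity>, \<infinity>)\<close>\<close>

lemma concave_ext_real:
  assumes \<phi>: "concave_ext \<phi>"
  shows "convex {x. \<phi> x \<noteq> -\<infinity>}" "concave_on {x. \<phi> x \<noteq> -\<infinity>} (\<lambda>x. real_of_ereal (\<phi> x))"
proof -
  have fin: "\<phi> x \<noteq> \<infinity>" for x using \<phi> by (simp add: concave_ext_def)
  have main: "\<phi> ((1 - t) * x + t * y) \<noteq> -\<infinity> \<and>
      (1 - t) * real_of_ereal (\<phi> x) + t * real_of_ereal (\<phi> y) \<le> real_of_ereal (\<phi> ((1 - t) * x + t * y))"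
    if t: "0 < t" "t < 1" and ne: "\<phi> x \<noteq> -\<infinity>" "\<phi> y \<noteq> -\<infinity>" for x y t
  proof -
    have le: "ereal (1 - t) * \<phi> x + ereal t * \<phi> y \<le> \<phi> ((1 - t) * x + t * y)"
      using \<phi> t by (simp add: concave_ext_def)
    obtain a b where ab: "\<phi> x = ereal a" "\<phi> y = ereal b"
      using fin[of x] fin[of y] ne by (cases "\<phi> x"; cases "\<phi> y") auto
    show ?thesis using le fin[of "(1 - t) * x + t * y"]
      by (cases "\<phi> ((1 - t) * x + t * y)") (auto simp: ab)
  qed
  show "convex {x. \<phi> x \<noteq> -\<infinity>}"
    unfolding convex_alt
  proof (intro ballI allI impI)
    fix x y t :: real assume "x \<in> {x. \<phi> x \<noteq> -\<infinity>}" "y \<in> {x. \<phi> x \<noteq> -\<infinity>}" "0 \<le> t \<and> t \<le> 1"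
    then show "(1 - t) *\<^sub>R x + t *\<^sub>R y \<in> {x. \<phi> x \<noteq> -\<infinity>}"
      using main[of t x y] by (cases "t = 0 \<or> t = 1") auto
  qed
  then show "concave_on {x. \<phi> x \<noteq> -\<infinity>} (\<lambda>x. real_of_ereal (\<phi> x))"
    unfolding concave_on_def using main by (intro convex_onI) (auto simp: algebra_simps)
qed

lemma borel_of_convex_real:
  fixes S :: "real set"
  assumes "convex S"
  shows "S \<in> sets borel"
proof -
  have "is_interval S" using assms by (simp add: is_interval_convex_1)
  then have "x \<in> S" if "a \<in> S" "b \<in> S" "a \<le> x" "x \<le> b" for a b x
    using that unfolding is_interval_1 by blast
  then have "\<exists>a b. S = {} \<or> S = UNIV \<or> S = {..<b} \<or> S = {..b} \<or> S = {a<..} \<or> S = {a..} \<or>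
      S = {a<..<b} \<or> S = {a<..b} \<or> S = {a..<b} \<or> S = {a..b}"
    by (intro interval_cases) blast+
  then show ?thesis by (elim exE disjE) simp_all
qed

lemma exp_ext_mono: "u \<le> v \<Longrightarrow> v \<noteq> \<infinity> \<Longrightarrow> exp_ext u \<le> exp_ext v"
  by (cases u; cases v) (auto simp: exp_ext_def)

lemma exp_ext_nonneg: "0 \<le> exp_ext u"
  by (simp add: exp_ext_def)

text \<open>Superlevel sets of a concave function are convex, hence intervals.\<close>

lemma borel_measurable_exp_ext:
  assumes \<phi>: "concave_ext \<phi>"
  shows "(\<lambda>x. exp_ext (\<phi> x)) \<in> borel_measurable borel"
proof (rule borel_measurableI_greater)
  fix a :: real
  have fin: "\<phi> x \<noteq> \<infinity>" for x using \<phi> by (simp add: concave_ext_def)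
  have "convex {x. a < exp_ext (\<phi> x)}"
  proof (cases "a < 0")
    case True
    then have "{x. a < exp_ext (\<phi> x)} = UNIV" using exp_ext_nonneg less_le_trans by blast
    then show ?thesis by simp
  next
    case False
    note conc = concave_ext_real[OF \<phi>]
    have iff: "a < exp_ext (\<phi> x) \<longleftrightarrow> \<phi> x \<noteq> -\<infinity> \<and> a < exp (real_of_ereal (\<phi> x))" for x
      using False by (auto simp: exp_ext_def)
    have "convex {x \<in> {x. \<phi> x \<noteq> -\<infinity>}. a < exp (real_of_ereal (\<phi> x))}"
      unfolding convex_alt
    proof (intro ballI allI impI)
      fix x y t :: real
      assume x: "x \<in> {x \<in> {x. \<phi> x \<noteq> -\<infinity>}. a < exp (real_of_ereal (\<phi> x))}"
        and y: "y \<in> {x \<in> {x. \<phi> x \<noteq> -\<infinity>}. a < exp (real_of_ereal (\<phi> x))}" and t: "0 \<le> t \<and> t \<le> 1"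
      define z where "z = (1 - t) *\<^sub>R x + t *\<^sub>R y"
      have z: "\<phi> z \<noteq> -\<infinity>" using conc(1) x y t unfolding convex_alt z_def by blast
      define p where "p v = real_of_ereal (\<phi> v)" for v
      have "(1 - t) * p x + t * p y \<le> p z"
        using convex_onD[OF conc(2)[unfolded concave_on_def], of t x y] x y t
        by (auto simp: z_def p_def)
      moreover have "(1 - t) * min (p x) (p y) \<le> (1 - t) * p x" "t * min (p x) (p y) \<le> t * p y"
        using t by (auto intro: mult_left_mono)
      ultimately have "min (p x) (p y) \<le> p z" by (simp add: algebra_simps)
      then have "a < exp (p z)" using x y
        by (auto simp: p_def min_def split: if_splits) (meson exp_le_cancel_iff less_le_trans)+
      with z show "(1 - t) *\<^sub>R x + t *\<^sub>R y \<in> {x \<in> {x. \<phi> x \<noteq> -\<infinity>}. a < exp (real_of_ereal (\<phi> x))}"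
        by (simp add: z_def p_def)
    qed
    then show ?thesis by (simp add: iff)
  qed
  then show "{x \<in> space borel. a < exp_ext (\<phi> x)} \<in> sets borel" by (simp add: borel_of_convex_real)
qed

text \<open>Restricting a real function to the sample range keeps the integral in the likelihood
  finite, whatever the behaviour of the function at infinity.\<close>

definition ext_on :: "real \<Rightarrow> real \<Rightarrow> (real \<Rightarrow> real) \<Rightarrow> real \<Rightarrow> ereal" where
  "ext_on lo hi G r = (if lo \<le> r \<and> r \<le> hi then ereal (G r) else -\<infinity>)"

lemma concave_ext_ext_on:
  assumes "concave_on UNIV G"
  shows "concave_ext (ext_on lo hi G)"
  unfolding concave_ext_def
proof (intro conjI allI impI)
  fix x y t :: real assume t: "0 < t \<and> t < 1"
  show "ereal (1 - t) * ext_on lo hi G x + ereal t * ext_on lo hi G y \<le> ext_on lo hi G ((1 - t) * x + t * y)"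
  proof (cases "lo \<le> x \<and> x \<le> hi \<and> lo \<le> y \<and> y \<le> hi")
    case True
    have "(1 - t) * lo + t * lo \<le> (1 - t) * x + t * y" "(1 - t) * x + t * y \<le> (1 - t) * hi + t * hi"
      using t True by (auto intro!: add_mono mult_left_mono)
    then have "lo \<le> (1 - t) * x + t * y" "(1 - t) * x + t * y \<le> hi" by (simp_all add: algebra_simps)
    with True show ?thesis
      using convex_onD[OF assms[unfolded concave_on_def], of t x y] t by (simp add: ext_on_def)
  next
    case False
    then have "ereal (1 - t) * ext_on lo hi G x + ereal t * ext_on lo hi G y = -\<infinity>"
      using t by (auto simp: ext_on_def)
    then show ?thesis by (rule ord_eq_le_trans) simp
  qed
qed (simp add: ext_on_def)

lemma exp_ext_ext_on: "exp_ext (ext_on lo hi G r) = indicat_real {lo..hi} r * exp (G r)"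
  by (simp add: exp_ext_def ext_on_def indicator_def)

lemma nn_integral_ext_on:
  assumes "continuous_on UNIV G"
  shows "(\<integral>\<^sup>+ r. ennreal (exp_ext (ext_on lo hi G r)) \<partial>lborel) = ennreal (integral {lo..hi} (\<lambda>r. exp (G r)))"
  unfolding exp_ext_ext_on
proof (rule nn_integral_has_integral_lebesgue)
  have "continuous_on {lo..hi} (\<lambda>r. exp (G r))"
    using assms continuous_on_subset by (intro continuous_on_exp) blast
  then show "((\<lambda>r. exp (G r)) has_integral integral {lo..hi} (\<lambda>r. exp (G r))) {lo..hi}"
    by (simp add: integrable_continuous_interval integrable_integral)
qed simp

lemma log_lik_ext_on:
  assumes "continuous_on UNIV G" "0 < n" "\<And>i. i < n \<Longrightarrow> x i \<in> {lo..hi}"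
  shows "log_lik n x (ext_on lo hi G) =
    ereal ((\<Sum>i<n. G (x i)) / real n - integral {lo..hi} (\<lambda>r. exp (G r)))"
proof -
  have "(\<Sum>i<n. ext_on lo hi G (x i)) = (\<Sum>i<n. ereal (G (x i)))"
    using assms(3) by (intro sum.cong) (auto simp: ext_on_def)
  moreover have "0 \<le> integral {lo..hi} (\<lambda>r. exp (G r))"
    by (rule Henstock_Kurzweil_Integration.integral_nonneg)
       (auto intro!: integrable_continuous_interval continuous_on_exp continuous_on_subset[OF assms(1)])
  ultimately show ?thesis
    using assms(2) by (simp add: log_lik_def nn_integral_ext_on[OF assms(1)])
qed

section \<open>Perturbations of the maximum likelihood estimator\<close>

lemma exp_le_quadratic:
  fixes z :: real
  assumes "\<bar>z\<bar> \<le> 1"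
  shows "exp z \<le> 1 + z + z\<^sup>2"
proof (cases "0 \<le> z")
  case False
  define y where "y = - z"
  have y: "0 \<le> y" "y \<le> 1" using False assms by (auto simp: y_def)
  have "1 \<le> 1 + y ^ 3" using y by simp
  also have "\<dots> = (1 + y) * (1 - y + y\<^sup>2)" by (simp add: algebra_simps eval_nat_numeral)
  also have "\<dots> \<le> exp y * (1 - y + y\<^sup>2)"
  proof (intro mult_right_mono)
    have "0 \<le> (1 - y) + y\<^sup>2" using y by (intro add_nonneg_nonneg) auto
    then show "0 \<le> 1 - y + y\<^sup>2" by simp
  qed (rule exp_ge_add_one_self)
  finally have "1 / exp y \<le> 1 - y + y\<^sup>2" by (simp add: divide_le_eq mult.commute)
  then show ?thesis by (simp add: y_def exp_minus inverse_eq_divide)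
qed (use assms exp_bound in auto)

text \<open>First-order optimality: along \<open>G + h * \<Delta>\<close> the likelihood cannot
  exceed its value at \<open>h = 0\<close>. The quadratic bound on \<open>exp\<close> replaces
  differentiation under the integral, with an error \<open>h * J\<close> after division by
  \<open>h\<close>.\<close>

lemma concave_on_perturb_ext:
  fixes G \<Delta> :: "real \<Rightarrow> real"
  assumes mle: "is_log_concave_mle n x (ext_on lo hi G)" and n: "0 < n"
    and x: "\<And>i. i < n \<Longrightarrow> x i \<in> {lo..hi}"
    and G: "continuous_on UNIV G" and \<Delta>: "continuous_on UNIV \<Delta>" and \<epsilon>: "0 < \<epsilon>"
    and conc: "\<And>h. 0 < h \<Longrightarrow> h \<le> \<epsilon> \<Longrightarrow> concave_on UNIV (\<lambda>r. G r + h * \<Delta> r)"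
  shows "(\<Sum>i<n. \<Delta> (x i)) / real n \<le> integral {lo..hi} (\<lambda>r. \<Delta> r * exp (G r))"
proof -
  define J where "J = integral {lo..hi} (\<lambda>r. (\<Delta> r)\<^sup>2 * exp (G r))"
  have cG: "continuous_on {lo..hi} G" and c\<Delta>: "continuous_on {lo..hi} \<Delta>"
    using G \<Delta> continuous_on_subset by blast+
  have J: "0 \<le> J" unfolding J_def
    by (rule Henstock_Kurzweil_Integration.integral_nonneg)
       (auto intro!: integrable_continuous_interval continuous_intros cG c\<Delta>)
  have "bounded (\<Delta> ` {lo..hi})" using c\<Delta> compact_continuous_image compact_imp_bounded by blast
  then obtain c where "\<forall>v\<in>\<Delta> ` {lo..hi}. norm v \<le> c" unfolding bounded_iff by blast
  then have c: "\<bar>\<Delta> r\<bar> \<le> max c 1" if "r \<in> {lo..hi}" for r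
    using that by (force simp: le_max_iff_disj)
  \<comment> \<open>This ensures \<open>\<bar>h * \<Delta> r\<bar> \<le> 1\<close> on the sample
    range, where \<open>exp_le_quadratic\<close> is valid.\<close>
  define \<delta> where "\<delta> = min \<epsilon> (1 / max c 1)"
  have \<delta>: "0 < \<delta>" using \<epsilon> by (simp add: \<delta>_def)
  have step: "(\<Sum>i<n. \<Delta> (x i)) / real n \<le> integral {lo..hi} (\<lambda>r. \<Delta> r * exp (G r)) + h * J"
    if h: "0 < h" "h \<le> \<delta>" for h
  proof -
    have "log_lik n x (ext_on lo hi (\<lambda>r. G r + h * \<Delta> r)) \<le> log_lik n x (ext_on lo hi G)"
      using mle conc[of h] h by (auto simp: is_log_concave_mle_def \<delta>_def intro: concave_ext_ext_on)
    moreover have "continuous_on UNIV (\<lambda>r. G r + h * \<Delta> r)" using G \<Delta> by (intro continuous_intros)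
    ultimately have "(\<Sum>i<n. G (x i) + h * \<Delta> (x i)) / real n - integral {lo..hi} (\<lambda>r. exp (G r + h * \<Delta> r))
        \<le> (\<Sum>i<n. G (x i)) / real n - integral {lo..hi} (\<lambda>r. exp (G r))"
      using x n G by (simp add: log_lik_ext_on)
    moreover have "integral {lo..hi} (\<lambda>r. exp (G r + h * \<Delta> r)) \<le>
        integral {lo..hi} (\<lambda>r. exp (G r) + (h * (\<Delta> r * exp (G r)) + h\<^sup>2 * ((\<Delta> r)\<^sup>2 * exp (G r))))"
    proof (rule integral_le)
      fix r assume r: "r \<in> {lo..hi}"
      have "h * \<bar>\<Delta> r\<bar> \<le> (1 / max c 1) * max c 1"
        using h c[OF r] by (intro mult_mono) (auto simp: \<delta>_def)
      moreover have "max c 1 \<noteq> 0" by linarith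
      ultimately have "\<bar>h * \<Delta> r\<bar> \<le> 1" using h by (simp add: abs_mult)
      then have "exp (G r) * exp (h * \<Delta> r) \<le> exp (G r) * (1 + h * \<Delta> r + (h * \<Delta> r)\<^sup>2)"
        by (intro mult_left_mono exp_le_quadratic) auto
      then show "exp (G r + h * \<Delta> r) \<le>
          exp (G r) + (h * (\<Delta> r * exp (G r)) + h\<^sup>2 * ((\<Delta> r)\<^sup>2 * exp (G r)))"
        by (simp add: exp_add algebra_simps power_mult_distrib)
    qed (auto intro!: integrable_continuous_interval continuous_intros cG c\<Delta>)
    moreover have "integral {lo..hi} (\<lambda>r. exp (G r) + (h * (\<Delta> r * exp (G r)) + h\<^sup>2 * ((\<Delta> r)\<^sup>2 * exp (G r)))) =
        integral {lo..hi} (\<lambda>r. exp (G r)) + (h * integral {lo..hi} (\<lambda>r. \<Delta> r * exp (G r)) + h\<^sup>2 * J)"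
      unfolding J_def
      by (intro integral_unique has_integral_add has_integral_mult_right integrable_integral
          integrable_continuous_interval continuous_intros cG c\<Delta>)
    moreover have "(\<Sum>i<n. G (x i) + h * \<Delta> (x i)) / real n =
        (\<Sum>i<n. G (x i)) / real n + h * ((\<Sum>i<n. \<Delta> (x i)) / real n)"
      by (simp add: sum.distrib sum_distrib_left add_divide_distrib)
    ultimately have "h * ((\<Sum>i<n. \<Delta> (x i)) / real n) \<le>
        h * integral {lo..hi} (\<lambda>r. \<Delta> r * exp (G r)) + h\<^sup>2 * J" by linarith
    also have "\<dots> = h * (integral {lo..hi} (\<lambda>r. \<Delta> r * exp (G r)) + h * J)"
      by (simp add: algebra_simps power2_eq_square)
    finally show ?thesis by (rule mult_left_le_imp_le) (rule h(1))
  qed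
  show ?thesis
  proof (rule field_le_epsilon)
    fix e :: real assume e: "0 < e"
    define h where "h = min \<delta> (e / (J + 1))"
    have h: "0 < h" "h \<le> \<delta>" using \<delta> e J by (auto simp: h_def)
    have "h * J \<le> e / (J + 1) * (J + 1)"
      using J e by (intro mult_mono) (auto simp: h_def)
    then have "h * J \<le> e" using J by simp
    with step[OF h] show "(\<Sum>i<n. \<Delta> (x i)) / real n \<le> integral {lo..hi} (\<lambda>r. \<Delta> r * exp (G r)) + e"
      by linarith
  qed
qed

text \<open>The function that is 0 on the sample range and \<open>-\<infinity>\<close> outside is a
  competitor with finite likelihood.\<close>

lemma mle_finite:
  assumes mle: "is_log_concave_mle n x \<phi>" and n: "0 < n"
  shows "\<And>i. i < n \<Longrightarrow> \<phi> (x i) \<noteq> -\<infinity>"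
    and "(\<integral>\<^sup>+ r. ennreal (exp_ext (\<phi> r)) \<partial>lborel) \<noteq> \<infinity>"
proof -
  define lo hi where "lo = Min (x ` {..<n})" and "hi = Max (x ` {..<n})"
  define I where "I = (\<integral>\<^sup>+ r. ennreal (exp_ext (\<phi> r)) \<partial>lborel)"
  have "x i \<in> {lo..hi}" if "i < n" for i using that n by (auto simp: lo_def hi_def)
  then have "log_lik n x (ext_on lo hi (\<lambda>_. 0)) \<noteq> -\<infinity>"
    using n by (subst log_lik_ext_on) auto
  moreover have "concave_ext (ext_on lo hi (\<lambda>_. 0))"
    by (rule concave_ext_ext_on) (simp add: concave_on_def convex_on_const)
  ultimately have ne: "log_lik n x \<phi> \<noteq> -\<infinity>"
    using mle by (auto simp: is_log_concave_mle_def)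
  have fin: "\<phi> v \<noteq> \<infinity>" for v using mle by (simp add: is_log_concave_mle_def concave_ext_def)
  have S: "(\<Sum>i<n. \<phi> (x i)) \<noteq> \<infinity>" using fin by (simp add: sum_Pinfty)
  show I: "I \<noteq> \<infinity>"
    using ne S n unfolding log_lik_def I_def[symmetric]
    by (cases "\<Sum>i<n. \<phi> (x i)") auto
  have "(\<Sum>i<n. \<phi> (x i)) \<noteq> -\<infinity>"
    using ne n I unfolding log_lik_def I_def[symmetric]
    by (cases I rule: ennreal_cases) auto
  moreover have "(\<Sum>i<n. \<phi> (x i)) = -\<infinity>" if "i < n" "\<phi> (x i) = -\<infinity>" for i
  proof -
    have "(\<Sum>j\<in>{..<n} - {i}. \<phi> (x j)) \<noteq> \<infinity>" using fin by (simp add: sum_Pinfty)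
    then show ?thesis using that by (simp add: sum.remove[of "{..<n}" i])
  qed
  ultimately show "\<phi> (x i) \<noteq> -\<infinity>" if "i < n" for i using that by blast
qed

text \<open>Interpolating a maximizer at the sample points keeps its average and does not raise its
  integral, since the interpolant lies below. Optimality forces equal integrals, so the two
  densities agree almost everywhere and have the same distribution function.\<close>

lemma mle_interpolant:
  assumes mle: "is_log_concave_mle n x \<phi>" and n: "0 < n"
  defines "S \<equiv> x ` {..<n}"
  obtains a b c where "\<And>z. 0 \<le> c z"
    "is_log_concave_mle n x (ext_on (Min S) (Max S) (hinge_fun a b c S))"
    "\<And>t. estimated_cdf \<phi> t = estimated_cdf (ext_on (Min S) (Max S) (hinge_fun a b c S)) t"
proof -
  define k where "k r = real_of_ereal (\<phi> r)" for r
  have S: "finite S" "S \<noteq> {}" using n by (auto simp: S_def)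
  have conc: "concave_ext \<phi>" and opt: "\<And>\<psi>. concave_ext \<psi> \<Longrightarrow> log_lik n x \<psi> \<le> log_lik n x \<phi>"
    using mle by (auto simp: is_log_concave_mle_def)
  have fin: "\<phi> v \<noteq> \<infinity>" for v using conc by (simp add: concave_ext_def)
  have "S \<subseteq> {r. \<phi> r \<noteq> -\<infinity>}" using mle_finite(1)[OF mle n] by (auto simp: S_def)
  moreover have "is_interval {r. \<phi> r \<noteq> -\<infinity>}"
    using concave_ext_real(1)[OF conc] by (simp add: is_interval_convex_1)
  moreover have "Min S \<in> S" "Max S \<in> S" using S by auto
  ultimately have sub: "{Min S..Max S} \<subseteq> {r. \<phi> r \<noteq> -\<infinity>}"
    using mem_is_interval_1_I[of "{r. \<phi> r \<noteq> -\<infinity>}" "Min S" "Max S"]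
    by (meson atLeastAtMost_iff subset_iff)
  then have "concave_on {Min S..Max S} k"
    using concave_ext_real(2)[OF conc] unfolding concave_on_def k_def by (metis convex_on_subset convex_real_interval(5))
  from hinge_interpolation[OF S this] obtain a b c where c: "\<And>z. 0 \<le> c z"
    and eq: "\<And>r. r \<in> S \<Longrightarrow> hinge_fun a b c S r = k r"
    and le: "\<And>r. r \<in> {Min S..Max S} \<Longrightarrow> hinge_fun a b c S r \<le> k r" by blast
  define \<psi> where "\<psi> = ext_on (Min S) (Max S) (hinge_fun a b c S)"
  have \<psi>: "concave_ext \<psi>" unfolding \<psi>_def
    by (intro concave_ext_ext_on concave_on_hinge_fun c)
  have \<phi>k: "\<phi> r = ereal (k r)" if "r \<in> {Min S..Max S}" for r
    using sub that fin[of r] by (cases "\<phi> r") (auto simp: k_def)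
  have \<psi>\<phi>: "\<psi> r \<le> \<phi> r" for r
    using le[of r] \<phi>k[of r] by (auto simp: \<psi>_def ext_on_def)
  have xS: "x i \<in> S" "x i \<in> {Min S..Max S}" if "i < n" for i
    using that S by (auto simp: S_def)
  have \<psi>x: "\<psi> (x i) = \<phi> (x i)" if "i < n" for i
    using xS[OF that] eq[of "x i"] \<phi>k[of "x i"] by (simp add: \<psi>_def ext_on_def)
  define I J where "I = (\<integral>\<^sup>+ r. ennreal (exp_ext (\<phi> r)) \<partial>lborel)"
    and "J = (\<integral>\<^sup>+ r. ennreal (exp_ext (\<psi> r)) \<partial>lborel)"
  have I: "I \<noteq> \<infinity>" unfolding I_def by (rule mle_finite(2)[OF mle n])
  have JI: "J \<le> I" unfolding I_def J_def
    by (intro nn_integral_mono ennreal_leI exp_ext_mono \<psi>\<phi> fin)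
  define s where "s = (\<Sum>i<n. k (x i)) / real n"
  have s: "(\<Sum>i<n. \<phi> (x i)) / ereal (real n) = ereal s"
  proof -
    have "(\<Sum>i<n. \<phi> (x i)) = (\<Sum>i<n. ereal (k (x i)))" using \<phi>k xS by (intro sum.cong) auto
    then show ?thesis using n by (simp add: s_def)
  qed
  have lik: "log_lik n x \<phi> = ereal s - enn2ereal I" "log_lik n x \<psi> = ereal s - enn2ereal J"
    using s \<psi>x by (simp_all add: log_lik_def I_def J_def)
  have "log_lik n x \<psi> \<le> log_lik n x \<phi>" by (rule opt[OF \<psi>])
  then have "I \<le> J" unfolding lik
    by (cases I rule: ennreal_cases; cases J rule: ennreal_cases) (use I JI in auto)
  with JI have IJ: "I = J" by simp
  have mle\<psi>: "is_log_concave_mle n x \<psi>"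
    using opt \<psi> by (simp add: is_log_concave_mle_def lik IJ)
  have meas: "(\<lambda>r. exp_ext (\<phi> r)) \<in> borel_measurable borel" "(\<lambda>r. exp_ext (\<psi> r)) \<in> borel_measurable borel"
    using conc \<psi> by (simp_all add: borel_measurable_exp_ext)
  have "AE r in lborel. ennreal (exp_ext (\<phi> r)) - ennreal (exp_ext (\<psi> r)) = 0"
  proof -
    have "(\<integral>\<^sup>+ r. ennreal (exp_ext (\<phi> r)) - ennreal (exp_ext (\<psi> r)) \<partial>lborel) = I - J"
      unfolding I_def J_def
      by (rule nn_integral_diff)
         (use meas I IJ in \<open>auto simp: J_def intro!: ennreal_leI exp_ext_mono \<psi>\<phi> fin\<close>)
    also have "\<dots> = 0" using I IJ by simp
    finally show ?thesis using meas by (subst (asm) nn_integral_0_iff_AE) auto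
  qed
  then have ae: "AE r in lborel. exp_ext (\<phi> r) = exp_ext (\<psi> r)"
  proof eventually_elim
    case (elim r)
    then have "ennreal (exp_ext (\<phi> r)) \<le> ennreal (exp_ext (\<psi> r))"
      by (simp add: diff_eq_0_iff_ennreal)
    then have "exp_ext (\<phi> r) \<le> exp_ext (\<psi> r)" by (simp add: ennreal_le_iff exp_ext_nonneg)
    with exp_ext_mono[OF \<psi>\<phi> fin, of r] show ?case by simp
  qed
  have "estimated_cdf \<phi> t = estimated_cdf \<psi> t" for t
    unfolding estimated_cdf_def set_lebesgue_integral_def
    by (rule integral_cong_AE) (use ae meas in auto)
  with c mle\<psi> that show ?thesis unfolding \<psi>_def by blast
qed

section \<open>Integrals of the two distribution functions\<close>

lemma step_has_integral:
  fixes c lo y :: real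
  assumes "lo \<le> c"
  shows "((\<lambda>r. if c \<le> r then 1 else 0) has_integral max 0 (y - c)) {lo..y}"
proof (cases "c \<le> y")
  case True
  have "((\<lambda>r. 1::real) has_integral (y - c)) {c..y}"
    using has_integral_const_real[of "1::real" c y] True by simp
  then have "((\<lambda>r. if r \<in> {c..y} then 1 else 0::real) has_integral (y - c)) {lo..y}"
    using assms by (subst has_integral_restrict) auto
  then have "((\<lambda>r. if c \<le> r then 1 else 0::real) has_integral (y - c)) {lo..y}"
    by (rule has_integral_eq[rotated]) auto
  with True show ?thesis by simp
next
  case False
  then have "((\<lambda>r. if c \<le> r then 1 else 0::real) has_integral 0) {lo..y}"
    by (intro has_integral_is_0) auto
  with False show ?thesis by simp
qed

lemma empirical_cdf_eq_sum:
  "empirical_cdf n x t = (\<Sum>i<n. if x i \<le> t then 1 else 0) / real n"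
proof -
  have "(\<Sum>i<n. if x i \<le> t then 1 else 0 :: real) = real (card {i. i < n \<and> x i \<le> t})"
    by (simp add: sum.If_cases Int_def)
  then show ?thesis by (simp add: empirical_cdf_def)
qed

lemma empirical_cdf_has_integral:
  assumes "\<And>i. i < n \<Longrightarrow> lo \<le> x i"
  shows "(empirical_cdf n x has_integral (\<Sum>i<n. max 0 (y - x i)) / real n) {lo..y}"
proof -
  have "((\<lambda>r. (\<Sum>i<n. if x i \<le> r then 1 else 0) / real n) has_integral
      (\<Sum>i<n. max 0 (y - x i)) / real n) {lo..y}"
    using assms by (intro has_integral_divide has_integral_sum step_has_integral) auto
  then show ?thesis by (simp add: empirical_cdf_eq_sum[abs_def])
qed

lemma iterated_integral_has_integral:
  fixes e :: "real \<Rightarrow> real"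
  assumes e: "continuous_on {lo..y} e" and y: "lo \<le> y"
  shows "((\<lambda>r. integral {lo..r} e) has_integral integral {lo..y} (\<lambda>r. (y - r) * e r)) {lo..y}"
proof -
  \<comment> \<open>Integration by parts: in the derivative of \<open>V\<close> the terms
    \<open>z * e z\<close> cancel.\<close>
  define V where "V z = z * integral {lo..z} e - integral {lo..z} (\<lambda>r. r * e r)" for z
  have ce: "continuous_on {lo..y} (\<lambda>r. r * e r)" by (intro continuous_intros e)
  have "((\<lambda>r. integral {lo..r} e) has_integral V y - V lo) {lo..y}"
  proof (rule fundamental_theorem_of_calculus[OF y])
    fix z assume z: "z \<in> {lo..y}"
    have "(V has_real_derivative integral {lo..z} e) (at z within {lo..y})"
      unfolding V_def
      using integral_has_real_derivative[OF e z] integral_has_real_derivative[OF ce z]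
      by (auto intro!: derivative_eq_intros)
    then show "(V has_vector_derivative integral {lo..z} e) (at z within {lo..y})"
      by (simp add: has_real_derivative_iff_has_vector_derivative)
  qed
  moreover have "V y - V lo = integral {lo..y} (\<lambda>r. (y - r) * e r)"
  proof -
    have "((\<lambda>r. y * e r - r * e r) has_integral (y * integral {lo..y} e - integral {lo..y} (\<lambda>r. r * e r))) {lo..y}"
      by (intro has_integral_diff has_integral_mult_right integrable_integral integrable_continuous_interval e ce)
    then have "integral {lo..y} (\<lambda>r. y * e r - r * e r) = V y"
      unfolding V_def by (rule integral_unique)
    then show ?thesis by (simp add: V_def left_diff_distrib)
  qed
  ultimately show ?thesis by simp
qed

lemma estimated_cdf_ext_on:
  assumes G: "continuous_on UNIV G" and t: "t \<in> {lo..hi}"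
  shows "estimated_cdf (ext_on lo hi G) t = integral {lo..t} (\<lambda>r. exp (G r))"
proof -
  have "continuous_on {lo..t} (\<lambda>r. exp (G r))"
    using G continuous_on_subset by (intro continuous_on_exp) blast
  then have int: "set_integrable lborel {lo..t} (\<lambda>r. exp (G r))"
    by (rule borel_integrable_atLeastAtMost')
  have "estimated_cdf (ext_on lo hi G) t = (LINT r:{lo..t}|lborel. exp (G r))"
    unfolding estimated_cdf_def set_lebesgue_integral_def exp_ext_ext_on
    using t by (intro Bochner_Integration.integral_cong) (auto simp: indicator_def)
  also have "\<dots> = integral {lo..t} (\<lambda>r. exp (G r))"
    by (rule set_borel_integral_eq_integral(2)[OF int])
  finally show ?thesis .
qed

lemma concave_on_add_scaled:
  fixes G \<Delta> :: "real \<Rightarrow> real"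
  assumes "concave_on UNIV G" "concave_on UNIV \<Delta>" "0 \<le> h"
  shows "concave_on UNIV (\<lambda>r. G r + h * \<Delta> r)"
proof -
  have "convex_on UNIV (\<lambda>r. - G r + h * - \<Delta> r)"
    using assms unfolding concave_on_def by (intro convex_on_add convex_on_cmul)
  then show ?thesis by (simp add: concave_on_def)
qed

lemma concave_on_affine: "concave_on UNIV (\<lambda>r::real. a + b * r :: real)"
  unfolding concave_on_def by (rule convex_onI) (auto simp: algebra_simps)

lemma concave_on_neg_hinge: "concave_on UNIV (\<lambda>r::real. - max 0 (x - r) :: real)"
  unfolding concave_on_def
proof (rule convex_onI)
  fix t p q :: real assume t: "0 < t" "t < 1"
  have "max 0 ((1 - t) * (- p) + t * (- q) - (- x)) \<le> (1 - t) * max 0 (- p - (- x)) + t * max 0 (- q - (- x))"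
    using t by (intro max_affine_convex) auto
  then show "- (- max 0 (x - ((1 - t) *\<^sub>R p + t *\<^sub>R q))) \<le>
      (1 - t) * (- (- max 0 (x - p))) + t * (- (- max 0 (x - q)))"
    by (simp add: algebra_simps)
qed simp

text \<open>
  \<open>D \<le> 0\<close> comes from perturbing the estimator by \<open>- max 0 (y - r)\<close>.  At a kink the opposite perturbation
  is also admissible, hence \<open>D = 0\<close> there; so the estimator is affine between adjacent zeros of \<open>D\<close>.
\<close>

lemma mle_structure:
  assumes mle: "is_log_concave_mle n x \<phi>" and n: "0 < n"
  defines "lo \<equiv> Min (x ` {..<n})" and "hi \<equiv> Max (x ` {..<n})"
  defines "D \<equiv> \<lambda>y. integral {lo..y} (\<lambda>r. estimated_cdf \<phi> r - empirical_cdf n x r)"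
  obtains G where "continuous_on UNIV G"
    and "\<And>t. t \<in> {lo..hi} \<Longrightarrow> estimated_cdf \<phi> t = integral {lo..t} (\<lambda>r. exp (G r))"
    and "integral {lo..hi} (\<lambda>r. exp (G r)) = 1"
    and "\<And>y. y \<in> {lo..hi} \<Longrightarrow> D y \<le> 0"
    and "\<And>t. t \<in> {lo..hi} \<Longrightarrow> \<exists>s u p q. s \<in> x ` {..<n} \<and> u \<in> x ` {..<n} \<and> s \<le> t \<and> t \<le> u \<and>
      D s = 0 \<and> D u = 0 \<and> (\<forall>r\<in>{s..u}. G r = p + q * r)"
proof -
  define S where "S = x ` {..<n}"
  have S: "finite S" "S \<noteq> {}" using n by (auto simp: S_def)
  have lohi: "lo = Min S" "hi = Max S" by (simp_all add: lo_def hi_def S_def)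
  obtain a b c where c: "\<And>z. 0 \<le> c z"
    and mle': "is_log_concave_mle n x (ext_on lo hi (hinge_fun a b c S))"
    and cdf: "\<And>t. estimated_cdf \<phi> t = estimated_cdf (ext_on lo hi (hinge_fun a b c S)) t"
    using mle_interpolant[OF mle n] unfolding lohi S_def by metis
  define G where "G = hinge_fun a b c S"
  note mle' = mle'[folded G_def]
  have G: "continuous_on UNIV G" unfolding G_def by (rule continuous_on_hinge_fun)
  have GA: "continuous_on A (\<lambda>r. exp (G r))" for A
    using G continuous_on_subset by (intro continuous_on_exp) blast
  have Gc: "concave_on UNIV G" unfolding G_def by (rule concave_on_hinge_fun) (rule c)
  have x: "x i \<in> {lo..hi}" if "i < n" for i using that S by (auto simp: lohi S_def)
  have lh: "lo \<in> S" "hi \<in> S" "lo \<le> hi" using S by (auto simp: lohi)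
  define mean where "mean \<Delta> = (\<Sum>i<n. \<Delta> (x i)) / real n" for \<Delta> :: "real \<Rightarrow> real"
  define int where "int \<Delta> = integral {lo..hi} (\<lambda>r. \<Delta> r * exp (G r))" for \<Delta> :: "real \<Rightarrow> real"
  have pert: "mean \<Delta> \<le> int \<Delta>" if "continuous_on UNIV \<Delta>" "concave_on UNIV \<Delta>" for \<Delta>
    unfolding mean_def int_def
    by (rule concave_on_perturb_ext[OF mle' n x G that(1), of 1])
       (use Gc that(2) in \<open>auto intro!: concave_on_add_scaled\<close>)
  have int_minus: "int (\<lambda>r. - \<Delta> r) = - int \<Delta>" for \<Delta> by (simp add: int_def)
  have mean_minus: "mean (\<lambda>r. - \<Delta> r) = - mean \<Delta>" for \<Delta> by (simp add: mean_def sum_negf)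
  \<comment> \<open>Affine perturbations are admissible with both signs, so the first-order
    condition becomes an equality. The constant 1 gives total mass one.\<close>
  have aff: "mean (\<lambda>r. p + q * r) = int (\<lambda>r. p + q * r)" for p q
  proof (rule antisym)
    show "mean (\<lambda>r. p + q * r) \<le> int (\<lambda>r. p + q * r)"
      by (intro pert continuous_intros concave_on_affine)
    have "mean (\<lambda>r. - p + (- q) * r) \<le> int (\<lambda>r. - p + (- q) * r)"
      by (intro pert continuous_intros concave_on_affine)
    then have "mean (\<lambda>r. - (p + q * r)) \<le> int (\<lambda>r. - (p + q * r))" by simp
    then show "int (\<lambda>r. p + q * r) \<le> mean (\<lambda>r. p + q * r)" by (simp only: int_minus mean_minus)
  qed
  have mass: "integral {lo..hi} (\<lambda>r. exp (G r)) = 1"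
    using aff[of 1 0] n by (simp add: mean_def int_def)
  have cdf': "estimated_cdf \<phi> t = integral {lo..t} (\<lambda>r. exp (G r))" if "t \<in> {lo..hi}" for t
    using cdf[of t] estimated_cdf_ext_on[OF G that] by (simp add: G_def)
  \<comment> \<open>Integrating a distribution function up to \<open>y\<close> tests the
    distribution against the hinge \<open>max 0 (y - r)\<close>; \<open>D y\<close> is thus the
    defect in the first-order condition for this hinge.\<close>
  have D: "D y = int (\<lambda>r. max 0 (y - r)) - mean (\<lambda>r. max 0 (y - r))" if y: "y \<in> {lo..hi}" for y
  proof -
    have "((\<lambda>r. integral {lo..r} (\<lambda>r. exp (G r)) - empirical_cdf n x r) has_integral
       integral {lo..y} (\<lambda>r. (y - r) * exp (G r)) - mean (\<lambda>r. max 0 (y - r))) {lo..y}"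
      unfolding mean_def using x y
      by (intro has_integral_diff iterated_integral_has_integral empirical_cdf_has_integral GA) auto
    then have "((\<lambda>r. estimated_cdf \<phi> r - empirical_cdf n x r) has_integral
       integral {lo..y} (\<lambda>r. (y - r) * exp (G r)) - mean (\<lambda>r. max 0 (y - r))) {lo..y}"
      by (rule has_integral_eq[rotated]) (use y cdf' in auto)
    then have "D y = integral {lo..y} (\<lambda>r. (y - r) * exp (G r)) - mean (\<lambda>r. max 0 (y - r))"
      unfolding D_def by (rule integral_unique)
    moreover have "int (\<lambda>r. max 0 (y - r)) = integral {lo..y} (\<lambda>r. max 0 (y - r) * exp (G r)) +
        integral {y..hi} (\<lambda>r. max 0 (y - r) * exp (G r))"
      unfolding int_def using y
      by (intro Henstock_Kurzweil_Integration.integral_combine[symmetric] integrable_continuous_interval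
          continuous_intros GA) auto
    moreover have "integral {lo..y} (\<lambda>r. max 0 (y - r) * exp (G r)) = integral {lo..y} (\<lambda>r. (y - r) * exp (G r))"
      by (rule Henstock_Kurzweil_Integration.integral_cong) auto
    moreover have "integral {y..hi} (\<lambda>r. max 0 (y - r) * exp (G r)) = integral {y..hi} (\<lambda>r. 0)"
      by (rule Henstock_Kurzweil_Integration.integral_cong) auto
    ultimately show ?thesis by simp
  qed
  have D_le: "D y \<le> 0" if y: "y \<in> {lo..hi}" for y
  proof -
    have "mean (\<lambda>r. - max 0 (y - r)) \<le> int (\<lambda>r. - max 0 (y - r))"
      by (intro pert continuous_intros concave_on_neg_hinge)
    then show ?thesis using D[OF y] by (simp only: int_minus mean_minus)
  qed
  have D_lo: "D lo = 0" by (simp add: D_def)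
  \<comment> \<open>On the sample range \<open>max 0 (hi - r)\<close> is affine.\<close>
  have D_hi: "D hi = 0"
  proof -
    have "int (\<lambda>r. max 0 (hi - r)) = int (\<lambda>r. hi + (- 1) * r)"
      unfolding int_def by (rule Henstock_Kurzweil_Integration.integral_cong) auto
    moreover have "mean (\<lambda>r. max 0 (hi - r)) = mean (\<lambda>r. hi + (- 1) * r)"
      unfolding mean_def using x by (intro arg_cong2[where f = "(/)"] sum.cong) auto
    ultimately show ?thesis using D[of hi] lh aff[of hi "- 1"] by simp
  qed
  \<comment> \<open>Lowering the weight at \<open>z\<close> by \<open>h \<le> c z\<close> preserves
    concavity, which admits the perturbation \<open>max 0 (r - z)\<close>. It differs from
    \<open>max 0 (z - r)\<close> by an affine function, to which \<open>aff\<close> applies.\<close>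
  have D_kink: "D z = 0" if z: "z \<in> S" "c z > 0" for z
  proof -
    have zl: "z \<in> {lo..hi}" using z S by (auto simp: lohi)
    have "mean (\<lambda>r. max 0 (r - z)) \<le> int (\<lambda>r. max 0 (r - z))"
      unfolding mean_def int_def
    proof (rule concave_on_perturb_ext[OF mle' n x G _ z(2)])
      fix h :: real assume h: "0 < h" "h \<le> c z"
      have "(\<Sum>v\<in>S. (c(z := c z - h)) v * max 0 (r - v)) = (\<Sum>v\<in>S. c v * max 0 (r - v)) - h * max 0 (r - z)" for r
      proof -
        have "(\<Sum>v\<in>S. (c(z := c z - h)) v * max 0 (r - v)) =
            (\<Sum>v\<in>S. c v * max 0 (r - v) - (if v = z then h * max 0 (r - z) else 0))"
          by (intro sum.cong) (auto simp: algebra_simps)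
        then show ?thesis using S z by (simp add: sum_subtractf)
      qed
      then have "(\<lambda>r. G r + h * max 0 (r - z)) = hinge_fun a b (c(z := c z - h)) S"
        by (auto simp: G_def hinge_fun_def)
      then show "concave_on UNIV (\<lambda>r. G r + h * max 0 (r - z))"
        using c h by (auto intro: concave_on_hinge_fun)
    qed (auto intro!: continuous_intros)
    moreover have "mean (\<lambda>r. max 0 (r - z)) = mean (\<lambda>r. max 0 (z - r)) + mean (\<lambda>r. - z + 1 * r)"
      unfolding mean_def add_divide_distrib[symmetric] sum.distrib[symmetric]
      by (intro arg_cong2[where f = "(/)"] sum.cong) (auto simp: max_def)
    moreover have "int (\<lambda>r. max 0 (r - z)) = int (\<lambda>r. max 0 (z - r)) + int (\<lambda>r. - z + 1 * r)"
    proof -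
      have "int (\<lambda>r. max 0 (z - r)) + int (\<lambda>r. - z + 1 * r) =
          integral {lo..hi} (\<lambda>r. max 0 (z - r) * exp (G r) + (- z + 1 * r) * exp (G r))"
        unfolding int_def
        by (intro Henstock_Kurzweil_Integration.integral_add[symmetric] integrable_continuous_interval
            continuous_intros GA)
      also have "\<dots> = int (\<lambda>r. max 0 (r - z))"
        unfolding int_def
        by (rule Henstock_Kurzweil_Integration.integral_cong) (auto simp: max_def algebra_simps)
      finally show ?thesis by simp
    qed
    ultimately have "0 \<le> D z" using D[OF zl] aff[of "- z" 1] by linarith
    with D_le[OF zl] show ?thesis by simp
  qed
  have "\<exists>s u p q. s \<in> x ` {..<n} \<and> u \<in> x ` {..<n} \<and> s \<le> t \<and> t \<le> u \<and>
      D s = 0 \<and> D u = 0 \<and> (\<forall>r\<in>{s..u}. G r = p + q * r)" if t: "t \<in> {lo..hi}" for t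
  proof -
    \<comment> \<open>Among the sample points with \<open>D = 0\<close>, the nearest ones on either
      side of \<open>t\<close> are taken; a kink strictly between them would be a nearer
      zero.\<close>
    define L U where "L = {z \<in> S. D z = 0 \<and> z \<le> t}" and "U = {z \<in> S. D z = 0 \<and> t \<le> z}"
    have LU: "finite L" "lo \<in> L" "finite U" "hi \<in> U"
      using S lh t D_lo D_hi by (auto simp: L_def U_def)
    define s u where "s = Max L" and "u = Min U"
    have s: "s \<in> L" "\<And>z. z \<in> L \<Longrightarrow> z \<le> s"
      unfolding s_def using LU(1,2) by (blast intro: Max_in Max_ge)+
    have u: "u \<in> U" "\<And>z. z \<in> U \<Longrightarrow> u \<le> z"
      unfolding u_def using LU(3,4) by (blast intro: Min_in Min_le)+
    have c0: "c z = 0" if z: "z \<in> S" "s < z" "z < u" for z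
    proof (rule ccontr)
      assume "c z \<noteq> 0"
      then have "D z = 0" using D_kink[OF z(1)] c[of z] by simp
      then have "z \<in> L \<or> z \<in> U" using z by (auto simp: L_def U_def)
      with s(2)[of z] u(2)[of z] z show False by auto
    qed
    have "G r = (a + (\<Sum>z\<in>{z \<in> S. z \<le> s}. c z * z)) + (b - (\<Sum>z\<in>{z \<in> S. z \<le> s}. c z)) * r"
      if r: "r \<in> {s..u}" for r
    proof -
      have "(\<Sum>z\<in>S. c z * max 0 (r - z)) = (\<Sum>z\<in>S. if z \<le> s then c z * (r - z) else 0)"
        using r c0 by (intro sum.cong) (auto simp: max_def)
      also have "\<dots> = (\<Sum>z\<in>{z \<in> S. z \<le> s}. c z * (r - z))"
        using S by (simp add: sum.If_cases Int_def)
      finally show ?thesis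
        by (simp add: G_def hinge_fun_def right_diff_distrib sum_subtractf sum_distrib_right left_diff_distrib)
    qed
    moreover have "s \<in> x ` {..<n}" "u \<in> x ` {..<n}" "s \<le> t" "t \<le> u" "D s = 0" "D u = 0"
      using s(1) u(1) by (auto simp: L_def U_def S_def)
    ultimately show ?thesis by blast
  qed
  with that[OF G cdf' mass D_le] show ?thesis by blast
qed

section \<open>The distance of the distribution functions for a good sample\<close>

text \<open>The deterministic half of the argument, for one realisation \<open>x\<close>. Chance
  enters only through the requirements that the sample lies in \<open>J\<close>, is bounded by
  \<open>R - 1\<close>, reaches past \<open>A\<close> and \<open>B\<close>, and obeys the modulus;
  the facts on \<open>G\<close> are those of \<open>mle_structure\<close>.\<close>

locale good_sample =
  fixes f p :: "real \<Rightarrow> real" and J :: "real set" and A B c m0 M0 Fm K R r Lam \<kappa> :: real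
    and n :: nat and x :: "nat \<Rightarrow> real" and \<phi>h :: "real \<Rightarrow> ereal" and G :: "real \<Rightarrow> real"
  assumes J: "convex J" and p_concave: "concave_on J p"
    and f_exp: "\<And>v. v \<in> J \<Longrightarrow> f v = exp (p v)" and p_cont: "continuous_on J p"
    and AB: "A < B" and c: "0 < c" "c \<le> 1" and ABJ: "{A - c..B + c} \<subseteq> J"
    and m0: "0 < m0" "\<And>v. v \<in> {A - c..B + c} \<Longrightarrow> m0 \<le> f v"
    and M0: "\<And>v. v \<in> {A - c..B + c} \<Longrightarrow> f v \<le> M0"
    and Fm: "\<And>a b. a \<le> b \<Longrightarrow> integral {a..b} f \<le> Fm * (b - a)" and Fm0: "0 \<le> Fm"
    and K: "0 < K" and r: "0 < r" "r \<le> 1"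
    and \<kappa>: "0 < \<kappa>" "\<And>v d. A \<le> v \<Longrightarrow> 0 \<le> d \<Longrightarrow> v + 2 * d \<le> B \<Longrightarrow>
      p v + p (v + 2 * d) - 2 * p (v + d) \<le> - (\<kappa> * d\<^sup>2)"
    and n: "0 < n" and G_cont: "continuous_on UNIV G"
    and G_cdf: "\<And>t. t \<in> {Min (x ` {..<n})..Max (x ` {..<n})} \<Longrightarrow>
      estimated_cdf \<phi>h t = integral {Min (x ` {..<n})..t} (\<lambda>r. exp (G r))"
    and G_mass: "integral {Min (x ` {..<n})..Max (x ` {..<n})} (\<lambda>r. exp (G r)) = 1"
    and G_nonpos: "\<And>v. v \<in> {Min (x ` {..<n})..Max (x ` {..<n})} \<Longrightarrow>
      integral {Min (x ` {..<n})..v} (\<lambda>r. estimated_cdf \<phi>h r - empirical_cdf n x r) \<le> 0"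
    and G_contact: "\<And>t. t \<in> {Min (x ` {..<n})..Max (x ` {..<n})} \<Longrightarrow>
      \<exists>s u p q. s \<in> x ` {..<n} \<and> u \<in> x ` {..<n} \<and> s \<le> t \<and> t \<le> u \<and>
        integral {Min (x ` {..<n})..s} (\<lambda>r. estimated_cdf \<phi>h r - empirical_cdf n x r) = 0 \<and>
        integral {Min (x ` {..<n})..u} (\<lambda>r. estimated_cdf \<phi>h r - empirical_cdf n x r) = 0 \<and>
        (\<forall>r\<in>{s..u}. G r = p + q * r)"
    and xJ: "\<And>i. i < n \<Longrightarrow> x i \<in> J" and xR: "\<And>i. i < n \<Longrightarrow> \<bar>x i\<bar> \<le> R - 1"
    and xA: "\<exists>i<n. x i \<le> A" and xB: "\<exists>i<n. B \<le> x i"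
    and modulus: "\<And>a b. - R \<le> a \<Longrightarrow> a \<le> b \<Longrightarrow> b \<le> R \<Longrightarrow>
      \<bar>empirical_cdf n x b - empirical_cdf n x a - integral {a..b} f\<bar> \<le> emp_modulus K r (b - a)"
    and Lam: "2 * R * emp_modulus (3 * K + Fm) r (2 * R) \<le> Lam"
begin

abbreviation "lo \<equiv> Min (x ` {..<n})"
abbreviation "hi \<equiv> Max (x ` {..<n})"
abbreviation "Fn \<equiv> empirical_cdf n x"
definition "y v = estimated_cdf \<phi>h v - Fn v"
definition "D v = integral {lo..v} y"
text \<open>Large enough to absorb the error \<open>(2 * K + Fm) * r\<close> at a contact point
  together with a modulus of constant \<open>K\<close>; see \<open>kr_nonneg\<close>.\<close>

definition "k = 3 * K + Fm"

lemma x_lohi: "i < n \<Longrightarrow> lo \<le> x i" "i < n \<Longrightarrow> x i \<le> hi"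
  by auto

lemma lohi_mem: "lo \<in> x ` {..<n}" "hi \<in> x ` {..<n}"
  using n by (auto intro!: Min_in Max_in)

lemma lohi_R: "- R + 1 \<le> lo" "hi \<le> R - 1" "lo \<le> hi"
proof -
  obtain i j where "i < n" "lo = x i" "j < n" "hi = x j" using lohi_mem by auto
  then show "- R + 1 \<le> lo" "hi \<le> R - 1" using xR[of i] xR[of j] by auto
  show "lo \<le> hi" using n by (intro Min_le Max_in) auto
qed

lemma lohi_AB: "lo \<le> A" "B \<le> hi"
proof -
  obtain i where "i < n" "x i \<le> A" using xA by auto
  then show "lo \<le> A" using x_lohi(1)[of i] by linarith
  obtain j where "j < n" "B \<le> x j" using xB by auto
  then show "B \<le> hi" using x_lohi(2)[of j] by linarith
qed

lemma Fn_lo: "v < lo \<Longrightarrow> Fn v = 0"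
proof -
  assume "v < lo"
  then have "\<not> x i \<le> v" if "i < n" for i using x_lohi(1)[OF that] by linarith
  then show ?thesis by (simp add: empirical_cdf_eq_sum)
qed

lemma Fn_hi: "Fn hi = 1"
  using n x_lohi(2) by (simp add: empirical_cdf_eq_sum)

lemmas G = G_cont G_cdf G_mass
  G_nonpos[folded y_def[abs_def], folded D_def] G_contact[folded y_def[abs_def], folded D_def]

lemma expG_cont: "continuous_on S (\<lambda>r. exp (G r))"
  using G(1) continuous_on_subset by (intro continuous_on_exp) blast

lemma expG_int: "(\<lambda>r. exp (G r)) integrable_on {a..b}"
  by (rule integrable_continuous_interval[OF expG_cont])

lemma Fh_diff:
  assumes "lo \<le> a" "a \<le> b" "b \<le> hi"
  shows "estimated_cdf \<phi>h b - estimated_cdf \<phi>h a = integral {a..b} (\<lambda>r. exp (G r))"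
  using Henstock_Kurzweil_Integration.integral_combine[OF assms(1,2) expG_int] assms G(2)[of a] G(2)[of b]
  by simp

lemma Fh_mono: "lo \<le> a \<Longrightarrow> a \<le> b \<Longrightarrow> b \<le> hi \<Longrightarrow> estimated_cdf \<phi>h a \<le> estimated_cdf \<phi>h b"
  using Fh_diff[of a b] Henstock_Kurzweil_Integration.integral_nonneg[OF expG_int, of a b] by simp

lemma y_int: "{a..b} \<subseteq> {lo..hi} \<Longrightarrow> y integrable_on {a..b}"
proof -
  assume ab: "{a..b} \<subseteq> {lo..hi}"
  have "(\<lambda>v. integral {lo..v} (\<lambda>r. exp (G r))) integrable_on {lo..hi}"
    by (intro integrable_continuous_interval indefinite_integral_continuous_1 expG_int)
  moreover have "Fn integrable_on {lo..hi}"
    by (rule has_integral_integrable[OF empirical_cdf_has_integral]) (rule x_lohi)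
  ultimately have "(\<lambda>v. integral {lo..v} (\<lambda>r. exp (G r)) - Fn v) integrable_on {lo..hi}"
    by (rule Henstock_Kurzweil_Integration.integrable_diff)
  then have "y integrable_on {lo..hi}"
    by (rule integrable_eq) (simp add: y_def G(2))
  then show ?thesis using ab by (rule integrable_on_subinterval)
qed

lemma D_diff:
  assumes "lo \<le> a" "a \<le> b" "b \<le> hi"
  shows "integral {a..b} y = D b - D a"
  using Henstock_Kurzweil_Integration.integral_combine[OF assms(1,2) y_int] assms
  by (simp add: D_def)

text \<open>\<open>y\<close> is the density of \<open>D\<close>, and \<open>D \<le> 0\<close>
  attains its maximum at \<open>z\<close>. The estimated distribution function increases and the
  empirical one gains at most \<open>(2 * K + Fm) * r\<close> over a length \<open>r\<close>; a
  larger positive \<open>y z\<close> would therefore persist to the right of \<open>z\<close> and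
  make \<open>D\<close> positive. A very negative \<open>y z\<close> fails in the same way on the
  left.\<close>

lemma contact_small:
  assumes z: "z \<in> {lo..hi}" "D z = 0"
  shows "\<bar>y z\<bar> \<le> (2 * K + Fm) * r"
proof -
  have jump: "Fn b - Fn a \<le> (2 * K + Fm) * r" if "- R \<le> a" "a \<le> b" "b \<le> R" "b - a \<le> r" for a b
  proof -
    have "Fn b - Fn a \<le> integral {a..b} f + emp_modulus K r (b - a)"
      using modulus[OF that(1-3)] by linarith
    also have "\<dots> \<le> Fm * (b - a) + emp_modulus K r r"
      using Fm[OF that(2)] that K r by (intro add_mono emp_modulus_mono) auto
    also have "\<dots> \<le> Fm * r + K * (2 * r)"
      using that Fm0 r by (intro add_mono mult_left_mono) (auto simp: emp_modulus_def)
    finally show ?thesis by (simp add: algebra_simps)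
  qed
  have "y z \<le> (2 * K + Fm) * r"
  proof (cases "z = hi")
    case True
    have "0 \<le> (2 * K + Fm) * r" using K Fm0 r by simp
    with True show ?thesis using G(2)[of hi] G(3) lohi_R by (simp add: y_def Fn_hi)
  next
    case False
    define h where "h = min r (hi - z)"
    have h: "0 < h" "h \<le> r" "z + h \<le> hi" using False z r by (auto simp: h_def)
    have "(y z - (2 * K + Fm) * r) * h \<le> integral {z..z + h} y"
    proof -
      have "integral {z..z + h} (\<lambda>_. y z - (2 * K + Fm) * r) \<le> integral {z..z + h} y"
      proof (rule integral_le)
        fix v assume v: "v \<in> {z..z + h}"
        have "Fn v - Fn z \<le> (2 * K + Fm) * r" using v h z lohi_R by (intro jump) auto
        moreover have "estimated_cdf \<phi>h z \<le> estimated_cdf \<phi>h v" using v h z by (intro Fh_mono) auto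
        ultimately show "y z - (2 * K + Fm) * r \<le> y v" by (simp add: y_def)
      qed (use z h in \<open>auto intro!: y_int\<close>)
      then show ?thesis using h by (simp add: mult.commute)
    qed
    also have "\<dots> = D (z + h) - D z" using z h by (intro D_diff) auto
    also have "\<dots> \<le> 0" using G(4)[of "z + h"] z h by auto
    finally show ?thesis using h by (simp add: mult_le_0_iff)
  qed
  moreover have "- ((2 * K + Fm) * r) \<le> y z"
  proof (cases "z = lo")
    case True
    \<comment> \<open>The margin in \<open>\<bar>x i\<bar> \<le> R - 1\<close> and
      \<open>r \<le> 1\<close> keep \<open>lo - r\<close> in the range where the modulus
      holds.\<close>
    have "Fn lo - Fn (lo - r) \<le> (2 * K + Fm) * r"
      using r lohi_R by (intro jump) linarith+
    moreover have "Fn (lo - r) = 0" using r by (intro Fn_lo) simp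
    moreover have "estimated_cdf \<phi>h lo = 0" using G(2)[of lo] lohi_R by simp
    ultimately show ?thesis using True by (simp add: y_def)
  next
    case False
    define h where "h = min r (z - lo)"
    have h: "0 < h" "h \<le> r" "lo \<le> z - h" using False z r by (auto simp: h_def)
    have "0 \<le> D z - D (z - h)" using G(4)[of "z - h"] z h by auto
    also have "\<dots> = integral {z - h..z} y" using z h by (intro D_diff[symmetric]) auto
    also have "\<dots> \<le> integral {z - h..z} (\<lambda>_. y z + (2 * K + Fm) * r)"
    proof (rule integral_le)
      fix v assume v: "v \<in> {z - h..z}"
      have "Fn z - Fn v \<le> (2 * K + Fm) * r" using v h z lohi_R by (intro jump) auto
      moreover have "estimated_cdf \<phi>h v \<le> estimated_cdf \<phi>h z" using v h z by (intro Fh_mono) auto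
      ultimately show "y v \<le> y z + (2 * K + Fm) * r" by (simp add: y_def)
    qed (use z h in \<open>auto intro!: y_int\<close>)
    finally have "0 \<le> h * (y z + (2 * K + Fm) * r)" using h by simp
    then show ?thesis using h by (simp add: zero_le_mult_iff)
  qed
  ultimately show ?thesis by simp
qed

lemma f_cont: "{a..b} \<subseteq> J \<Longrightarrow> continuous_on {a..b} f"
  by (subst continuous_on_cong[OF refl, of _ f "\<lambda>v. exp (p v)"])
     (auto simp: f_exp intro!: continuous_on_exp continuous_on_subset[OF p_cont])

lemma k_pos: "0 < k" using K Fm0 by (simp add: k_def)

lemma kr_nonneg: "0 \<le> d \<Longrightarrow> (2 * K + Fm) * r + emp_modulus K r d \<le> emp_modulus k r d"
proof -
  assume d: "0 \<le> d"
  have "K * sqrt (r * d) \<le> k * sqrt (r * d)" using K Fm0 r d by (intro mult_right_mono) (auto simp: k_def)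
  then show ?thesis by (simp add: emp_modulus_def k_def algebra_simps)
qed

section \<open>The piece between two contact points\<close>

context
  fixes s u a b :: real
  assumes s: "s \<in> x ` {..<n}" "D s = 0" and u: "u \<in> x ` {..<n}" "D u = 0" and su: "s < u"
    and aff: "\<And>v. v \<in> {s..u} \<Longrightarrow> G v = a + b * v" and mid: "max s A \<le> min u B"
begin

definition "g v = exp (G v - p v) - 1"
definition "Q1 v = integral {s..v} (\<lambda>v. exp (G v) - f v)"
definition "Q v = integral {s..v} Q1"

lemma su_J: "{s..u} \<subseteq> J"
proof -
  have "s \<in> J" "u \<in> J" using s u xJ by auto
  moreover have "is_interval J" using J by (simp add: is_interval_convex_1)
  ultimately show ?thesis using mem_is_interval_1_I[of J s u] by (meson atLeastAtMost_iff subsetI)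
qed

lemma su_lohi: "s \<in> {lo..hi}" "u \<in> {lo..hi}" "lo \<le> s" "u \<le> hi" "- R \<le> s" "u \<le> R"
proof -
  obtain i j where "i < n" "s = x i" "j < n" "u = x j" using s(1) u(1) by auto
  then show "s \<in> {lo..hi}" "u \<in> {lo..hi}" "lo \<le> s" "u \<le> hi"
    using x_lohi[of i] x_lohi[of j] by auto
  then show "- R \<le> s" "u \<le> R" using lohi_R by auto
qed

lemma h_cont: "continuous_on {s..u} (\<lambda>v. exp (G v) - f v)"
  by (rule continuous_on_diff[OF expG_cont f_cont[OF su_J]])

lemma dQ1: "v \<in> {s..u} \<Longrightarrow> (Q1 has_real_derivative exp (G v) - f v) (at v within {s..u})"
  unfolding Q1_def[abs_def] by (rule integral_has_real_derivative[OF h_cont])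

lemma Q1_cont: "continuous_on {s..u} Q1"
  by (rule DERIV_continuous_on[OF dQ1])

lemma dQ: "v \<in> {s..u} \<Longrightarrow> (Q has_real_derivative Q1 v) (at v within {s..u})"
  unfolding Q_def[abs_def] by (rule integral_has_real_derivative[OF Q1_cont])

lemma Q1_int: "{v..z} \<subseteq> {s..u} \<Longrightarrow> Q1 integrable_on {v..z}"
  by (intro integrable_continuous_interval continuous_on_subset[OF Q1_cont])

text \<open>\<open>Q1\<close> is \<open>y\<close> with the empirical distribution replaced by the
  density \<open>f\<close>, so their increments differ by an increment of the empirical
  process.\<close>

lemma y_increment:
  assumes "s \<le> v" "v \<le> z" "z \<le> u"
  shows "\<bar>y z - y v - (Q1 z - Q1 v)\<bar> \<le> emp_modulus K r (z - v)"
proof -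
  have sub: "{v..z} \<subseteq> {s..u}" using assms by auto
  have "Q1 v + integral {v..z} (\<lambda>v. exp (G v) - f v) = Q1 z"
    unfolding Q1_def
    by (rule Henstock_Kurzweil_Integration.integral_combine)
       (use assms in \<open>auto intro!: integrable_continuous_interval continuous_on_subset[OF h_cont]\<close>)
  moreover have "integral {v..z} (\<lambda>v. exp (G v) - f v) = integral {v..z} (\<lambda>v. exp (G v)) - integral {v..z} f"
    using sub su_J
    by (intro Henstock_Kurzweil_Integration.integral_diff expG_int integrable_continuous_interval f_cont) auto
  moreover have "estimated_cdf \<phi>h z - estimated_cdf \<phi>h v = integral {v..z} (\<lambda>r. exp (G r))"
    using assms su_lohi by (intro Fh_diff) auto
  ultimately have "y z - y v - (Q1 z - Q1 v) = - (Fn z - Fn v - integral {v..z} f)"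
    by (simp add: y_def)
  then show ?thesis using modulus[of v z] assms su_lohi by simp
qed

text \<open>\<open>y\<close> deviates from \<open>Q1\<close> by its value at the contact point
  \<open>s\<close> and by an increment of the empirical process; integration from \<open>s\<close>,
  where \<open>D\<close> vanishes, gives the claim.\<close>

lemma y_integral_start:
  assumes v: "v \<in> {s..u}"
  shows "\<bar>D v - Q v\<bar> \<le> (v - s) * emp_modulus k r (v - s)"
proof -
  have sub: "{s..v} \<subseteq> {lo..hi}" "{s..v} \<subseteq> {s..u}" using v su_lohi by auto
  have Q1s: "Q1 s = 0" by (simp add: Q1_def)
  have bd: "\<bar>y z - Q1 z\<bar> \<le> emp_modulus k r (v - s)" if z: "z \<in> {s..v}" for z
  proof -
    have "\<bar>y z - y s - Q1 z\<bar> \<le> emp_modulus K r (z - s)"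
      using y_increment[of s z] z v by (simp add: Q1s)
    moreover have "emp_modulus K r (z - s) \<le> emp_modulus K r (v - s)"
      using z K r by (intro emp_modulus_mono) auto
    moreover have "\<bar>y s\<bar> \<le> (2 * K + Fm) * r" by (rule contact_small[OF su_lohi(1) s(2)])
    ultimately show ?thesis using kr_nonneg[of "v - s"] v by auto
  qed
  have "D v = integral {s..v} y" using D_diff[of s v] v su_lohi s by simp
  then have "D v - Q v = integral {s..v} (\<lambda>z. y z - Q1 z)"
    unfolding Q_def
    by (simp add: Henstock_Kurzweil_Integration.integral_diff[OF y_int[OF sub(1)] Q1_int[OF sub(2)]])
  moreover have "norm (integral {s..v} (\<lambda>z. y z - Q1 z)) \<le> integral {s..v} (\<lambda>z. emp_modulus k r (v - s))"
    by (rule integral_norm_bound_integral)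
       (use sub bd in \<open>auto intro!: Henstock_Kurzweil_Integration.integrable_diff y_int Q1_int\<close>)
  ultimately show ?thesis using v by simp
qed

text \<open>The counterpart from the contact point \<open>u\<close>, with the double primitive
  started there.\<close>

lemma y_integral_end:
  assumes v: "v \<in> {s..u}"
  shows "\<bar>D v - (Q v - Q u - (v - u) * Q1 u)\<bar> \<le> (u - v) * emp_modulus k r (u - v)"
proof -
  have sub: "{v..u} \<subseteq> {lo..hi}" "{v..u} \<subseteq> {s..u}" using v su_lohi by auto
  have bd: "\<bar>y z + (Q1 u - Q1 z)\<bar> \<le> emp_modulus k r (u - v)" if z: "z \<in> {v..u}" for z
  proof -
    have "\<bar>y u - y z - (Q1 u - Q1 z)\<bar> \<le> emp_modulus K r (u - z)"
      using y_increment[of z u] z v by simp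
    moreover have "emp_modulus K r (u - z) \<le> emp_modulus K r (u - v)"
      using z K r by (intro emp_modulus_mono) auto
    moreover have "\<bar>y u\<bar> \<le> (2 * K + Fm) * r" by (rule contact_small[OF su_lohi(2) u(2)])
    ultimately show ?thesis using kr_nonneg[of "u - v"] v by auto
  qed
  have "- D v = integral {v..u} y" using D_diff[of v u] v su_lohi u by simp
  moreover have "integral {v..u} Q1 = Q u - Q v"
    using Henstock_Kurzweil_Integration.integral_combine[of s v u Q1] v Q1_int[of s u] by (simp add: Q_def)
  moreover have "integral {v..u} (\<lambda>z. y z + (Q1 u - Q1 z)) =
      integral {v..u} y + ((u - v) * Q1 u - integral {v..u} Q1)"
  proof (intro integral_unique has_integral_add has_integral_diff integrable_integral)
    show "((\<lambda>z. Q1 u) has_integral (u - v) * Q1 u) {v..u}"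
      using has_integral_const_real[of "Q1 u" v u] v by simp
  qed (use Q1_int[OF sub(2)] y_int[OF sub(1)] in auto)
  ultimately have "- D v + ((u - v) * Q1 u - (Q u - Q v)) = integral {v..u} (\<lambda>z. y z + (Q1 u - Q1 z))"
    by simp
  moreover have "norm (integral {v..u} (\<lambda>z. y z + (Q1 u - Q1 z))) \<le> integral {v..u} (\<lambda>z. emp_modulus k r (u - v))"
    by (rule integral_norm_bound_integral)
       (use sub bd in \<open>auto intro!: Henstock_Kurzweil_Integration.integrable_add Henstock_Kurzweil_Integration.integrable_diff y_int Q1_int\<close>)
  ultimately have "\<bar>- D v + ((u - v) * Q1 u - (Q u - Q v))\<bar> \<le> (u - v) * emp_modulus k r (u - v)"
    using v by simp
  moreover have "- D v + ((u - v) * Q1 u - (Q u - Q v)) = - (D v - (Q v - Q u - (v - u) * Q1 u))"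
    by (simp add: algebra_simps)
  ultimately show ?thesis by simp
qed

lemma g_convex: "convex_on {s..u} g"
proof (rule convex_onI)
  fix t v z :: real assume t: "0 < t" "t < 1" and vz: "v \<in> {s..u}" "z \<in> {s..u}"
  define w where "w = (1 - t) * v + t * z"
  have wsu: "w \<in> {s..u}"
  proof -
    have "(1 - t) * s + t * s \<le> w" "w \<le> (1 - t) * u + t * u"
      unfolding w_def using t vz by (auto intro!: add_mono mult_left_mono)
    then show ?thesis by (simp add: algebra_simps)
  qed
  have "v \<in> J" "z \<in> J" using vz su_J by auto
  then have "(1 - t) * p v + t * p z \<le> p w"
    using convex_onD[OF p_concave[unfolded concave_on_def], of t v z] t by (simp add: w_def)
  moreover have "G w = (1 - t) * G v + t * G z"
    using aff[OF vz(1)] aff[OF vz(2)] aff[OF wsu] by (simp add: w_def algebra_simps)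
  ultimately have "G w - p w \<le> (1 - t) * (G v - p v) + t * (G z - p z)" by (simp add: algebra_simps)
  then have "exp (G w - p w) \<le> exp ((1 - t) * (G v - p v) + t * (G z - p z))" by simp
  also have "\<dots> \<le> (1 - t) * exp (G v - p v) + t * exp (G z - p z)"
    using convex_onD[OF convex_on_exp[of 1], of t "G v - p v" "G z - p z"] t by simp
  finally have "exp (G w - p w) - 1 \<le> (1 - t) * (exp (G v - p v) - 1) + t * (exp (G z - p z) - 1)"
    by (simp add: algebra_simps)
  then show "g ((1 - t) *\<^sub>R v + t *\<^sub>R z) \<le> (1 - t) * g v + t * g z"
    by (simp add: g_def w_def)
qed simp

lemma g_pos: "0 < 1 + g v"
  by (simp add: g_def)

lemma piece: "affine_piece s u A B c m0 M0 k r Lam f g Q Q1"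
proof
  show "0 < f v" if "v \<in> {s..u}" for v using f_exp[of v] su_J that by auto
  show "continuous_on {s..u} g"
    unfolding g_def[abs_def]
    by (intro continuous_intros continuous_on_subset[OF G(1)] continuous_on_subset[OF p_cont su_J]) auto
  show "(Q1 has_real_derivative f v * g v) (at v within {s..u})" if "v \<in> {s..u}" for v
  proof -
    have "f v * g v = exp (G v) - f v"
      using f_exp[of v] su_J that by (auto simp: g_def right_diff_distrib simp flip: exp_add)
    then show ?thesis using dQ1[OF that] by simp
  qed
  have start: "\<bar>D v - Q v\<bar> \<le> (v - s) * emp_modulus k r (v - s)" if "v \<in> {s..u}" for v
    using y_integral_start[OF that] .
  have D_neg: "D v \<le> 0" if "v \<in> {s..u}" for v using that su_lohi by (intro G(4)) auto
  show "Q v \<le> (v - s) * emp_modulus k r (v - s)" if "v \<in> {s..u}" for v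
    using start[OF that] D_neg[OF that] by linarith
  show "Q v - Q u - (v - u) * Q1 u \<le> (u - v) * emp_modulus k r (u - v)" if "v \<in> {s..u}" for v
    using y_integral_end[OF that] D_neg[OF that] by linarith
  show "- ((u - s) * emp_modulus k r (u - s)) \<le> Q u"
    using start[of u] u su by auto
  show "- ((u - s) * emp_modulus k r (u - s)) \<le> (u - s) * Q1 u - Q u"
  proof -
    have "Q s = 0" by (simp add: Q_def)
    moreover have "- (s - u) * Q1 u = (u - s) * Q1 u" by simp
    ultimately show ?thesis using y_integral_end[of s] s su by (simp add: algebra_simps)
  qed
  have "(u - s) * emp_modulus k r (u - s) \<le> 2 * R * emp_modulus k r (2 * R)"
    using su_lohi su r k_pos by (intro mult_mono emp_modulus_mono emp_modulus_nonneg) auto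
  then show "(u - s) * emp_modulus k r (u - s) \<le> Lam" using Lam by (simp add: k_def)
  show "m0 \<le> f v" if "A - c \<le> v" "v \<le> B + c" for v using m0(2) that by simp
  show "f v \<le> M0" if "A - c \<le> v" "v \<le> B + c" for v using M0 that by simp
qed (use su c m0 k_pos r mid g_convex dQ in \<open>auto simp: Q_def Q1_def\<close>)

lemma piece_strong_convexity:
  assumes "max s A \<le> v" "0 \<le> d" "v + 2 * d \<le> min u B"
  shows "\<kappa> * d\<^sup>2 \<le> ln (1 + g v) + ln (1 + g (v + 2 * d)) - 2 * ln (1 + g (v + d))"
proof -
  have "v \<in> {s..u}" "v + d \<in> {s..u}" "v + 2 * d \<in> {s..u}" using assms by auto
  from aff[OF this(1)] aff[OF this(2)] aff[OF this(3)] \<kappa>(2)[of v d] assms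
  show ?thesis by (simp add: g_def algebra_simps)
qed

end

text \<open>At a contact point the two distribution functions are close. From a contact point inside
  \<open>[A, B]\<close> to \<open>t\<close> the difference changes by an increment of
  \<open>Q1\<close> and one of the empirical process, both of order \<open>q ^ 3\<close> because the
  overlap has length at most \<open>C7 * q\<close>.\<close>

lemma cdf_distance:
  fixes q C7 :: real
  assumes q: "0 < q" "q \<le> 1" "r = q ^ 5" "Lam \<le> q\<^sup>2"
    and K7: "mid_const c m0 * (2 * k + 1) * q\<^sup>2 \<le> 1 / 2"
    and C7: "1 \<le> C7" "288 * mid_const c m0 * (2 * k + 1) \<le> \<kappa> * C7\<^sup>2" "C7 * q < B - A"
    and t: "t \<in> {A..B}"
  shows "\<bar>estimated_cdf \<phi>h t - Fn t\<bar> \<le> (inc_const c m0 M0 * (2 * k * C7 + C7) + 3 * k * C7) * q ^ 3"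
proof -
  have tl: "t \<in> {lo..hi}" using t lohi_AB by auto
  from G(5)[OF tl] obtain s u a b where su: "s \<in> x ` {..<n}" "u \<in> x ` {..<n}" "s \<le> t" "t \<le> u"
    "D s = 0" "D u = 0" "\<And>v. v \<in> {s..u} \<Longrightarrow> G v = a + b * v" by blast
  have kq: "(2 * K + Fm) * r \<le> k * C7 * q ^ 3"
  proof -
    have "(2 * K + Fm) * q ^ 5 \<le> k * q ^ 3"
      using q K Fm0 k_pos by (intro mult_mono power_decreasing) (auto simp: k_def)
    also have "\<dots> \<le> k * C7 * q ^ 3" using q C7 k_pos by (intro mult_right_mono) auto
    finally show ?thesis by (simp add: q)
  qed
  have rate_nonneg: "0 \<le> inc_const c m0 M0 * (2 * k * C7 + C7) * q ^ 3 + 2 * k * C7 * q ^ 3"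
    if "0 \<le> inc_const c m0 M0"
    using that q C7 k_pos by (intro add_nonneg_nonneg mult_nonneg_nonneg) auto
  have modq: "emp_modulus K r d \<le> 2 * k * C7 * q ^ 3" if "d \<le> C7 * q" for d
  proof -
    have "emp_modulus K r d \<le> emp_modulus K r (C7 * q)" using that K r by (intro emp_modulus_mono) auto
    also have "\<dots> \<le> k * (C7 * q ^ 3 + C7 * q ^ 3)"
      unfolding emp_modulus_def
    proof (intro mult_mono add_mono)
      have "r * (C7 * q) = C7 * (q ^ 3)\<^sup>2" by (simp add: q(3) power2_eq_square) (simp add: eval_nat_numeral)
      then have "sqrt (r * (C7 * q)) = sqrt C7 * sqrt ((q ^ 3)\<^sup>2)" by (simp only: real_sqrt_mult)
      also have "\<dots> = sqrt C7 * q ^ 3" using q by (simp only: real_sqrt_abs) simp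
      also have "\<dots> \<le> C7 * q ^ 3"
        using C7 q by (intro mult_right_mono) (auto simp: real_le_lsqrt power2_eq_square)
      finally show "sqrt (r * (C7 * q)) \<le> C7 * q ^ 3" .
      have "q ^ 5 \<le> 1 * q ^ 3" using q by (simp add: power_decreasing)
      also have "\<dots> \<le> C7 * q ^ 3" using C7 q by (intro mult_right_mono) auto
      finally show "r \<le> C7 * q ^ 3" using q by simp
    qed (use K Fm0 r q C7 in \<open>auto simp: k_def\<close>)
    finally show ?thesis by simp
  qed
  have y_small: "\<bar>y z\<bar> \<le> k * C7 * q ^ 3" if "z \<in> {lo..hi}" "D z = 0" for z
    using contact_small[OF that] kq by linarith
  have C_inc: "0 \<le> inc_const c m0 M0"
  proof -
    have mM: "m0 \<le> M0" using m0(2)[of A] M0[of A] AB c by auto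
    show ?thesis using m0(1) mM by (intro inc_const_nonneg) auto
  qed
  have "\<bar>y t\<bar> \<le> inc_const c m0 M0 * (2 * k * C7 + C7) * q ^ 3 + 2 * k * C7 * q ^ 3 + k * C7 * q ^ 3"
  proof (cases "s = u")
    case True
    then have "D t = 0" using su by simp
    from y_small[OF tl this] show ?thesis using rate_nonneg[OF C_inc] by linarith
  next
    case False
    then have lt: "s < u" using su by simp
    have mid: "max s A \<le> min u B" using su t by auto
    note ctx = su(1,5,2,6) lt su(7) mid
    interpret pc: affine_piece s u A B c m0 M0 k r Lam f "g" "Q s" "Q1 s"
      by (rule piece[OF ctx])
    note g1 = g_pos[OF ctx]
    note rate = pc.increment_bound_rate[OF \<kappa>(1) g1 piece_strong_convexity[OF ctx] q K7 C7(1,2)]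
    have len: "min u B - max s A \<le> C7 * q"
      by (rule rate(1)[of "max s A" "max s A"]) (use mid in auto)
    have sl: "s \<in> {lo..hi}" "u \<in> {lo..hi}" using su_lohi[OF ctx] by auto
    \<comment> \<open>The overlap is shorter than \<open>B - A\<close>, so the piece cannot cover
      \<open>[A, B]\<close>, and one of its ends can serve as the starting point.\<close>
    consider "A \<le> s" | "u \<le> B" | "s < A" "B < u" by linarith
    then show ?thesis
    proof cases
      case 1
      then have "\<bar>Q1 s t - Q1 s s\<bar> \<le> inc_const c m0 M0 * (2 * k * C7 + C7) * q ^ 3"
        by (intro rate(2)) (use su t in auto)
      moreover have "\<bar>y t - y s - (Q1 s t - Q1 s s)\<bar> \<le> emp_modulus K r (t - s)"
        by (rule y_increment[OF ctx]) (use su in auto)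
      moreover have "emp_modulus K r (t - s) \<le> 2 * k * C7 * q ^ 3"
        by (rule modq) (use len su t 1 in auto)
      ultimately show ?thesis using y_small[OF sl(1) su(5)] by linarith
    next
      case 2
      then have "\<bar>Q1 s u - Q1 s t\<bar> \<le> inc_const c m0 M0 * (2 * k * C7 + C7) * q ^ 3"
        by (intro rate(2)) (use su t in auto)
      moreover have "\<bar>y u - y t - (Q1 s u - Q1 s t)\<bar> \<le> emp_modulus K r (u - t)"
        by (rule y_increment[OF ctx]) (use su in auto)
      moreover have "emp_modulus K r (u - t) \<le> 2 * k * C7 * q ^ 3"
        by (rule modq) (use len su t 2 in auto)
      ultimately show ?thesis using y_small[OF sl(2) su(6)] by linarith
    next
      case 3
      with len C7(3) show ?thesis by simp
    qed
  qed
  also have "\<dots> = (inc_const c m0 M0 * (2 * k * C7 + C7) + 3 * k * C7) * q ^ 3"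
    by (simp add: algebra_simps)
  finally show ?thesis by (simp add: y_def)
qed

end

section \<open>Log-concave densities\<close>

lemma concave_ext_uminus: "concave_ext \<phi> \<Longrightarrow> concave_ext (\<lambda>x. \<phi> (- x))"
  unfolding concave_ext_def
proof (elim conjE, intro conjI allI impI)
  fix x y t :: real
  assume c: "\<forall>x y t. 0 < t \<and> t < 1 \<longrightarrow> ereal (1 - t) * \<phi> x + ereal t * \<phi> y \<le> \<phi> ((1 - t) * x + t * y)"
    and t: "0 < t \<and> t < 1"
  have "ereal (1 - t) * \<phi> (- x) + ereal t * \<phi> (- y) \<le> \<phi> ((1 - t) * (- x) + t * (- y))"
    using c t by blast
  moreover have "(1 - t) * (- x) + t * (- y) = - ((1 - t) * x + t * y)" by (simp add: algebra_simps)
  ultimately show "ereal (1 - t) * \<phi> (- x) + ereal t * \<phi> (- y) \<le> \<phi> (- ((1 - t) * x + t * y))" by simp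
qed simp

text \<open>The chord from \<open>x0\<close> to \<open>x1\<close> falls, and concavity keeps
  \<open>\<phi>\<close> below its extension past \<open>x1\<close>. Between \<open>x0\<close> and
  \<open>x1\<close> the extension of the chord from \<open>w\<close> to \<open>x0\<close> gives a
  bound. If \<open>\<phi>\<close> is \<open>-\<infinity>\<close> at \<open>x1\<close>, it is so
  everywhere to the right.\<close>

lemma exp_ext_tail_right:
  assumes \<phi>: "concave_ext \<phi>" and w: "\<phi> w \<noteq> -\<infinity>" "w < x0" and x0: "\<phi> x0 \<noteq> -\<infinity>"
    and x1: "x0 < x1" "exp_ext (\<phi> x1) < exp_ext (\<phi> x0)"
  shows "\<exists>K>0. \<exists>c>0. \<forall>x\<ge>x0. exp_ext (\<phi> x) \<le> K * exp (- c * x)"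
proof -
  define S where "S = {x. \<phi> x \<noteq> -\<infinity>}"
  define p where "p x = real_of_ereal (\<phi> x)" for x
  have conc: "concave_on S p" unfolding S_def p_def by (rule concave_ext_real(2)[OF \<phi>])
  have S: "convex S" unfolding S_def by (rule concave_ext_real(1)[OF \<phi>])
  have mem: "w \<in> S" "x0 \<in> S" using w x0 by (auto simp: S_def)
  have f: "exp_ext (\<phi> x) = (if x \<in> S then exp (p x) else 0)" for x
    by (simp add: exp_ext_def S_def p_def)
  define m where "m = (p x0 - p w) / (x0 - w)"
  define B where "B = exp (p x0 + \<bar>m\<bar> * (x1 - x0))"
  have near: "exp_ext (\<phi> x) \<le> B" if x: "x0 \<le> x" "x \<le> x1" for x
  proof (cases "x \<in> S \<and> x \<noteq> x0")
    case True
    have "(p x - p x0) / (x - x0) \<le> m"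
      unfolding m_def using True x w mem by (intro concave_on_slope_le(1)[OF conc]) auto
    then have "p x - p x0 \<le> m * (x - x0)" using True x by (simp add: divide_le_eq)
    also have "\<dots> \<le> \<bar>m\<bar> * (x1 - x0)" using x by (intro mult_mono) auto
    finally show ?thesis using True by (simp add: f B_def)
  next
    case False
    then show ?thesis using x1 by (auto simp: f B_def)
  qed
  have "\<exists>c>0. \<forall>x>x1. exp_ext (\<phi> x) \<le> exp (p x0 - c * (x - x0))"
  proof (cases "x1 \<in> S")
    case True
    define c where "c = (p x0 - p x1) / (x1 - x0)"
    have c: "0 < c" using x1 True mem by (simp add: c_def f)
    moreover have "exp_ext (\<phi> x) \<le> exp (p x0 - c * (x - x0))" if x: "x1 < x" for x
    proof (cases "x \<in> S")
      case xS: True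
      have "(p x - p x0) / (x - x0) \<le> (p x1 - p x0) / (x1 - x0)"
        using xS x x1 mem by (intro concave_on_slope_le(3)[OF conc]) auto
      also have "\<dots> = - c" by (simp add: c_def minus_divide_left)
      finally have "p x - p x0 \<le> - c * (x - x0)" using x x1 by (simp add: divide_le_eq)
      then show ?thesis using xS by (simp add: f)
    qed (simp add: f)
    ultimately show ?thesis by blast
  next
    case False
    have "x \<notin> S" if "x1 < x" for x
    proof
      assume "x \<in> S"
      with S mem(2) have "x1 \<in> S"
        using mem_is_interval_1_I[of S x0 x x1] that x1 by (simp add: is_interval_convex_1)
      with False show False ..
    qed
    then show ?thesis by (intro exI[of _ 1]) (simp add: f)
  qed
  then obtain c where c: "0 < c" and far: "\<And>x. x1 < x \<Longrightarrow> exp_ext (\<phi> x) \<le> exp (p x0 - c * (x - x0))" by blast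
  define K where "K = B * exp (c * x1) + exp (p x0 + c * x0)"
  have B: "0 < B" by (simp add: B_def)
  have "exp_ext (\<phi> x) \<le> K * exp (- c * x)" if x: "x0 \<le> x" for x
  proof (cases "x \<le> x1")
    case True
    have "exp_ext (\<phi> x) \<le> B * 1" using near[OF x True] by simp
    also have "\<dots> \<le> B * exp (c * (x1 - x))" using B c True by (intro mult_left_mono) auto
    also have "\<dots> = B * exp (c * x1) * exp (- c * x)" by (simp add: algebra_simps flip: exp_add)
    also have "\<dots> \<le> K * exp (- c * x)" unfolding K_def by (intro mult_right_mono) auto
    finally show ?thesis .
  next
    case False
    then have "exp_ext (\<phi> x) \<le> exp (p x0 + c * x0) * exp (- c * x)"
      using far[of x] by (simp add: algebra_simps flip: exp_add)
    also have "\<dots> \<le> K * exp (- c * x)" unfolding K_def using B by (intro mult_right_mono) auto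
    finally show ?thesis .
  qed
  moreover have "0 < K" unfolding K_def using B by (intro add_pos_pos mult_pos_pos) auto
  ultimately show ?thesis using c by blast
qed

text \<open>Otherwise \<open>f\<close> would be at least \<open>f x0\<close> on an interval of
  length \<open>2 / f x0\<close> and carry mass 2 there.\<close>

lemma exists_smaller_value:
  fixes f :: "real \<Rightarrow> real"
  assumes int: "(\<integral>\<^sup>+ x. ennreal (f x) \<partial>lborel) = 1" and pos: "0 < f x0"
  shows "\<exists>x1>x0. f x1 < f x0" "\<exists>x1<x0. f x1 < f x0"
proof -
  have key: "\<not> (\<forall>x\<in>{a..a + 2 / f x0}. f x0 \<le> f x)" for a
  proof
    assume le: "\<forall>x\<in>{a..a + 2 / f x0}. f x0 \<le> f x"
    have "2 = ennreal (f x0) * emeasure lborel {a..a + 2 / f x0}"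
      using pos by (simp flip: ennreal_mult)
    also have "\<dots> = (\<integral>\<^sup>+ x. ennreal (f x0) * indicator {a..a + 2 / f x0} x \<partial>lborel)"
      by (subst nn_integral_cmult_indicator) auto
    also have "\<dots> \<le> (\<integral>\<^sup>+ x. ennreal (f x) \<partial>lborel)"
      using le by (intro nn_integral_mono) (auto simp: indicator_def intro: ennreal_leI)
    finally show False using int by simp
  qed
  from key[of x0] obtain x where "x0 \<le> x" "f x < f x0" by (auto simp: not_le)
  then show "\<exists>x1>x0. f x1 < f x0" by (intro exI[of _ x]) (cases "x = x0"; simp)
  from key[of "x0 - 2 / f x0"] obtain x where "x \<le> x0" "f x < f x0" by (auto simp: not_le)
  then show "\<exists>x1<x0. f x1 < f x0" by (intro exI[of _ x]) (cases "x = x0"; simp)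
qed

lemma log_concave_density_tail:
  assumes f: "log_concave_density f \<phi>" and AB: "A < B" "{A..B} \<subseteq> {x. 0 < f x}"
  shows "\<exists>K>0. \<exists>c>0. \<forall>x. f x \<le> K * exp (- c * \<bar>x\<bar>)"
proof -
  have \<phi>: "concave_ext \<phi>" and fe: "\<And>x. f x = exp_ext (\<phi> x)" and int: "(\<integral>\<^sup>+ x. ennreal (f x) \<partial>lborel) = 1"
    using f by (auto simp: log_concave_density_def)
  have pos: "\<phi> x \<noteq> -\<infinity>" if "x \<in> {A..B}" for x
    using AB(2) that by (force simp: fe exp_ext_def)
  define x0 where "x0 = (A + B) / 2"
  have x0: "A < x0" "x0 < B" using AB by (auto simp: x0_def)
  then have "x0 \<in> {A..B}" by simp
  then have f0: "0 < f x0" using AB(2) by blast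
  obtain a b where a: "x0 < a" "f a < f x0" and b: "b < x0" "f b < f x0"
    using exists_smaller_value[OF int f0] by blast
  obtain K1 c1 where 1: "0 < K1" "0 < c1" "\<And>x. x0 \<le> x \<Longrightarrow> f x \<le> K1 * exp (- c1 * x)"
    using exp_ext_tail_right[OF \<phi> pos x0(1) pos a(1)] a(2) x0 by (auto simp: fe)
  obtain K2 c2 where 2: "0 < K2" "0 < c2" "\<And>x. - x0 \<le> x \<Longrightarrow> f (- x) \<le> K2 * exp (- c2 * x)"
    using exp_ext_tail_right[OF concave_ext_uminus[OF \<phi>], of "- B" "- x0" "- b"] pos b x0 by (auto simp: fe)
  define c where "c = min c1 c2"
  have c: "0 < c" "c \<le> c1" "c \<le> c2" using 1 2 by (auto simp: c_def)
  \<comment> \<open>These factors pay for the stretch between 0 and \<open>x0\<close>, where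
    \<open>\<bar>x\<bar>\<close> and the argument of the one-sided bound have opposite
    signs.\<close>
  define E1 E2 where "E1 = exp ((c1 + c) * \<bar>x0\<bar>)" and "E2 = exp ((c2 + c) * \<bar>x0\<bar>)"
  define K where "K = K1 * E1 + K2 * E2"
  have E: "0 < E1" "0 < E2" by (simp_all add: E1_def E2_def)
  have bound: "exp (- d * z) \<le> exp ((d + c) * \<bar>x0\<bar>) * exp (- c * \<bar>z\<bar>)"
    if d: "c \<le> d" and z: "- \<bar>x0\<bar> \<le> z" for d z
  proof -
    have "- d * z \<le> (d + c) * \<bar>x0\<bar> - c * \<bar>z\<bar>"
    proof (cases "0 \<le> z")
      case True
      have "c * z \<le> d * z" "0 \<le> (d + c) * \<bar>x0\<bar>" using True d c by (auto intro: mult_right_mono)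
      then show ?thesis using True by simp
    next
      case False
      have "(d + c) * (- z) \<le> (d + c) * \<bar>x0\<bar>" using z d c by (intro mult_left_mono) auto
      then show ?thesis using False by (simp add: algebra_simps)
    qed
    then show ?thesis by (simp flip: exp_add)
  qed
  have "f x \<le> K * exp (- c * \<bar>x\<bar>)" for x
  proof (cases "x0 \<le> x")
    case True
    have "f x \<le> K1 * (E1 * exp (- c * \<bar>x\<bar>))"
      using 1(3)[OF True] bound[of c1 x] c True 1(1) unfolding E1_def
      by (meson abs_le_D2 dual_order.trans mult_left_mono less_imp_le abs_ge_minus_self minus_le_iff order.trans)
    also have "\<dots> = K1 * E1 * exp (- c * \<bar>x\<bar>)" by simp
    also have "\<dots> \<le> K * exp (- c * \<bar>x\<bar>)"
      unfolding K_def using 2 E by (intro mult_right_mono) auto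
    finally show ?thesis .
  next
    case False
    then have "f (- (- x)) \<le> K2 * exp (- c2 * (- x))" by (intro 2(3)) simp
    also have "\<dots> \<le> K2 * (E2 * exp (- c * \<bar>- x\<bar>))"
      unfolding E2_def using c False 2(1) by (intro mult_left_mono bound) auto
    also have "\<dots> = K2 * E2 * exp (- c * \<bar>x\<bar>)" by simp
    also have "\<dots> \<le> K * exp (- c * \<bar>x\<bar>)"
      unfolding K_def using 1 E by (intro mult_right_mono) auto
    finally show ?thesis by simp
  qed
  moreover have "0 < K" unfolding K_def using 1 2 E by (intro add_pos_pos mult_pos_pos)
  ultimately show ?thesis using c by blast
qed

lemma density_integral:
  fixes f :: "real \<Rightarrow> real"
  assumes meas: "f \<in> borel_measurable borel" and nonneg: "\<And>x. 0 \<le> f x"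
    and int: "(\<integral>\<^sup>+ x. ennreal (f x) \<partial>lborel) = 1"
  shows "f integrable_on {a..b}"
    and "(\<integral>\<^sup>+ x. ennreal (f x) * indicator {a<..b} x \<partial>lborel) = ennreal (integral {a..b} f)"
proof -
  have "(f has_integral 1) UNIV"
    using nn_integral_has_integral[OF meas nonneg, of 1] int by simp
  then have "f integrable_on UNIV" by (rule has_integral_integrable)
  then show I: "f integrable_on {a..b}" by (rule integrable_on_subinterval) simp
  have "(\<integral>\<^sup>+ x. ennreal (f x) * indicator {a<..b} x \<partial>lborel) = (\<integral>\<^sup>+ x. ennreal (f x) * indicator {a..b} x \<partial>lborel)"
  proof (rule nn_integral_cong_AE)
    have "AE x in lborel. x \<noteq> a" by (rule AE_lborel_singleton)
    then show "AE x in lborel. ennreal (f x) * indicator {a<..b} x = ennreal (f x) * indicator {a..b} x"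
      by eventually_elim (auto simp: indicator_def)
  qed
  also have "\<dots> = ennreal (integral {a..b} f)"
    using nn_integral_has_integral_lebesgue'[OF nonneg integrable_integral[OF I]] by simp
  finally show "(\<integral>\<^sup>+ x. ennreal (f x) * indicator {a<..b} x \<partial>lborel) = ennreal (integral {a..b} f)" .
qed

text \<open>By monotonicity an increment of \<open>H\<close> over \<open>[a, b]\<close> lies between
  those over the largest grid interval inside and the smallest one around it. Passing to the grid
  changes the increment of \<open>\<Phi>\<close> by at most two meshes, that is by
  \<open>2 * Fm * h\<close> with \<open>h = 2 * \<kappa> * r\<close>, which is of order
  \<open>r\<close>.\<close>

lemma modulus_from_grid:
  fixes H \<Phi> :: "real \<Rightarrow> real" and n :: nat
  assumes H: "mono H" and \<Phi>: "mono \<Phi>" and Fm: "\<And>a b. a \<le> b \<Longrightarrow> \<Phi> b - \<Phi> a \<le> Fm * (b - a)" "0 \<le> Fm"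
    and n: "0 < n" and R: "0 < R" "2 * R / real n = 2 * \<kappa> * r" and \<kappa>: "0 \<le> \<kappa>" "0 \<le> r" "0 \<le> L"
    and grid: "\<And>i j. i \<le> j \<Longrightarrow> j \<le> n \<Longrightarrow>
      \<bar>H (- R + real j * (2 * R / real n)) - H (- R + real i * (2 * R / real n)) -
        (\<Phi> (- R + real j * (2 * R / real n)) - \<Phi> (- R + real i * (2 * R / real n)))\<bar>
      \<le> L * (sqrt (Fm * (real (j - i) * (2 * R / real n)) * r) + r)"
    and ab: "- R \<le> a" "a \<le> b" "b \<le> R"
  shows "\<bar>H b - H a - (\<Phi> b - \<Phi> a)\<bar> \<le>
    emp_modulus (4 * \<kappa> * Fm + L * (sqrt Fm + 2 * sqrt (\<kappa> * Fm) + 1)) r (b - a)"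
proof -
  define h where "h = 2 * R / real n"
  define z where "z j = - R + real j * h" for j :: nat
  have "0 < h" unfolding h_def using R(1) n by simp
  moreover have "h = 2 * \<kappa> * r" unfolding h_def by (rule R(2))
  ultimately have h: "0 < h" "h = 2 * \<kappa> * r" .
  have zn: "z n = R" using n by (simp add: z_def h_def)
  have loc: "\<exists>j<n. z j \<le> v \<and> v \<le> z (Suc j)" if v: "- R \<le> v" "v \<le> R" for v
  proof (cases "v = R")
    case True
    have "z (n - 1) \<le> z n" using h by (simp add: z_def mult_right_mono)
    then show ?thesis using True n zn by (intro exI[of _ "n - 1"]) auto
  next
    case False
    define j where "j = nat \<lfloor>(v + R) / h\<rfloor>"
    have nonneg: "0 \<le> (v + R) / h" using v h by simp
    then have j: "real j \<le> (v + R) / h" "(v + R) / h < real j + 1" by (auto simp: j_def)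
    then have "real j * h \<le> v + R" "v + R < (real j + 1) * h" using h by (auto simp: le_divide_eq divide_less_eq)
    then have zj: "z j \<le> v" "v \<le> z (Suc j)" by (auto simp: z_def algebra_simps)
    have "j < n"
    proof (rule ccontr)
      assume "\<not> j < n"
      then have "real n * h \<le> real j * h" using h by (intro mult_right_mono) auto
      then have "z n \<le> z j" by (simp add: z_def)
      with zj zn False v show False by auto
    qed
    with zj show ?thesis by blast
  qed
  define E where "E = 4 * \<kappa> * Fm + L * (sqrt Fm + 2 * sqrt (\<kappa> * Fm) + 1)"
  have err: "2 * (Fm * h) + L * (sqrt (Fm * d * r) + r) \<le> emp_modulus E r (b - a)"
    if d: "0 \<le> d" "d \<le> b - a + 2 * h" for d
  proof -
    have "Fm * d * r \<le> Fm * (b - a + 2 * h) * r" using d Fm \<kappa> by (intro mult_right_mono mult_left_mono) auto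
    then have "sqrt (Fm * d * r) \<le> sqrt (Fm * (b - a + 2 * h) * r)" by simp
    also have "Fm * (b - a + 2 * h) * r = Fm * (r * (b - a)) + 4 * (\<kappa> * Fm) * r\<^sup>2"
      by (simp add: h algebra_simps power2_eq_square)
    also have "sqrt \<dots> \<le> sqrt (Fm * (r * (b - a))) + sqrt (4 * (\<kappa> * Fm) * r\<^sup>2)"
      using Fm \<kappa> ab by (intro sqrt_add_le_add_sqrt) auto
    also have "\<dots> = sqrt Fm * sqrt (r * (b - a)) + 2 * sqrt (\<kappa> * Fm) * r"
      using \<kappa> by (simp add: real_sqrt_mult)
    finally have "L * (sqrt (Fm * d * r) + r) \<le> L * (sqrt Fm * sqrt (r * (b - a)) + 2 * sqrt (\<kappa> * Fm) * r + r)"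
      using \<kappa> by (intro mult_left_mono) auto
    moreover have "0 \<le> (4 * \<kappa> * Fm + L * (2 * sqrt (\<kappa> * Fm) + 1)) * sqrt (r * (b - a))"
      using Fm \<kappa> ab by (intro mult_nonneg_nonneg add_nonneg_nonneg) auto
    moreover have "0 \<le> L * sqrt Fm * r" using Fm \<kappa> by simp
    ultimately show ?thesis by (simp add: emp_modulus_def E_def h algebra_simps)
  qed
  obtain i where i: "i < n" "z i \<le> a" "a \<le> z (Suc i)" using loc[of a] ab by auto
  obtain l where l: "l < n" "z l \<le> b" "b \<le> z (Suc l)" using loc[of b] ab by auto
  have zdiff: "z j - z i = real (j - i) * h" if "i \<le> j" for i j
    using that by (simp add: z_def of_nat_diff algebra_simps)
  have zS: "z (Suc j) = z j + h" for j by (simp add: z_def algebra_simps)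
  have gridz: "\<bar>H (z j) - H (z i) - (\<Phi> (z j) - \<Phi> (z i))\<bar> \<le> L * (sqrt (Fm * (z j - z i) * r) + r)"
    if "i \<le> j" "j \<le> n" for i j
    unfolding zdiff[OF that(1)] using grid[OF that] by (simp add: z_def h_def)
  have "H b - H a - (\<Phi> b - \<Phi> a) \<le> emp_modulus E r (b - a)"
  proof -
    have "i \<le> Suc l"
    proof (rule ccontr)
      assume "\<not> i \<le> Suc l"
      then have "real (Suc l) * h < real i * h" using h by (intro mult_strict_right_mono) auto
      then have "z (Suc l) < z i" by (simp add: z_def)
      then show False using i l ab by linarith
    qed
    have "H b - H a \<le> H (z (Suc l)) - H (z i)" using H i l by (simp add: mono_def diff_mono)
    also have "\<dots> \<le> \<Phi> (z (Suc l)) - \<Phi> (z i) + L * (sqrt (Fm * (z (Suc l) - z i) * r) + r)"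
      using gridz[OF \<open>i \<le> Suc l\<close>] l by auto
    also have "\<Phi> (z (Suc l)) - \<Phi> (z i) \<le> \<Phi> b - \<Phi> a + 2 * (Fm * h)"
    proof -
      have "\<Phi> (z (Suc l)) - \<Phi> b \<le> Fm * h"
        using Fm(1)[OF l(3)] mult_left_mono[OF _ Fm(2), of "z (Suc l) - b" h] l zS[of l] by linarith
      moreover have "\<Phi> a - \<Phi> (z i) \<le> Fm * h"
        using Fm(1)[OF i(2)] mult_left_mono[OF _ Fm(2), of "a - z i" h] i zS[of i] by linarith
      ultimately show ?thesis by linarith
    qed
    finally have "H b - H a - (\<Phi> b - \<Phi> a) \<le> 2 * (Fm * h) + L * (sqrt (Fm * (z (Suc l) - z i) * r) + r)" by linarith
    also have "\<dots> \<le> emp_modulus E r (b - a)"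
      by (rule err) (use i l ab zS[of l] zS[of i] in linarith)+
    finally show ?thesis .
  qed
  moreover have "- emp_modulus E r (b - a) \<le> H b - H a - (\<Phi> b - \<Phi> a)"
  proof (cases "Suc i \<le> l")
    case True
    have "H (z l) - H (z (Suc i)) \<le> H b - H a" using H i l by (simp add: mono_def diff_mono)
    moreover have "\<Phi> (z l) - \<Phi> (z (Suc i)) - L * (sqrt (Fm * (z l - z (Suc i)) * r) + r) \<le> H (z l) - H (z (Suc i))"
      using gridz[OF True] l by auto
    moreover have "\<Phi> b - \<Phi> a - 2 * (Fm * h) \<le> \<Phi> (z l) - \<Phi> (z (Suc i))"
    proof -
      have "\<Phi> b - \<Phi> (z l) \<le> Fm * h"
        using Fm(1)[OF l(2)] mult_left_mono[OF _ Fm(2), of "b - z l" h] l zS[of l] by linarith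
      moreover have "\<Phi> (z (Suc i)) - \<Phi> a \<le> Fm * h"
        using Fm(1)[OF i(3)] mult_left_mono[OF _ Fm(2), of "z (Suc i) - a" h] i zS[of i] by linarith
      ultimately show ?thesis by linarith
    qed
    moreover have "2 * (Fm * h) + L * (sqrt (Fm * (z l - z (Suc i)) * r) + r) \<le> emp_modulus E r (b - a)"
    proof (rule err)
      show "0 \<le> z l - z (Suc i)" using zdiff[OF True] h by simp
    qed (use i l h in linarith)
    ultimately show ?thesis by linarith
  next
    \<comment> \<open>No grid interval of positive length fits inside: \<open>b - a\<close> is at
      most one mesh, and \<open>H a \<le> H b\<close> already suffices.\<close>
    case False
    then have "real (Suc l) * h \<le> real (Suc i) * h" using h by (intro mult_right_mono) auto
    then have "z (Suc l) \<le> z (Suc i)" by (simp add: z_def)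
    then have "b - a \<le> h" using i l zS[of i] by linarith
    then have "\<Phi> b - \<Phi> a \<le> Fm * h"
      using Fm(1)[OF ab(2)] mult_left_mono[OF _ Fm(2), of "b - a" h] by linarith
    moreover have "H a \<le> H b" using H ab by (simp add: mono_def)
    moreover have "2 * (Fm * h) + L * (sqrt (Fm * 0 * r) + r) \<le> emp_modulus E r (b - a)"
      by (rule err) (use ab h in auto)
    moreover have "0 \<le> Fm * h" "0 \<le> L * (sqrt (Fm * 0 * r) + r)" using Fm h \<kappa> by auto
    ultimately show ?thesis by linarith
  qed
  ultimately show ?thesis unfolding E_def abs_le_iff by linarith
qed

section \<open>Deviations of the empirical process\<close>

context prob_space
begin

text \<open>The moment generating function of a binomial count: each factor is
  \<open>1 - p + p * exp h\<close>, at most \<open>exp (p * (h + h\<^sup>2))\<close>, and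
  independence multiplies them.\<close>

lemma nn_integral_exp_count:
  fixes X :: "nat \<Rightarrow> 'a \<Rightarrow> real"
  assumes ind: "indep_vars (\<lambda>_. borel) X {..<n}" and A: "A \<in> sets borel"
    and p: "\<And>i. i < n \<Longrightarrow> emeasure M (X i -` A \<inter> space M) = ennreal p" "0 \<le> p" and h: "\<bar>h\<bar> \<le> 1"
  shows "(\<integral>\<^sup>+\<omega>. ennreal (exp (h * (\<Sum>i<n. indicat_real A (X i \<omega>)))) \<partial>M) \<le> ennreal (exp (real n * p * (h + h\<^sup>2)))"
proof -
  have rv: "X i \<in> borel_measurable M" if "i < n" for i
    using ind that by (auto simp: indep_vars_def)
  note [measurable] = A
  have ind': "indep_vars (\<lambda>_. borel) (\<lambda>i \<omega>. ennreal (exp (h * indicat_real A (X i \<omega>)))) {..<n}"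
    by (rule indep_vars_compose2[OF ind]) measurable
  have single: "(\<integral>\<^sup>+\<omega>. ennreal (exp (h * indicat_real A (X i \<omega>))) \<partial>M) \<le> ennreal (exp (p * (h + h\<^sup>2)))"
    if i: "i < n" for i
  proof -
    define U where "U = X i -` A \<inter> space M"
    have U: "U \<in> sets M" unfolding U_def using rv[OF i] A by (rule measurable_sets)
    have "ennreal p \<le> 1" using p(1)[OF i] emeasure_le_1 by (metis)
    then have p1: "p \<le> 1" by simp
    have "(\<integral>\<^sup>+\<omega>. ennreal (exp (h * indicat_real A (X i \<omega>))) \<partial>M) =
        (\<integral>\<^sup>+\<omega>. indicator (space M - U) \<omega> + ennreal (exp h) * indicator U \<omega> \<partial>M)"
      by (intro nn_integral_cong) (auto simp: U_def indicator_def)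
    also have "\<dots> = emeasure M (space M - U) + ennreal (exp h) * emeasure M U"
      using U by (subst nn_integral_add) (auto simp: nn_integral_cmult_indicator)
    also have "emeasure M (space M - U) = 1 - ennreal p"
      using U p(1)[OF i] by (simp add: emeasure_compl emeasure_space_1 U_def[symmetric])
    also have "1 - ennreal p + ennreal (exp h) * emeasure M U = ennreal (1 - p + exp h * p)"
      using p(1)[OF i] p(2) p1 unfolding U_def[symmetric]
      by (simp add: ennreal_minus ennreal_mult flip: ennreal_1)
    also have "\<dots> \<le> ennreal (exp (p * (h + h\<^sup>2)))"
    proof (rule ennreal_leI)
      have "p * exp h \<le> p * (1 + h + h\<^sup>2)" using p(2) h by (intro mult_left_mono exp_le_quadratic) auto
      then have "1 - p + exp h * p \<le> 1 + p * (h + h\<^sup>2)" by (simp add: algebra_simps)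
      also have "\<dots> \<le> exp (p * (h + h\<^sup>2))" by (rule exp_ge_add_one_self)
      finally show "1 - p + exp h * p \<le> exp (p * (h + h\<^sup>2))" .
    qed
    finally show ?thesis .
  qed
  have "(\<integral>\<^sup>+\<omega>. ennreal (exp (h * (\<Sum>i<n. indicat_real A (X i \<omega>)))) \<partial>M) =
      (\<integral>\<^sup>+\<omega>. (\<Prod>i<n. ennreal (exp (h * indicat_real A (X i \<omega>)))) \<partial>M)"
  proof (rule nn_integral_cong)
    fix \<omega>
    have "exp (h * (\<Sum>i<n. indicat_real A (X i \<omega>))) = (\<Prod>i<n. exp (h * indicat_real A (X i \<omega>)))"
      unfolding sum_distrib_left by (rule exp_sum) simp
    then show "ennreal (exp (h * (\<Sum>i<n. indicat_real A (X i \<omega>)))) = (\<Prod>i<n. ennreal (exp (h * indicat_real A (X i \<omega>))))"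
      by (simp only: prod_ennreal exp_ge_zero)
  qed
  also have "\<dots> = (\<Prod>i<n. \<integral>\<^sup>+\<omega>. ennreal (exp (h * indicat_real A (X i \<omega>))) \<partial>M)"
    by (rule indep_vars_nn_integral[OF _ ind']) auto
  also have "\<dots> \<le> (\<Prod>i<n. ennreal (exp (p * (h + h\<^sup>2))))"
  proof -
    have "(\<Prod>i\<in>I. \<integral>\<^sup>+\<omega>. ennreal (exp (h * indicat_real A (X i \<omega>))) \<partial>M) \<le> (\<Prod>i\<in>I. ennreal (exp (p * (h + h\<^sup>2))))"
      if "finite I" "I \<subseteq> {..<n}" for I
      using that by (induction I) (auto intro!: mult_mono single)
    from this[of "{..<n}"] show ?thesis by blast
  qed
  also have "\<dots> = ennreal (exp (real n * p * (h + h\<^sup>2)))"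
    by (simp add: ennreal_power mult.assoc flip: exp_of_nat_mult)
  finally show ?thesis .
qed

text \<open>A Bernstein-type bound by Chernoff's method, whose exponent is
  \<open>np * h\<^sup>2 - h * t\<close>. For \<open>L \<le> np\<close> the choice
  \<open>h = sqrt (L / np)\<close> makes the quadratic term equal to \<open>L\<close> and the linear
  one at least \<open>k * L\<close>; for rarer events \<open>h = 1\<close> does the same.\<close>

lemma count_deviation:
  fixes X :: "nat \<Rightarrow> 'a \<Rightarrow> real"
  assumes ind: "indep_vars (\<lambda>_. borel) X {..<n}" and A: "A \<in> sets borel"
    and p: "\<And>i. i < n \<Longrightarrow> emeasure M (X i -` A \<inter> space M) = ennreal p" "0 \<le> p"
    and L: "0 < L" and k: "1 \<le> k"
  shows "emeasure M {\<omega> \<in> space M. k * (sqrt (real n * p * L) + L) \<le> \<bar>(\<Sum>i<n. indicat_real A (X i \<omega>)) - real n * p\<bar>}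
    \<le> ennreal (2 * exp (- ((k - 1) * L)))"
proof -
  define S where "S \<omega> = (\<Sum>i<n. indicat_real A (X i \<omega>))" for \<omega>
  define t where "t = k * (sqrt (real n * p * L) + L)"
  define np where "np = real n * p"
  have np: "0 \<le> np" using p by (simp add: np_def)
  have rv: "X i \<in> borel_measurable M" if "i < n" for i
    using ind that by (auto simp: indep_vars_def)
  have S[measurable]: "S \<in> borel_measurable M"
    unfolding S_def by (intro borel_measurable_sum borel_measurable_indicator' measurable_compose[OF rv] )
      (use A in auto)
  obtain h where h: "0 < h" "h \<le> 1" "np * h\<^sup>2 - h * t \<le> - ((k - 1) * L)"
  proof (cases "L \<le> np")
    case True
    define h where "h = sqrt (L / np)"
    have n0: "0 < np" using True L by simp
    have "0 < h" "h \<le> 1" using n0 L True by (auto simp: h_def)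
    moreover have "np * h\<^sup>2 = L" using n0 L by (simp add: h_def)
    moreover have "h * (k * sqrt (np * L)) = k * L"
    proof -
      have "sqrt (L / np) * sqrt (np * L) = sqrt (L * L)" using n0 by (simp flip: real_sqrt_mult)
      then have "sqrt (L / np) * sqrt (np * L) = L" using L by simp
      then show ?thesis by (simp add: h_def mult.left_commute)
    qed
    moreover have "h * (k * sqrt (np * L)) \<le> h * t"
      using \<open>0 < h\<close> k L unfolding t_def np_def by (intro mult_left_mono) auto
    ultimately have "np * h\<^sup>2 - h * t \<le> L - k * L" by linarith
    also have "\<dots> = - ((k - 1) * L)" by (simp add: algebra_simps)
    finally show ?thesis using that[of h] \<open>0 < h\<close> \<open>h \<le> 1\<close> by blast
  next
    case False
    have "k * L \<le> t" unfolding t_def using k p L by (intro mult_left_mono) auto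
    with False show ?thesis using that[of 1] by (simp add: algebra_simps)
  qed
  \<comment> \<open>The sign \<open>e = 1\<close> gives the lower tail of the count,
    \<open>e = - 1\<close> the upper tail.\<close>
  have tail: "emeasure M {\<omega> \<in> space M. t - e * np \<le> - (e * S \<omega>)} \<le> ennreal (exp (- ((k - 1) * L)))"
    if e: "e = 1 \<or> e = - 1" for e :: real
  proof -
    have "emeasure M {\<omega> \<in> space M. t - e * np \<le> - (e * S \<omega>)} \<le>
        ennreal (exp (- h * (t - e * np))) * (\<integral>\<^sup>+\<omega>\<in>space M. ennreal (exp (h * (- (e * S \<omega>)))) \<partial>M)"
      by (rule Chernoff_ineq_nn_integral_ge) (use h in auto)
    also have "(\<integral>\<^sup>+\<omega>\<in>space M. ennreal (exp (h * (- (e * S \<omega>)))) \<partial>M) =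
        (\<integral>\<^sup>+\<omega>. ennreal (exp ((- (h * e)) * S \<omega>)) \<partial>M)"
      by (intro nn_integral_cong) (simp add: mult.assoc)
    also have "\<dots> \<le> ennreal (exp (real n * p * (- (h * e) + (- (h * e))\<^sup>2)))"
      unfolding S_def by (rule nn_integral_exp_count[OF ind A p]) (use h e in auto)
    also have "ennreal (exp (- h * (t - e * np))) * ennreal (exp (real n * p * (- (h * e) + (- (h * e))\<^sup>2)))
        = ennreal (exp (- h * (t - e * np) + np * (- (h * e) + (- (h * e))\<^sup>2)))"
      by (simp only: np_def exp_add ennreal_mult[OF exp_ge_zero exp_ge_zero])
    also have "- h * (t - e * np) + np * (- (h * e) + (- (h * e))\<^sup>2) = np * h\<^sup>2 - h * t"
      using e by (auto simp: algebra_simps)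
    also have "ennreal (exp (np * h\<^sup>2 - h * t)) \<le> ennreal (exp (- ((k - 1) * L)))"
      using h(3) by (intro ennreal_leI) simp
    finally show ?thesis by (simp add: mult_left_mono)
  qed
  have "emeasure M {\<omega> \<in> space M. t \<le> \<bar>S \<omega> - np\<bar>} \<le>
      emeasure M ({\<omega> \<in> space M. t - 1 * np \<le> - (1 * S \<omega>)} \<union> {\<omega> \<in> space M. t - (- 1) * np \<le> - ((- 1) * S \<omega>)})"
    by (intro emeasure_mono) auto
  also have "\<dots> \<le> emeasure M {\<omega> \<in> space M. t - 1 * np \<le> - (1 * S \<omega>)} +
      emeasure M {\<omega> \<in> space M. t - (- 1) * np \<le> - ((- 1) * S \<omega>)}"
    by (intro emeasure_subadditive) measurable
  also have "\<dots> \<le> ennreal (exp (- ((k - 1) * L))) + ennreal (exp (- ((k - 1) * L)))"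
    by (intro add_mono tail) auto
  also have "\<dots> = ennreal (2 * exp (- ((k - 1) * L)))" by (simp flip: ennreal_plus)
  finally show ?thesis by (simp add: S_def t_def np_def)
qed

end

section \<open>A uniform modulus for the empirical process\<close>

lemma empirical_cdf_diff:
  assumes "a \<le> b"
  shows "empirical_cdf n x b - empirical_cdf n x a = (\<Sum>i<n. indicat_real {a<..b} (x i)) / real n"
  unfolding empirical_cdf_eq_sum diff_divide_distrib[symmetric] sum_subtractf[symmetric]
  using assms by (intro arg_cong2[where f = "(/)"] sum.cong) (auto simp: indicator_def)

lemma mono_empirical_cdf: "mono (empirical_cdf n x)"
  unfolding mono_def empirical_cdf_eq_sum by (intro allI impI divide_right_mono sum_mono) auto

lemma exp_tail_nn_integral:
  fixes f :: "real \<Rightarrow> real"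
  assumes tail: "\<And>x. f x \<le> K * exp (- c * \<bar>x\<bar>)" and K: "0 < K" and c: "0 < c" and v: "0 \<le> v"
  shows "(\<integral>\<^sup>+ x. ennreal (f x) * indicator {x. v < \<bar>x\<bar>} x \<partial>lborel) \<le> ennreal (2 * K / c * exp (- c * v))"
proof -
  have one: "(\<integral>\<^sup>+ x. ennreal (K * exp (- c * x)) * indicator {v..} x \<partial>lborel) = ennreal (K / c * exp (- c * v))"
  proof -
    have "((\<lambda>x. K * exp (- c * x)) has_integral K * (exp (- c * v) / c)) {v..}"
      by (intro has_integral_mult_right has_integral_exp_minus_to_infinity c)
    from nn_integral_has_integral_lebesgue'[OF _ this] show ?thesis using K by simp
  qed
  have two: "(\<integral>\<^sup>+ x. ennreal (K * exp (- c * - x)) * indicator {v..} (- x) \<partial>lborel) = ennreal (K / c * exp (- c * v))"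
  proof -
    have "(\<integral>\<^sup>+ x. ennreal (K * exp (- c * x)) * indicator {v..} x \<partial>lborel) =
       ennreal \<bar>- 1\<bar> * (\<integral>\<^sup>+ x. ennreal (K * exp (- c * (0 + - 1 * x))) * indicator {v..} (0 + - 1 * x) \<partial>lborel)"
      by (rule nn_integral_real_affine) auto
    then show ?thesis using one by simp
  qed
  have "(\<integral>\<^sup>+ x. ennreal (f x) * indicator {x. v < \<bar>x\<bar>} x \<partial>lborel) \<le>
      (\<integral>\<^sup>+ x. ennreal (K * exp (- c * x)) * indicator {v..} x + ennreal (K * exp (- c * - x)) * indicator {v..} (- x) \<partial>lborel)"
  proof (rule nn_integral_mono)
    fix x :: real
    have "ennreal (f x) \<le> ennreal (K * exp (- c * \<bar>x\<bar>))" using tail by (rule ennreal_leI)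
    then show "ennreal (f x) * indicator {x. v < \<bar>x\<bar>} x \<le>
        ennreal (K * exp (- c * x)) * indicator {v..} x + ennreal (K * exp (- c * - x)) * indicator {v..} (- x)"
      using v by (cases "0 \<le> x") (auto simp: indicator_def intro: add_increasing add_increasing2)
  qed
  also have "\<dots> = ennreal (K / c * exp (- c * v)) + ennreal (K / c * exp (- c * v))"
    by (subst nn_integral_add) (use one two in auto)
  also have "\<dots> = ennreal (2 * K / c * exp (- c * v))" using K c by (simp flip: ennreal_plus)
  finally show ?thesis .
qed

text \<open>The constant of \<open>modulus_from_grid\<close> at the deviation factor 4.\<close>

definition grid_const :: "real \<Rightarrow> real \<Rightarrow> real" where
  "grid_const \<kappa> Fm = 4 * \<kappa> * Fm + 4 * (sqrt Fm + 2 * sqrt (\<kappa> * Fm) + 1)"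

text \<open>
  Bernstein-type bounds for the \<open>(n + 1)\<^sup>2\<close> intervals of a grid of mesh of order \<open>ln n / n\<close>; the monotonicity
  of both distribution functions extends them to all intervals.
\<close>

lemma good_sample_event:
  fixes f :: "real \<Rightarrow> real" and \<kappa> :: real
  assumes sample: "random_sample M f n X" and n: "2 \<le> n"
    and meas: "f \<in> borel_measurable borel" and nonneg: "\<And>x. 0 \<le> f x"
    and int: "(\<integral>\<^sup>+ x. ennreal (f x) \<partial>lborel) = 1"
    and tail: "\<And>x. f x \<le> K * exp (- c * \<bar>x\<bar>)" and K: "0 < K" and c: "0 < c"
    and \<kappa>: "0 < \<kappa>" "1 \<le> \<kappa> * ln (real n)"
  defines "R \<equiv> \<kappa> * ln (real n)"
  shows "\<exists>E\<in>sets M. emeasure M E \<le> ennreal (real n * (2 * K / c * exp (- c * (R - 1))) +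
      (real n + 1)\<^sup>2 * (2 * exp (- (3 * ln (real n))))) \<and>
    (\<forall>\<omega>\<in>space M - E. (\<forall>i<n. \<bar>X i \<omega>\<bar> \<le> R - 1) \<and>
      (\<forall>a b. - R \<le> a \<longrightarrow> a \<le> b \<longrightarrow> b \<le> R \<longrightarrow>
        \<bar>empirical_cdf n (\<lambda>i. X i \<omega>) b - empirical_cdf n (\<lambda>i. X i \<omega>) a - integral {a..b} f\<bar>
        \<le> emp_modulus (grid_const \<kappa> K) (rho n) (b - a)))"
proof -
  interpret prob_space M using sample by (simp add: random_sample_def)
  have ind: "indep_vars (\<lambda>_. borel) X {..<n}" and dist: "\<And>i. i < n \<Longrightarrow> distributed M lborel (X i) (\<lambda>x. ennreal (f x))"
    using sample by (auto simp: random_sample_def)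
  have rv[measurable]: "X i \<in> borel_measurable M" if "i < n" for i
    using ind that by (auto simp: indep_vars_def)
  have R: "1 \<le> R" using \<kappa> by (simp add: R_def)
  define L where "L = ln (real n)"
  have L: "0 < L" using n by (simp add: L_def)
  have r: "rho n = L / real n" by (simp add: rho_def L_def)
  have fint: "f integrable_on {a..b}" for a b by (rule density_integral(1)[OF meas nonneg int])
  have fK: "f x \<le> K" for x
  proof -
    have "K * exp (- c * \<bar>x\<bar>) \<le> K * 1" using K c by (intro mult_left_mono) auto
    with tail[of x] show ?thesis by simp
  qed
  have ple: "integral {a..b} f \<le> K * (b - a)" if "a \<le> b" for a b
  proof -
    have "integral {a..b} f \<le> integral {a..b} (\<lambda>_. K)" by (intro integral_le fint) (auto intro: fK)
    then show ?thesis using that by (simp add: mult.commute)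
  qed
  have pnn: "0 \<le> integral {a..b} f" for a b
    by (intro Henstock_Kurzweil_Integration.integral_nonneg fint nonneg)
  have prob: "emeasure M (X i -` {a<..b} \<inter> space M) = ennreal (integral {a..b} f)" if "i < n" for i a b
    using distributed_emeasure[OF dist[OF that], of "{a<..b}"] density_integral(2)[OF meas nonneg int] by simp
  define z where "z j = - R + real j * (2 * R / real n)" for j :: nat
  \<comment> \<open>The factor 4 makes each failure probability
    \<open>2 * exp (- (3 * ln n))\<close>, of order \<open>n ^ (- 3)\<close>, which survives a union
    over \<open>(n + 1)\<^sup>2\<close> pairs.\<close>
  define bad where "bad = (\<lambda>(i, j). {\<omega> \<in> space M. 4 * (sqrt (real n * integral {z i..z j} f * L) + L) \<le>
      \<bar>(\<Sum>m<n. indicat_real {z i<..z j} (X m \<omega>)) - real n * integral {z i..z j} f\<bar>})"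
  define far where "far i = {\<omega> \<in> space M. R - 1 < \<bar>X i \<omega>\<bar>}" for i
  have bad_meas: "bad ij \<in> sets M" for ij
  proof -
    have "(\<lambda>\<omega>. \<Sum>m<n. indicat_real {z i<..z j} (X m \<omega>)) \<in> borel_measurable M" for i j
      by (intro borel_measurable_sum) measurable
    then show ?thesis unfolding bad_def by (cases ij) (simp, measurable)
  qed
  have far_meas: "far i \<in> sets M" if "i < n" for i
    unfolding far_def using rv[OF that] by measurable
  define E where "E = (\<Union>i<n. far i) \<union> (\<Union>ij\<in>{..n} \<times> {..n}. bad ij)"
  have E: "E \<in> sets M" unfolding E_def
    by (intro sets.Un sets.finite_UN bad_meas) (auto intro: far_meas)
  have "emeasure M E \<le> emeasure M (\<Union>i<n. far i) + emeasure M (\<Union>ij\<in>{..n} \<times> {..n}. bad ij)"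
    unfolding E_def by (intro emeasure_subadditive sets.finite_UN bad_meas) (auto intro: far_meas)
  also have "\<dots> \<le> (\<Sum>i<n. emeasure M (far i)) + (\<Sum>ij\<in>{..n} \<times> {..n}. emeasure M (bad ij))"
    by (intro add_mono emeasure_subadditive_finite) (auto intro: far_meas bad_meas)
  also have "\<dots> \<le> (\<Sum>i<n. ennreal (2 * K / c * exp (- c * (R - 1)))) +
      (\<Sum>ij\<in>{..n} \<times> {..n}. ennreal (2 * exp (- ((4 - 1) * L))))"
  proof (intro add_mono sum_mono)
    fix i assume "i \<in> {..<n}"
    then have i: "i < n" by simp
    have "far i = X i -` {x. R - 1 < \<bar>x\<bar>} \<inter> space M" by (auto simp: far_def)
    then have "emeasure M (far i) = (\<integral>\<^sup>+ x. ennreal (f x) * indicator {x. R - 1 < \<bar>x\<bar>} x \<partial>lborel)"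
      using distributed_emeasure[OF dist[OF i], of "{x. R - 1 < \<bar>x\<bar>}"] by simp
    also have "\<dots> \<le> ennreal (2 * K / c * exp (- c * (R - 1)))"
      using R by (intro exp_tail_nn_integral tail K c) auto
    finally show "emeasure M (far i) \<le> ennreal (2 * K / c * exp (- c * (R - 1)))" .
  next
    fix ij assume "ij \<in> {..n} \<times> {..n}"
    obtain i j where ij: "ij = (i, j)" by (cases ij)
    have "emeasure M {\<omega> \<in> space M. 4 * (sqrt (real n * integral {z i..z j} f * L) + L) \<le>
      \<bar>(\<Sum>m<n. indicat_real {z i<..z j} (X m \<omega>)) - real n * integral {z i..z j} f\<bar>} \<le> ennreal (2 * exp (- ((4 - 1) * L)))"
      by (rule count_deviation[OF ind]) (use L prob pnn in auto)
    then show "emeasure M (bad ij) \<le> ennreal (2 * exp (- ((4 - 1) * L)))" by (simp add: bad_def ij)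
  qed
  also have "\<dots> = ennreal (real n * (2 * K / c * exp (- c * (R - 1))) + (real n + 1)\<^sup>2 * (2 * exp (- (3 * L))))"
  proof -
    have "(\<Sum>i<n. ennreal (2 * K / c * exp (- c * (R - 1)))) = ennreal (\<Sum>i<n. 2 * K / c * exp (- c * (R - 1)))"
      using K c by (intro sum_ennreal) auto
    moreover have "(\<Sum>ij\<in>{..n} \<times> {..n}. ennreal (2 * exp (- ((4 - 1) * L)))) =
        ennreal (\<Sum>ij\<in>{..n} \<times> {..n}. 2 * exp (- ((4 - 1) * L)))"
      by (intro sum_ennreal) auto
    moreover have "(\<Sum>ij\<in>{..n} \<times> {..n}. 2 * exp (- ((4 - 1) * L))) = (real n + 1)\<^sup>2 * (2 * exp (- (3 * L)))"
      by (simp add: card_cartesian_product power2_eq_square algebra_simps)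
    ultimately show ?thesis using K c by (simp flip: ennreal_plus)
  qed
  finally have mE: "emeasure M E \<le> ennreal (real n * (2 * K / c * exp (- c * (R - 1))) +
      (real n + 1)\<^sup>2 * (2 * exp (- (3 * ln (real n)))))" by (simp add: L_def)
  have "(\<forall>i<n. \<bar>X i \<omega>\<bar> \<le> R - 1) \<and>
      (\<forall>a b. - R \<le> a \<longrightarrow> a \<le> b \<longrightarrow> b \<le> R \<longrightarrow>
        \<bar>empirical_cdf n (\<lambda>i. X i \<omega>) b - empirical_cdf n (\<lambda>i. X i \<omega>) a - integral {a..b} f\<bar>
        \<le> emp_modulus (grid_const \<kappa> K) (rho n) (b - a))" if \<omega>: "\<omega> \<in> space M - E" for \<omega>
  proof (intro conjI allI impI)
    fix i assume "i < n"
    then show "\<bar>X i \<omega>\<bar> \<le> R - 1" using \<omega> by (auto simp: E_def far_def not_less)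
  next
    fix a b assume ab: "- R \<le> a" "a \<le> b" "b \<le> R"
    define H where "H = empirical_cdf n (\<lambda>i. X i \<omega>)"
    \<comment> \<open>Left of \<open>- R\<close> the integral is over an empty interval, so
      \<open>\<Phi>\<close> vanishes there and is monotone on the whole line.\<close>
    define \<Phi> where "\<Phi> v = integral {- R..v} f" for v
    have diff: "\<Phi> v - \<Phi> u = integral {u..v} f" if "- R \<le> u" "u \<le> v" for u v
      using Henstock_Kurzweil_Integration.integral_combine[OF that fint] by (simp add: \<Phi>_def)
    have \<Phi>0: "\<Phi> u = 0" if "u \<le> - R" for u
      using that by (cases "u = - R") (auto simp: \<Phi>_def)
    have \<Phi>_inc: "0 \<le> \<Phi> v - \<Phi> u \<and> \<Phi> v - \<Phi> u \<le> K * (v - u)" if "u \<le> v" for u v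
    proof (cases "- R \<le> u")
      case True
      then show ?thesis using diff[OF True that] pnn ple[OF that] by simp
    next
      case False
      show ?thesis
      proof (cases "v \<le> - R")
        case True
        then show ?thesis using \<Phi>0 False that K by simp
      next
        case v: False
        have "K * (v + R) \<le> K * (v - u)" using False K by (intro mult_left_mono) auto
        then show ?thesis using v False \<Phi>0[of u] pnn[of "- R" v] ple[of "- R" v] by (simp add: \<Phi>_def)
      qed
    qed
    have "\<bar>H b - H a - (\<Phi> b - \<Phi> a)\<bar> \<le>
      emp_modulus (4 * \<kappa> * K + 4 * (sqrt K + 2 * sqrt (\<kappa> * K) + 1)) (rho n) (b - a)"
    proof (rule modulus_from_grid)
      show "mono H" unfolding H_def by (rule mono_empirical_cdf)
      have "\<Phi> u \<le> \<Phi> v" if "u \<le> v" for u v using \<Phi>_inc[OF that] by linarith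
      then show "mono \<Phi>" by (rule monoI)
      show "\<Phi> b - \<Phi> a \<le> K * (b - a)" if "a \<le> b" for a b using \<Phi>_inc[OF that] by simp
      show "2 * R / real n = 2 * \<kappa> * rho n" by (simp add: R_def r L_def)
      fix i j :: nat assume ij: "i \<le> j" "j \<le> n"
      have "z j - z i = real (j - i) * (2 * R / real n)"
        using ij by (simp add: z_def of_nat_diff left_diff_distrib del: times_divide_eq_right)
      moreover have "0 \<le> real (j - i) * (2 * R / real n)" "0 \<le> real i * (2 * R / real n)" using R by auto
      ultimately have zz: "z i \<le> z j" "- R \<le> z i" "z j - z i = real (j - i) * (2 * R / real n)"
        by (auto simp: z_def)
      define P where "P = integral {z i..z j} f"
      have P: "0 \<le> P" "P \<le> K * (z j - z i)" unfolding P_def using pnn ple[OF zz(1)] by auto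
      have "\<omega> \<notin> bad (i, j)" using \<omega> ij by (auto simp: E_def)
      then have "\<bar>(\<Sum>m<n. indicat_real {z i<..z j} (X m \<omega>)) - real n * P\<bar> \<le> 4 * (sqrt (real n * P * L) + L)"
        using \<omega> by (simp add: bad_def P_def)
      moreover have "(\<Sum>m<n. indicat_real {z i<..z j} (X m \<omega>)) = real n * (H (z j) - H (z i))"
        unfolding H_def empirical_cdf_diff[OF zz(1)] using n by simp
      ultimately have "real n * \<bar>H (z j) - H (z i) - P\<bar> \<le> 4 * (sqrt (real n * P * L) + L)"
        by (simp add: abs_mult flip: right_diff_distrib)
      also have "real n * P * L = (real n)\<^sup>2 * (P * rho n)" using n by (simp add: r power2_eq_square)
      also have "sqrt ((real n)\<^sup>2 * (P * rho n)) = real n * sqrt (P * rho n)" by (simp add: real_sqrt_mult)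
      also have "L = real n * rho n" using n by (simp add: r)
      finally have "real n * \<bar>H (z j) - H (z i) - P\<bar> \<le> real n * (4 * (sqrt (P * rho n) + rho n))"
        by (simp add: algebra_simps)
      then have "\<bar>H (z j) - H (z i) - P\<bar> \<le> 4 * (sqrt (P * rho n) + rho n)" using n by simp
      also have "\<dots> \<le> 4 * (sqrt (K * (z j - z i) * rho n) + rho n)"
        using P L n by (intro mult_left_mono add_right_mono) (auto simp: r intro!: mult_right_mono divide_right_mono)
      finally show "\<bar>H (- R + real j * (2 * R / real n)) - H (- R + real i * (2 * R / real n)) -
          (\<Phi> (- R + real j * (2 * R / real n)) - \<Phi> (- R + real i * (2 * R / real n)))\<bar>
          \<le> 4 * (sqrt (K * (real (j - i) * (2 * R / real n)) * rho n) + rho n)"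
        using diff[OF zz(2,1)] zz(3) by (simp add: P_def z_def)
    qed (use K n R \<kappa> L ab in \<open>auto simp: r\<close>)
    then show "\<bar>empirical_cdf n (\<lambda>i. X i \<omega>) b - empirical_cdf n (\<lambda>i. X i \<omega>) a - integral {a..b} f\<bar>
        \<le> emp_modulus (grid_const \<kappa> K) (rho n) (b - a)"
      using diff[OF ab(1,2)] by (simp add: H_def grid_const_def)
  qed
  with E mE show ?thesis by blast
qed

section \<open>The rate of convergence\<close>

text \<open>The frontier of a convex set is Lebesgue null. In the interior of its domain a concave
  function is continuous, which the analysis of the pieces relies on.\<close>

lemma AE_distributed_interior:
  assumes X: "distributed M lborel X (\<lambda>x. ennreal (f x))" and S: "convex {x. 0 < f x}"
  shows "AE \<omega> in M. X \<omega> \<in> interior {x::real. 0 < f x}"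
proof -
  define S where "S = {x. 0 < f x}"
  have null: "frontier S \<in> null_sets lborel"
  proof -
    have "frontier S \<in> null_sets lebesgue"
      using negligible_convex_frontier[of S] S by (simp add: S_def negligible_iff_null_sets)
    then show ?thesis by (subst (asm) null_sets_completion_iff) auto
  qed
  have meas: "X \<in> measurable M lborel" using X by (simp add: distributed_def)
  have "emeasure M (X -` (- interior S) \<inter> space M) = (\<integral>\<^sup>+x. ennreal (f x) * indicator (- interior S) x \<partial>lborel)"
    by (rule distributed_emeasure[OF X]) simp
  also have "\<dots> = (\<integral>\<^sup>+x. 0 \<partial>(lborel :: real measure))"
  proof (rule nn_integral_cong_AE)
    show "AE x in lborel. ennreal (f x) * indicator (- interior S) x = 0"
      using AE_not_in[OF null]
    proof eventually_elim
      case (elim x)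
      then have "x \<in> interior S \<or> x \<notin> S" using closure_subset[of S] by (auto simp: frontier_def)
      then show ?case by (auto simp: S_def not_less ennreal_neg)
    qed
  qed
  finally have "X -` (- interior S) \<inter> space M \<in> null_sets M"
    using measurable_sets[OF meas, of "- interior S"] by (auto intro: null_setsI)
  then show ?thesis
    by (rule AE_I') (auto simp: S_def)
qed

text \<open>The bad event may fail to be measurable. It is enclosed in the union of a measurable
  event of probability at most \<open>bound n\<close>, off which the sample is good, and a null set
  that covers the almost sure assumptions.\<close>

theorem cdf_distance_rate:
  fixes M :: "'w measure"
    and f :: "real \<Rightarrow> real" and \<phi> :: "real \<Rightarrow> ereal"
    and X :: "nat \<Rightarrow> nat \<Rightarrow> 'w \<Rightarrow> real"
    and \<phi>hat :: "nat \<Rightarrow> 'w \<Rightarrow> real \<Rightarrow> ereal"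
    and A B C :: real
  defines "g \<equiv> \<lambda>x. real_of_ereal (\<phi> x)"
  assumes density: "log_concave_density f \<phi>"
    and sample: "\<And>n. n > 1 \<Longrightarrow> random_sample M f n (X n)"
    and mle: "\<And>n. n > 1 \<Longrightarrow> AE \<omega> in M. is_log_concave_mle n (\<lambda>i. X n i \<omega>) (\<phi>hat n \<omega>)"
    and T: "A < B" "{A..B} \<subseteq> interior {x. f x > 0}"
    and C: "C > 0"
    and curvature:
      "(\<forall>x y. A \<le> x \<and> x < y \<and> y \<le> B \<longrightarrow> left_deriv g x - left_deriv g y \<ge> C * (y - x)) \<or>
       (\<forall>x y. A \<le> x \<and> x < y \<and> y \<le> B \<longrightarrow> right_deriv g x - right_deriv g y \<ge> C * (y - x))"
  obtains K where "0 < K"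
    "(\<lambda>n. outer_measure_of M {\<omega> \<in> space M. \<exists>t\<in>{A..B}. K * rho n powr (3 / 5) <
       \<bar>estimated_cdf (\<phi>hat n \<omega>) t - empirical_cdf n (\<lambda>i. X n i \<omega>) t\<bar>}) \<longlonglongrightarrow> 0"
proof -
  define S where "S = {x. f x > 0}"
  define J where "J = interior S"
  have \<phi>: "concave_ext \<phi>" and fe: "\<And>x. f x = exp_ext (\<phi> x)" and int: "(\<integral>\<^sup>+ x. ennreal (f x) \<partial>lborel) = 1"
    using density by (auto simp: log_concave_density_def)
  have S_eq: "S = {x. \<phi> x \<noteq> -\<infinity>}" by (auto simp: S_def fe exp_ext_def)
  have S: "convex S" and gS: "concave_on S g"
    unfolding S_eq g_def by (rule concave_ext_real[OF \<phi>])+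
  have J: "convex J" "open J" "J \<subseteq> S" using S by (auto simp: J_def convex_interior interior_subset)
  have gJ: "concave_on J g" using gS J unfolding concave_on_def by (meson convex_on_subset)
  have f_exp: "f v = exp (g v)" if "v \<in> J" for v
    using that J by (auto simp: S_eq fe exp_ext_def g_def)
  have g_cont: "continuous_on J g"
  proof -
    have "continuous_on J (\<lambda>x. - g x)"
      using J gJ unfolding concave_on_def by (intro convex_on_continuous)
    then have "continuous_on J (\<lambda>x. - (- g x))" by (rule continuous_on_minus)
    then show ?thesis by simp
  qed
  have meas: "f \<in> borel_measurable borel"
    using borel_measurable_exp_ext[OF \<phi>] by (simp add: fe[abs_def])
  have nonneg: "0 \<le> f x" for x by (simp add: fe exp_ext_nonneg)
  have "A \<in> J" "B \<in> J" using T by (auto simp: J_def S_def)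
  then obtain e1 e2 where e: "0 < e1" "cball A e1 \<subseteq> J" "0 < e2" "cball B e2 \<subseteq> J"
    using J(2) open_contains_cball by metis
  define c where "c = min 1 (min e1 e2)"
  have c: "0 < c" "c \<le> 1" "c \<le> e1" "c \<le> e2" using e by (auto simp: c_def)
  have ABJ: "{A - c..B + c} \<subseteq> J"
  proof
    fix v assume v: "v \<in> {A - c..B + c}"
    consider "v < A" | "v \<in> {A..B}" | "B < v" by force
    then show "v \<in> J"
    proof cases
      case 1
      then have "v \<in> cball A e1" using v c by (auto simp: dist_real_def)
      then show ?thesis using e by blast
    next
      case 2
      then show ?thesis using T by (auto simp: J_def S_def)
    next
      case 3
      then have "v \<in> cball B e2" using v c by (auto simp: dist_real_def)
      then show ?thesis using e by blast
    qed
  qed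
  obtain K0 d where K0: "0 < K0" and d: "0 < d" and tail: "\<And>x. f x \<le> K0 * exp (- d * \<bar>x\<bar>)"
    using log_concave_density_tail[OF density T(1)] T(2) interior_subset by blast
  have fK0: "f x \<le> K0" for x
  proof -
    have "K0 * exp (- d * \<bar>x\<bar>) \<le> K0 * 1" using K0 d by (intro mult_left_mono) auto
    with tail[of x] show ?thesis by simp
  qed
  have fI: "integral {a..b} f \<le> K0 * (b - a)" if "a \<le> b" for a b
  proof -
    have "integral {a..b} f \<le> integral {a..b} (\<lambda>_. K0)"
      by (intro integral_le density_integral(1)[OF meas nonneg int]) (auto intro: fK0)
    then show ?thesis using that by (simp add: mult.commute)
  qed
  have "continuous_on {A - c..B + c} f"
    by (subst continuous_on_cong[OF refl, of _ f "\<lambda>v. exp (g v)"])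
       (use ABJ f_exp in \<open>auto intro!: continuous_on_exp continuous_on_subset[OF g_cont]\<close>)
  moreover have "{A - c..B + c} \<noteq> {}" using T c by simp
  ultimately obtain v0 where v0: "v0 \<in> {A - c..B + c}" "\<And>v. v \<in> {A - c..B + c} \<Longrightarrow> f v0 \<le> f v"
    using continuous_attains_inf[of "{A - c..B + c}" f] by auto
  define m0 where "m0 = f v0"
  have m0: "0 < m0" "\<And>v. v \<in> {A - c..B + c} \<Longrightarrow> m0 \<le> f v"
    using v0 ABJ J f_exp[of v0] by (auto simp: m0_def)
  have curv: "g v + g (v + 2 * h) - 2 * g (v + h) \<le> - (C / 4 * h\<^sup>2)"
    if "A \<le> v" "0 \<le> h" "v + 2 * h \<le> B" for v h
  proof (rule second_difference_of_strong_concavity[OF _ _ _ curvature that])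
    show "concave_on {A - c<..<B + c} g"
    proof -
      have "{A - c<..<B + c} \<subseteq> J" using ABJ by auto
      with gJ show ?thesis unfolding concave_on_def by (rule convex_on_subset) simp
    qed
  qed (use c in auto)
  \<comment> \<open>With range \<open>R n = \<kappa> * ln n\<close> the probability that some
    observation falls outside is of order \<open>n * exp (- d * R n) = 1 / n\<close>.\<close>
  define \<kappa> where "\<kappa> = 2 / d"
  have \<kappa>: "0 < \<kappa>" using d by (simp add: \<kappa>_def)
  define K where "K = grid_const \<kappa> K0"
  have K: "0 < K" unfolding K_def grid_const_def using \<kappa> K0
    by (intro add_nonneg_pos mult_nonneg_nonneg mult_pos_pos) auto
  define k where "k = 3 * K + K0"
  have k: "0 < k" using K K0 by (simp add: k_def)
  define m where "m = mid_const c m0"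
  have m: "0 < m" using m0 c by (simp add: m_def mid_const_pos)
  \<comment> \<open>A choice linear in the required constant suffices: \<open>1 \<le> C7\<close>
    gives \<open>C7 \<le> C7\<^sup>2\<close>.\<close>
  define C7 where "C7 = 1 + 288 * m * (2 * k + 1) / (C / 4)"
  have C7: "1 \<le> C7" "288 * m * (2 * k + 1) \<le> C / 4 * C7\<^sup>2"
  proof -
    show 1: "1 \<le> C7" using m k C by (simp add: C7_def)
    have "288 * m * (2 * k + 1) \<le> C / 4 * C7" using C by (simp add: C7_def field_simps)
    also have "\<dots> \<le> C / 4 * C7\<^sup>2" using 1 C by (intro mult_left_mono) (auto simp: power2_eq_square)
    finally show "288 * m * (2 * k + 1) \<le> C / 4 * C7\<^sup>2" .
  qed
  define Kf where "Kf = inc_const c m0 K0 * (2 * k * C7 + C7) + 3 * k * C7"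
  have Kf: "0 < Kf"
    unfolding Kf_def using k C7 m0 K0 inc_const_nonneg[of m0 K0 c]
    by (intro add_nonneg_pos mult_nonneg_nonneg) auto
  define R where "R n = \<kappa> * ln (real n)" for n
  define q where "q n = rho n powr (1 / 5)" for n
  define bound where "bound n = real n * (2 * K0 / d * exp (- d * (R n - 1))) +
      (real n + 1)\<^sup>2 * (2 * exp (- (3 * ln (real n))))" for n
  have bound0: "bound \<longlonglongrightarrow> 0"
    unfolding bound_def R_def \<kappa>_def using K0 d by real_asymp
  define W where "W = max 1 (\<bar>A\<bar> + \<bar>B\<bar> + c)"
  \<comment> \<open>The decisive item is the one that admits \<open>Lam = (q n)\<^sup>2\<close>: its
    left side is of order \<open>(ln n)\<^sup>2 / sqrt n\<close>, whereas
    \<open>(q n)\<^sup>2\<close> is \<open>(ln n / n) powr (2 / 5)\<close>.\<close>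
  have ev: "\<forall>\<^sub>F n in sequentially. 2 \<le> n \<and> W \<le> R n \<and> 0 < rho n \<and> rho n \<le> 1 \<and>
      2 * R n * emp_modulus k (rho n) (2 * R n) \<le> (q n)\<^sup>2 \<and> m * (2 * k + 1) * (q n)\<^sup>2 \<le> 1 / 2 \<and>
      C7 * q n < B - A \<and> emp_modulus K (rho n) (2 * R n) < m0 * c"
  proof (intro eventually_conj)
    have W: "0 < W" by (simp add: W_def)
    show "\<forall>\<^sub>F n in sequentially. W \<le> R n" unfolding R_def using \<kappa> W by real_asymp
    show "\<forall>\<^sub>F n in sequentially. 0 < rho n" unfolding rho_def by real_asymp
    show "\<forall>\<^sub>F n in sequentially. rho n \<le> 1" unfolding rho_def by real_asymp
    show "\<forall>\<^sub>F n in sequentially. 2 * R n * emp_modulus k (rho n) (2 * R n) \<le> (q n)\<^sup>2"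
      unfolding R_def emp_modulus_def rho_def q_def using k \<kappa> by real_asymp
    have mk: "0 < m * (2 * k + 1)" using m k by simp
    show "\<forall>\<^sub>F n in sequentially. m * (2 * k + 1) * (q n)\<^sup>2 \<le> 1 / 2"
      unfolding rho_def q_def using mk by real_asymp
    have BA: "0 < B - A" "0 < C7" using T C7 by auto
    show "\<forall>\<^sub>F n in sequentially. C7 * q n < B - A"
      unfolding rho_def q_def using BA by real_asymp
    have mc: "0 < m0 * c" using m0 c by simp
    show "\<forall>\<^sub>F n in sequentially. emp_modulus K (rho n) (2 * R n) < m0 * c"
      unfolding R_def emp_modulus_def rho_def using K \<kappa> mc by real_asymp
  qed (rule eventually_ge_at_top)
  define Bad where "Bad n = {\<omega> \<in> space M. \<exists>t\<in>{A..B}. Kf * rho n powr (3 / 5) <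
       \<bar>estimated_cdf (\<phi>hat n \<omega>) t - empirical_cdf n (\<lambda>i. X n i \<omega>) t\<bar>}" for n
  have le_bound: "\<forall>\<^sub>F n in sequentially. outer_measure_of M (Bad n) \<le> ennreal (bound n)"
    using ev
  proof eventually_elim
    case (elim n)
    have n: "1 < n" "0 < n" using elim by auto
    have R1: "1 \<le> R n" "\<bar>A\<bar> + \<bar>B\<bar> + c \<le> R n" using elim by (auto simp: W_def)
    have RAB: "- R n \<le> A - c" "- R n \<le> A" "A \<le> R n" "- R n \<le> B" "B \<le> R n" "B + c \<le> R n" using R1(2) c by linarith+
    have q: "0 < q n" "q n \<le> 1" "rho n = q n ^ 5" "q n ^ 3 = rho n powr (3 / 5)"
      using elim by (auto simp: q_def powr_le1 powr_powr simp flip: powr_realpow)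
    have "AE \<omega> in M. \<forall>i\<in>{..<n}. X n i \<omega> \<in> J"
    proof (rule AE_finite_allI)
      fix i assume "i \<in> {..<n}"
      then have "distributed M lborel (X n i) (\<lambda>x. ennreal (f x))"
        using sample[OF n(1)] by (simp add: random_sample_def)
      then show "AE \<omega> in M. X n i \<omega> \<in> J"
        unfolding J_def S_def by (rule AE_distributed_interior) (use S in \<open>simp add: S_def\<close>)
    qed simp
    with mle[OF n(1)] have "AE \<omega> in M. is_log_concave_mle n (\<lambda>i. X n i \<omega>) (\<phi>hat n \<omega>) \<and> (\<forall>i\<in>{..<n}. X n i \<omega> \<in> J)"
      by eventually_elim simp
    then obtain N where N: "N \<in> null_sets M" "{\<omega> \<in> space M. \<not> (is_log_concave_mle n (\<lambda>i. X n i \<omega>) (\<phi>hat n \<omega>) \<and>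
        (\<forall>i\<in>{..<n}. X n i \<omega> \<in> J))} \<subseteq> N"
      by (elim AE_E) (auto simp: null_sets_def)
    obtain E where E: "E \<in> sets M" "emeasure M E \<le> ennreal (bound n)"
      and good: "\<And>\<omega>. \<omega> \<in> space M - E \<Longrightarrow> (\<forall>i<n. \<bar>X n i \<omega>\<bar> \<le> R n - 1) \<and>
      (\<forall>a b. - R n \<le> a \<longrightarrow> a \<le> b \<longrightarrow> b \<le> R n \<longrightarrow>
        \<bar>empirical_cdf n (\<lambda>i. X n i \<omega>) b - empirical_cdf n (\<lambda>i. X n i \<omega>) a - integral {a..b} f\<bar>
        \<le> emp_modulus K (rho n) (b - a))"
      using good_sample_event[OF sample[OF n(1)] _ meas nonneg int tail K0 d \<kappa>] elim R1(1)
      unfolding bound_def R_def K_def by blast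
    have "Bad n \<subseteq> E \<union> N"
    proof
      fix \<omega> assume \<omega>: "\<omega> \<in> Bad n"
      show "\<omega> \<in> E \<union> N"
      proof (rule ccontr)
        assume "\<omega> \<notin> E \<union> N"
        then have wE: "\<omega> \<in> space M - E" and wN: "is_log_concave_mle n (\<lambda>i. X n i \<omega>) (\<phi>hat n \<omega>)"
          "\<And>i. i < n \<Longrightarrow> X n i \<omega> \<in> J"
          using \<omega> N(2) by (auto simp: Bad_def)
        define x where "x i = X n i \<omega>" for i
        have xR: "\<bar>x i\<bar> \<le> R n - 1" if "i < n" for i using good[OF wE] that by (simp add: x_def)
        have modulus: "\<bar>empirical_cdf n x b - empirical_cdf n x a - integral {a..b} f\<bar> \<le> emp_modulus K (rho n) (b - a)"
          if "- R n \<le> a" "a \<le> b" "b \<le> R n" for a b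
          using good[OF wE] that by (simp add: x_def[abs_def])
        have mass: "m0 * c \<le> integral {a..b} f" if "a \<le> b" "{v..v + c} \<subseteq> {a..b}" "{v..v + c} \<subseteq> {A - c..B + c}" for a b v
        proof -
          have "m0 * c = integral {v..v + c} (\<lambda>_. m0)" using c by simp
          also have "\<dots> \<le> integral {v..v + c} f"
            by (intro integral_le density_integral(1)[OF meas nonneg int]) (use that m0 in auto)
          also have "\<dots> \<le> integral {a..b} f"
            by (intro integral_subset_le density_integral(1)[OF meas nonneg int] that(2)) (use nonneg in blast)
          finally show ?thesis .
        qed
        have small: "emp_modulus K (rho n) v < m0 * c" if "v \<le> 2 * R n" for v
          using emp_modulus_mono[of K "rho n" v "2 * R n"] that elim K by auto
        \<comment> \<open>Without an observation up to \<open>A\<close> the empirical increment on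
          \<open>[- R n, A]\<close> would be 0, although \<open>f\<close> has mass at least
          \<open>m0 * c\<close> on \<open>[A - c, A]\<close>, more than the modulus
          tolerates.\<close>
        have xA: "\<exists>i<n. x i \<le> A"
        proof (rule ccontr)
          assume none: "\<not> (\<exists>i<n. x i \<le> A)"
          have "\<not> x i \<le> A" "\<not> x i \<le> - R n" if "i < n" for i
            using none xR[OF that] that by auto
          then have "empirical_cdf n x A = 0" "empirical_cdf n x (- R n) = 0"
            by (simp_all add: empirical_cdf_eq_sum)
          then have "integral {- R n..A} f \<le> emp_modulus K (rho n) (A - - R n)"
            using modulus[of "- R n" A] RAB by auto
          moreover have "emp_modulus K (rho n) (A - - R n) < m0 * c" using RAB by (intro small) auto
          moreover have "m0 * c \<le> integral {- R n..A} f" using RAB c T by (intro mass[of _ _ "A - c"]) auto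
          ultimately show False by linarith
        qed
        have xB: "\<exists>i<n. B \<le> x i"
        proof (rule ccontr)
          assume none: "\<not> (\<exists>i<n. B \<le> x i)"
          have "x i \<le> B" "x i \<le> R n" if "i < n" for i
            using none xR[OF that] that by auto
          then have "empirical_cdf n x B = 1" "empirical_cdf n x (R n) = 1"
            using n by (simp_all add: empirical_cdf_eq_sum)
          then have "integral {B..R n} f \<le> emp_modulus K (rho n) (R n - B)"
            using modulus[of B "R n"] RAB by auto
          moreover have "emp_modulus K (rho n) (R n - B) < m0 * c" using RAB by (intro small) auto
          moreover have "m0 * c \<le> integral {B..R n} f" using RAB c T by (intro mass[of _ _ B]) auto
          ultimately show False by linarith
        qed
        have M0: "f v \<le> K0" if "v \<in> {A - c..B + c}" for v by (rule fK0)
        have Lam: "2 * R n * emp_modulus (3 * K + K0) (rho n) (2 * R n) \<le> (q n)\<^sup>2"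
          using elim by (simp add: k_def)
        have pos: "0 \<le> K0" "0 < rho n" "rho n \<le> 1" "0 < C / 4" using K0 elim C by auto
        have xJ: "x i \<in> J" if "i < n" for i using wN(2)[OF that] by (simp add: x_def)
        have mle_x: "is_log_concave_mle n x (\<phi>hat n \<omega>)" using wN(1) by (simp add: x_def[abs_def])
        show False
        proof (rule mle_structure[OF mle_x n(2)], goal_cases)
          case (1 G)
          interpret gs: good_sample f g J A B c m0 K0 K0 K "R n" "rho n" "(q n)\<^sup>2" "C / 4" n x "\<phi>hat n \<omega>" G
            by (rule good_sample.intro[OF J(1) gJ f_exp g_cont T(1) c(1,2) ABJ m0 M0 fI pos(1) K pos(2-4) curv
                n(2) 1 xJ xR xA xB modulus Lam])
          have kk: "gs.k = k" by (simp add: gs.k_def k_def)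
          obtain t where t: "t \<in> {A..B}" "Kf * rho n powr (3 / 5) < \<bar>estimated_cdf (\<phi>hat n \<omega>) t - empirical_cdf n x t\<bar>"
            using \<omega> by (auto simp: Bad_def x_def[abs_def])
          have "\<bar>estimated_cdf (\<phi>hat n \<omega>) t - empirical_cdf n x t\<bar> \<le> Kf * q n ^ 3"
            unfolding Kf_def kk[symmetric]
            by (rule gs.cdf_distance) (use q elim C7 t in \<open>auto simp: kk m_def\<close>)
          with t q show False by simp
        qed
      qed
    qed
    then have "outer_measure_of M (Bad n) \<le> outer_measure_of M (E \<union> N)" by (rule outer_measure_of_mono)
    also have "\<dots> = emeasure M (E \<union> N)" using E N by (intro outer_measure_of_eq) auto
    also have "\<dots> = emeasure M E" using E N by (simp add: emeasure_Un_null_set)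
    also note E(2)
    finally show ?case .
  qed
  have "(\<lambda>n. ennreal (bound n)) \<longlonglongrightarrow> 0"
    using tendsto_ennrealI[OF bound0] by simp
  then have "(\<lambda>n. outer_measure_of M (Bad n)) \<longlonglongrightarrow> 0"
    by (rule tendsto_sandwich[OF _ le_bound tendsto_const, rotated]) simp
  from that[OF Kf this[unfolded Bad_def]] show ?thesis .
qed

theorem theorem4p4:
  fixes M :: "'w measure"
    and f :: "real \<Rightarrow> real" and \<phi> :: "real \<Rightarrow> ereal"
    and X :: "nat \<Rightarrow> nat \<Rightarrow> 'w \<Rightarrow> real"
    and \<phi>hat :: "nat \<Rightarrow> 'w \<Rightarrow> real \<Rightarrow> ereal"
    and \<beta> L A B C :: real
  defines "g \<equiv> \<lambda>x. real_of_ereal (\<phi> x)"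
    and "Z \<equiv> \<lambda>n \<omega>. SUP t\<in>shrunk_interval A B n \<beta>.
           \<bar>estimated_cdf (\<phi>hat n \<omega>) t - empirical_cdf n (\<lambda>i. X n i \<omega>) t\<bar>"
  assumes density: "log_concave_density f \<phi>"
    and sample: "\<And>n. n > 1 \<Longrightarrow> random_sample M f n (X n)"
    and mle: "\<And>n. n > 1 \<Longrightarrow> AE \<omega> in M. is_log_concave_mle n (\<lambda>i. X n i \<omega>) (\<phi>hat n \<omega>)"
    and beta: "1 \<le> \<beta>" "\<beta> \<le> 2"
    and L: "L > 0"
    and T: "A < B" "{A..B} \<subseteq> interior {x. f x > 0}"
    and holder: "holder_class \<beta> L {A..B} g"
    and C: "C > 0"
    and curvature:
      "(\<forall>x y. A \<le> x \<and> x < y \<and> y \<le> B \<longrightarrow> left_deriv g x - left_deriv g y \<ge> C * (y - x)) \<or>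
       (\<forall>x y. A \<le> x \<and> x < y \<and> y \<le> B \<longrightarrow> right_deriv g x - right_deriv g y \<ge> C * (y - x))"
  shows "bigO_prob M Z (\<lambda>n. rho n powr (3 * \<beta> / (4 * \<beta> + 2))) \<and>
         (\<beta> > 1 \<longrightarrow> smallo_prob M Z (\<lambda>n. real n powr (- 1 / 2)))"
proof -
  obtain K where K: "0 < K" and lim:
    "(\<lambda>n. outer_measure_of M {\<omega> \<in> space M. \<exists>t\<in>{A..B}. K * rho n powr (3 / 5) <
       \<bar>estimated_cdf (\<phi>hat n \<omega>) t - empirical_cdf n (\<lambda>i. X n i \<omega>) t\<bar>}) \<longlonglongrightarrow> 0"
    using cdf_distance_rate[OF density sample mle T C curvature[unfolded g_def]] by blast
  define Bad where "Bad n = {\<omega> \<in> space M. \<exists>t\<in>{A..B}. K * rho n powr (3 / 5) <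
       \<bar>estimated_cdf (\<phi>hat n \<omega>) t - empirical_cdf n (\<lambda>i. X n i \<omega>) t\<bar>}" for n
  note lim = lim[folded Bad_def]
  have ev: "\<forall>\<^sub>F n in sequentially. 0 < rho n \<and> rho n \<le> 1 \<and> rho n powr (1 / (2 * \<beta> + 1)) < (B - A) / 2"
  proof (intro eventually_conj)
    show "\<forall>\<^sub>F n in sequentially. 0 < rho n" "\<forall>\<^sub>F n in sequentially. rho n \<le> 1"
      unfolding rho_def by real_asymp+
    have "0 < 1 / (2 * \<beta> + 1)" "0 < (B - A) / 2" using beta T by auto
    then show "\<forall>\<^sub>F n in sequentially. rho n powr (1 / (2 * \<beta> + 1)) < (B - A) / 2"
      unfolding rho_def by real_asymp
  qed
  have sub: "\<forall>\<^sub>F n in sequentially. {\<omega> \<in> space M. K * rho n powr (3 / 5) < \<bar>Z n \<omega>\<bar>} \<subseteq> Bad n"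
    using ev
  proof eventually_elim
    case (elim n)
    define I where "I = shrunk_interval A B n \<beta>"
    \<comment> \<open>A real supremum is controlled only over a nonempty bounded set: the midpoint
      settles the first, and the bound valid off \<open>Bad n\<close> the second.\<close>
    have mid: "(A + B) / 2 \<in> I" using elim by (simp add: I_def shrunk_interval_def field_simps)
    have I: "I \<subseteq> {A..B}" by (auto simp: I_def shrunk_interval_def intro: order_trans[rotated])
    show ?case
    proof (intro subsetI, rule ccontr)
      fix \<omega>
      define d where "d t = \<bar>estimated_cdf (\<phi>hat n \<omega>) t - empirical_cdf n (\<lambda>i. X n i \<omega>) t\<bar>" for t
      assume \<omega>: "\<omega> \<in> {\<omega> \<in> space M. K * rho n powr (3 / 5) < \<bar>Z n \<omega>\<bar>}"
        and "\<omega> \<notin> Bad n"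
      then have d: "d t \<le> K * rho n powr (3 / 5)" if "t \<in> I" for t
        using that I by (auto simp: Bad_def d_def not_less)
      have Z: "Z n \<omega> = (SUP t\<in>I. d t)" by (simp add: Z_def I_def d_def)
      have "Z n \<omega> \<le> K * rho n powr (3 / 5)"
        unfolding Z using mid d by (intro cSUP_least) auto
      moreover have "0 \<le> Z n \<omega>"
      proof -
        have "0 \<le> d ((A + B) / 2)" by (simp add: d_def)
        also have "\<dots> \<le> Z n \<omega>" unfolding Z by (rule cSUP_upper[OF mid bdd_aboveI2[OF d]])
        finally show ?thesis .
      qed
      ultimately show False using \<omega> by simp
    qed
  qed
  have key: "(\<lambda>n. outer_measure_of M {\<omega> \<in> space M. P n \<omega>}) \<longlonglongrightarrow> 0"
    if P: "\<forall>\<^sub>F n in sequentially. \<forall>\<omega>. P n \<omega> \<longrightarrow> K * rho n powr (3 / 5) < \<bar>Z n \<omega>\<bar>" for P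
  proof (rule tendsto_sandwich[OF _ _ tendsto_const lim])
    show "\<forall>\<^sub>F n in sequentially. outer_measure_of M {\<omega> \<in> space M. P n \<omega>} \<le> outer_measure_of M (Bad n)"
      using P sub by eventually_elim (intro outer_measure_of_mono, blast)
  qed simp
  have "bigO_prob M Z (\<lambda>n. rho n powr (3 * \<beta> / (4 * \<beta> + 2)))"
    unfolding bigO_prob_def
  \<comment> \<open>For every constant from \<open>K\<close> on the limsup is exactly 0, so the
    outer limit is that of an eventually constant function.\<close>
  proof (rule tendsto_eventually, rule eventually_mono[OF eventually_ge_at_top[of K]])
    fix D assume D: "K \<le> D"
    have "(\<lambda>n. outer_measure_of M {\<omega> \<in> space M. D * rho n powr (3 * \<beta> / (4 * \<beta> + 2)) < \<bar>Z n \<omega>\<bar>}) \<longlonglongrightarrow> 0"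
    proof (rule key)
      show "\<forall>\<^sub>F n in sequentially. \<forall>\<omega>. D * rho n powr (3 * \<beta> / (4 * \<beta> + 2)) < \<bar>Z n \<omega>\<bar> \<longrightarrow>
          K * rho n powr (3 / 5) < \<bar>Z n \<omega>\<bar>"
        using ev
      proof eventually_elim
        case (elim n)
        have "3 * \<beta> / (4 * \<beta> + 2) \<le> 3 / 5" using beta by (simp add: divide_le_eq)
        \<comment> \<open>As \<open>rho n \<le> 1\<close>, the smaller exponent gives the larger
          power.\<close>
        then have "rho n powr (3 / 5) \<le> rho n powr (3 * \<beta> / (4 * \<beta> + 2))"
          using elim by (intro powr_mono') auto
        then have "K * rho n powr (3 / 5) \<le> D * rho n powr (3 * \<beta> / (4 * \<beta> + 2))"
          using K D by (intro mult_mono) auto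
        then show ?case by auto
      qed
    qed
    then show "limsup (\<lambda>n. outer_measure_of M {\<omega> \<in> space M. D * rho n powr (3 * \<beta> / (4 * \<beta> + 2)) < \<bar>Z n \<omega>\<bar>}) = 0"
      by (rule lim_imp_Limsup[rotated]) simp
  qed
  moreover have "smallo_prob M Z (\<lambda>n. real n powr (- 1 / 2))"
    unfolding smallo_prob_def
  proof (intro allI impI key)
    fix \<epsilon> :: real assume \<epsilon>: "0 < \<epsilon>"
    \<comment> \<open>Since \<open>3 / 5 > 1 / 2\<close>, the surplus power of \<open>n\<close>
      outweighs the logarithm.\<close>
    have "\<forall>\<^sub>F n in sequentially. K * rho n powr (3 / 5) \<le> \<epsilon> * real n powr (- 1 / 2)"
      unfolding rho_def using K \<epsilon> by real_asymp
    then show "\<forall>\<^sub>F n in sequentially. \<forall>\<omega>. \<epsilon> < \<bar>Z n \<omega> / real n powr (- 1 / 2)\<bar> \<longrightarrow>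
        K * rho n powr (3 / 5) < \<bar>Z n \<omega>\<bar>"
      using eventually_gt_at_top[of 0]
    proof eventually_elim
      case (elim n)
      show ?case
      proof (intro allI impI)
        fix \<omega> assume "\<epsilon> < \<bar>Z n \<omega> / real n powr (- 1 / 2)\<bar>"
        then have "\<epsilon> * real n powr (- 1 / 2) < \<bar>Z n \<omega>\<bar>"
          using elim by (simp add: less_divide_eq)
        with elim show "K * rho n powr (3 / 5) < \<bar>Z n \<omega>\<bar>" by linarith
      qed
    qed
  qed
  ultimately show ?thesis by blast
qed

end
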